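(* Let $\mu,\nu$ be atomic measures from $S^*(\mathbb{R}^d)$ whose Fourier transforms $\hat\mu,\hat\nu$ are atomic measures with $|\hat\mu|,|\hat\nu|\in S^*(\mathbb{R}^d)$. Suppose that there exist a set $E\subset\mathbb{R}^d$, a sequence of pairwise disjoint Borel sets $\Lambda_n\subset E$, and a sequence of pairwise disjoint Borel sets $\Gamma_n\subset E$, $n=1,2,\dots$ (some of the $\Lambda_n$ or $\Gamma_n$ may be empty), such that: (i) there exist balls $B(x_k,r_k)$, $k=1,2,\dots$, with $r_k\to\infty$, $r_k/|x_k|\to0$ and $\bigcup_{k=1}^\infty B(x_k,r_k)\subset E$; (ii) $\mu|_E=\sum_n\mu|_{\Lambda_n}$ and $\nu|_E=\sum_n\nu|_{\Gamma_n}$; (iii) for some $N<\infty$, $\ \#\{n:(\Lambda_n\cup\Gamma_n)\cap B(x,1)\ne\emptyset\}\le N$ for all $x\in E$; (iv) $\operatorname{diam}(\Lambda_n\cup\Gamma_n)\to0$ and $\mu(\Lambda_n)-\nu(\Gamma_n)\to0$ as $n\to\infty$. Then the measures $\mu$ and $\nu$ coincide.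
   Context: Here $B(x,r)=\{y\in\mathbb{R}^d:|y-x|<r\}$ and $\delta_\lambda$ is the unit mass at $\lambda\in\mathbb{R}^d$. $S(\mathbb{R}^d)$ is the Schwartz space and $S^*(\mathbb{R}^d)$ its dual, the space of temperate (tempered) distributions. The Fourier transform is $\hat f(\varphi)=f(\hat\varphi)$ for $\varphi\in S(\mathbb{R}^d)$, where $\hat\varphi(y)=\int_{\mathbb{R}^d}\varphi(x)e^{-2\pi i\langle x,y\rangle}dx$. Measures are complex Radon (locally finite, not necessarily finite) measures on $\mathbb{R}^d$; $|\mu|$ is the total variation measure; a measure is said to belong to $S^*(\mathbb{R}^d)$ if the distribution it defines is (extends to) a temperate distribution. A measure $\mu$ is atomic if $\mu=\sum_{\lambda\in\Lambda}a_\lambda\delta_\lambda$ with $a_\lambda\in\mathbb{C}$ and $\Lambda$ countable; its restriction to a set $A$ is $\mu|_A=\sum_{\lambda\in\Lambda\cap A}a_\lambda\delta_\lambda$. The diameter of the empty set is $0$. Since $\operatorname{diam}(\Lambda_n\cup\Gamma_n)\to 0$, the quantities $\mu(\Lambda_n),\nu(\Gamma_n)$ are well defined for all large $n$, which is all that (iv) needs.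
   Formalization: Every set Λ_n ∪ Γ_n is required to be bounded, not only those with n large; otherwise the claim fails, e.g. for μ = Σ_{k∈ℤ} δ_k, ν = 0, E = Λ_1 = ℝ and all other sets empty. *)

theory Defs
  imports "HOL-Analysis.Analysis"
begin

subsection \<open>Schwartz space and temperate distributions\<close>

text \<open>The iterated partial derivative along a list of basis vectors; such lists play the role of
  multi-indices.\<close>

primrec iterated_partial :: "'a::euclidean_space list \<Rightarrow> ('a \<Rightarrow> complex) \<Rightarrow> 'a \<Rightarrow> complex" where
  "iterated_partial [] f = f"
| "iterated_partial (b # bs) f = (\<lambda>x. frechet_derivative (iterated_partial bs f) (at x) b)"

definition smooth_fun :: "('a::euclidean_space \<Rightarrow> complex) \<Rightarrow> bool" where
  "smooth_fun f \<longleftrightarrow> (\<forall>bs\<in>lists Basis. iterated_partial bs f differentiable_on UNIV)"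

definition schwartz_space :: "('a::euclidean_space \<Rightarrow> complex) set" where
  "schwartz_space = {f. smooth_fun f \<and>
     (\<forall>(k::nat). \<forall>bs\<in>lists Basis.
        bdd_above (range (\<lambda>x. (1 + norm x) ^ k * norm (iterated_partial bs f x))))}"

definition schwartz_seminorm ::
  "nat \<Rightarrow> 'a::euclidean_space list \<Rightarrow> ('a \<Rightarrow> complex) \<Rightarrow> real" where
  "schwartz_seminorm k bs f = (SUP x. (1 + norm x) ^ k * norm (iterated_partial bs f x))"

definition schwartz_topology :: "('a::euclidean_space \<Rightarrow> complex) topology" where
  "schwartz_topology = topology_generated_by
     {{g \<in> schwartz_space. schwartz_seminorm k bs (\<lambda>x. g x - f x) < e} | f k bs e.
        f \<in> schwartz_space \<and> bs \<in> lists Basis \<and> e > 0}"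

text \<open>Functionals are total functions; only their values on \<^const>\<open>schwartz_space\<close> matter.\<close>

definition temperate_distribution ::
  "(('a::euclidean_space \<Rightarrow> complex) \<Rightarrow> complex) \<Rightarrow> bool" where
  "temperate_distribution T \<longleftrightarrow>
     (\<forall>f\<in>schwartz_space. \<forall>g\<in>schwartz_space. T (\<lambda>x. f x + g x) = T f + T g) \<and>
     (\<forall>c. \<forall>f\<in>schwartz_space. T (\<lambda>x. c * f x) = c * T f) \<and>
     continuous_map schwartz_topology euclidean T"

definition test_functions :: "('a::euclidean_space \<Rightarrow> complex) set" where
  "test_functions = {f. smooth_fun f \<and> compact (closure {x. f x \<noteq> 0})}"

definition fourier :: "('a::euclidean_space \<Rightarrow> complex) \<Rightarrow> 'a \<Rightarrow> complex" where
  "fourier f y = (LINT x|lborel. f x * exp (- 2 * of_real pi * \<i> * of_real (x \<bullet> y)))"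

definition fourier_distribution ::
  "(('a::euclidean_space \<Rightarrow> complex) \<Rightarrow> complex) \<Rightarrow> ('a \<Rightarrow> complex) \<Rightarrow> complex" where
  "fourier_distribution T f = T (fourier f)"


subsection \<open>Complex Radon measures\<close>

text \<open>A locally finite complex measure need not have a value on unbounded sets, so it is a
  countably additive set function on the bounded Borel sets; values on other sets are
  irrelevant.  On a Euclidean space regularity is automatic.\<close>

definition bounded_borel :: "'a::euclidean_space set set" where
  "bounded_borel = {A. A \<in> sets borel \<and> bounded A}"

definition complex_radon_measure :: "('a::euclidean_space set \<Rightarrow> complex) \<Rightarrow> bool" where
  "complex_radon_measure m \<longleftrightarrow>
     (\<forall>A :: nat \<Rightarrow> 'a set. range A \<subseteq> bounded_borel \<and> disjoint_family A \<and> (\<Union>n. A n) \<in> bounded_borel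
        \<longrightarrow> (\<lambda>n. m (A n)) sums m (\<Union>n. A n))"

text \<open>The supremum is finite for every complex Radon measure and bounded Borel set \<open>A\<close>.\<close>

definition total_variation ::
  "('a::euclidean_space set \<Rightarrow> complex) \<Rightarrow> 'a set \<Rightarrow> complex" where
  "total_variation m A = of_real
     (SUP P\<in>{P. finite P \<and> P \<subseteq> sets borel \<and> disjoint P \<and> \<Union>P = A}. \<Sum>B\<in>P. norm (m B))"

definition atomic_measure :: "('a::euclidean_space set \<Rightarrow> complex) \<Rightarrow> bool" where
  "atomic_measure m \<longleftrightarrow> complex_radon_measure m \<and>
     (\<exists>L a. countable L \<and> (\<forall>A\<in>bounded_borel. (a has_sum m A) (L \<inter> A)))"

text \<open>For an atomic measure \<open>m = \<Sum> a\<^sub>\<lambda> \<delta>\<^sub>\<lambda>\<close> one has \<open>a\<^sub>\<lambda> = m {\<lambda>}\<close>.  The next two notions are only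
  meaningful for atomic measures; the restriction is to an arbitrary set \<open>S\<close>.\<close>

definition atomic_restriction ::
  "('a::euclidean_space set \<Rightarrow> complex) \<Rightarrow> 'a set \<Rightarrow> 'a set \<Rightarrow> complex" where
  "atomic_restriction m S A = (\<Sum>\<^sub>\<infinity>x\<in>S \<inter> A. m {x})"

definition atomic_integral ::
  "('a::euclidean_space set \<Rightarrow> complex) \<Rightarrow> ('a \<Rightarrow> complex) \<Rightarrow> complex" where
  "atomic_integral m f = (\<Sum>\<^sub>\<infinity>x. m {x} * f x)"

text \<open>The temperate distribution extending a given measure is unique on \<^const>\<open>schwartz_space\<close>,
  since test functions are dense there.\<close>

definition extends_atomic_measure ::
  "(('a::euclidean_space \<Rightarrow> complex) \<Rightarrow> complex) \<Rightarrow> ('a set \<Rightarrow> complex) \<Rightarrow> bool" where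
  "extends_atomic_measure T m \<longleftrightarrow> (\<forall>f\<in>test_functions. T f = atomic_integral m f)"

definition temperate_atomic_measure :: "('a::euclidean_space set \<Rightarrow> complex) \<Rightarrow> bool" where
  "temperate_atomic_measure m \<longleftrightarrow> (\<exists>T. temperate_distribution T \<and> extends_atomic_measure T m)"

definition has_fourier_measure ::
  "('a::euclidean_space set \<Rightarrow> complex) \<Rightarrow> ('a set \<Rightarrow> complex) \<Rightarrow> bool" where
  "has_fourier_measure m m' \<longleftrightarrow>
     (\<exists>T. temperate_distribution T \<and> extends_atomic_measure T m \<and>
          extends_atomic_measure (fourier_distribution T) m')"

end

theory Submission
  imports Defs
begin

text \<open>Put \<open>\<rho> = \<mu> - \<nu>\<close>.  For a test function \<open>\<phi>\<close>, the function \<open>\<tau> \<mapsto> \<integral> \<phi> (t - \<tau>) d\<rho>(t)\<close> is, up to a constant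
  factor, the absolutely convergent series with frequencies \<open>\<gamma>\<close> and coefficients
  \<open>\<rho>hat {\<gamma>} * fourier \<phi> (- \<gamma>)\<close>, hence almost periodic, and its almost periods reach into the large
  balls contained in \<open>E\<close>.  There at most \<open>N\<close> tiny clusters of nearly vanishing \<open>\<rho>\<close>-mass are visible
  near a point.  The total variation of a cluster may be large, so the oscillation of \<open>\<phi>\<close> on a cluster
  has to be avoided altogether: among \<open>N + 1\<close> concentric plateau functions at least one is constant on
  every cluster, and for this one the integral is small.  Going back by an almost period,
  \<open>\<rho> {q}\<close> is arbitrarily small for every point \<open>q\<close>.

  The series is obtained without Fourier inversion.  If \<open>k = fourier \<psi>\<close> with \<open>\<psi>\<close> a test function and
  \<open>\<integral> k \<noteq> 0\<close> (for instance \<open>\<psi> = h * h\<close> with an even real bump \<open>h\<close>), then the averages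
  \<open>y \<mapsto> \<integral> \<phi> (y - v / n) k(v) dv\<close> converge to \<open>(\<integral> k) \<phi>\<close> in the Schwartz space, and by Fubini they are
  Fourier transforms of the test functions \<open>s \<mapsto> \<psi> (s / n) * fourier \<phi> (- s)\<close>.\<close>

section \<open>Smooth functions\<close>

text \<open>The hypothesis on \<open>|\<mu>hat|\<close> and \<open>|\<nu>hat|\<close> enters through
  one consequence: the mass of their atoms grows polynomially. Against the rapid decay of
  \<open>fourier \<phi>\<close> this makes the frequency series absolutely convergent, hence up to a
  small error finite, and then \<tau> is an almost period as soon as finitely many characters are
  nearly \<open>1\<close> at \<tau>.

  The order of choices shapes the argument. Which clusters are visible depends on the almost period,
  so the harmless plateau function is known only after \<tau>; therefore one \<tau> must serve all
  \<open>N + 1\<close> of them and both measures. Their radii are fixed beforehand: \<open>d\<close>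
  is so small that atoms near \<open>q\<close> other than \<open>q\<close> itself contribute at most
  \<epsilon>, and \<open>g = d / (2 * N + 2)\<close> fits \<open>N + 1\<close> annuli of width
  \<open>g\<close>, with gaps \<open>g\<close>, into \<open>ball q d\<close>. The ball of index
  \<open>k\<close> comes last: its radius exceeds the density constant \<open>L\<close> of the
  almost periods, and its centre is so remote that the finitely many clusters that are not yet small
  are out of sight. At most \<open>N\<close> clusters cost \<open>N * \<epsilon>\<close>;
  translation and localisation cost \<epsilon> each for each measure, whence
  \<open>N + 4\<close>.\<close>

declare iterated_partial.simps(2) [simp del]

abbreviation partial :: "'a::euclidean_space \<Rightarrow> ('a \<Rightarrow> complex) \<Rightarrow> 'a \<Rightarrow> complex" where
  "partial b f \<equiv> iterated_partial [b] f"

lemma iterated_partial_append: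
  "iterated_partial (bs @ cs) f = iterated_partial bs (iterated_partial cs f)"
  by (induction bs) (auto simp: iterated_partial.simps)

lemma partial_eq: "partial b f = (\<lambda>x. frechet_derivative f (at x) b)"
  by (simp add: iterated_partial.simps)

text \<open>Coinduction: a family of differentiable functions that is closed under partial
  derivatives contains all iterated partial derivatives of its members. Smoothness is thus shown
  without computing any higher derivative; the work is to find a closed family.\<close>

lemma smooth_fun_coinduct:
  assumes "f \<in> F"
    and step: "\<And>g. g \<in> F \<Longrightarrow>
      \<exists>D. (\<forall>x. (g has_derivative D x) (at x)) \<and> (\<forall>b\<in>Basis. (\<lambda>x. D x b) \<in> F)"
  shows "smooth_fun f"
proof -
  have diff: "g differentiable_on UNIV" if "g \<in> F" for g
    using step[OF that] by (auto simp: differentiable_on_def differentiable_def)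
  have part: "(\<lambda>x. frechet_derivative g (at x) b) \<in> F" if "g \<in> F" "b \<in> Basis" for g b
  proof -
    from step[OF that(1)] obtain D
      where D: "\<And>x. (g has_derivative D x) (at x)" "\<And>b. b \<in> Basis \<Longrightarrow> (\<lambda>x. D x b) \<in> F"
      by blast
    have "frechet_derivative g (at x) = D x" for x
      using frechet_derivative_at[OF D(1)] by simp
    with D(2)[OF that(2)] show ?thesis by simp
  qed
  have "iterated_partial bs f \<in> F" if "bs \<in> lists Basis" for bs
    using that by (induction bs) (auto simp: iterated_partial.simps intro: part \<open>f \<in> F\<close>)
  then show ?thesis
    unfolding smooth_fun_def using diff by blast
qed

lemma smooth_fun_iterated_partial:
  assumes "smooth_fun f" "cs \<in> lists Basis"
  shows "smooth_fun (iterated_partial cs f)"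
  unfolding smooth_fun_def
proof
  fix bs :: "'a list" assume "bs \<in> lists Basis"
  then have "bs @ cs \<in> lists Basis" using assms by simp
  then show "iterated_partial bs (iterated_partial cs f) differentiable_on UNIV"
    using assms(1) unfolding smooth_fun_def iterated_partial_append[symmetric] by blast
qed

lemma smooth_fun_has_derivative:
  assumes "smooth_fun f"
  shows "(f has_derivative frechet_derivative f (at x)) (at x)"
proof -
  have "iterated_partial [] f differentiable_on UNIV"
    using assms unfolding smooth_fun_def by blast
  then show ?thesis
    by (simp add: differentiable_on_def frechet_derivative_works)
qed

lemma smooth_fun_continuous: "smooth_fun f \<Longrightarrow> continuous_on A f"
  by (meson continuous_at_imp_continuous_on has_derivative_continuous smooth_fun_has_derivative)

lemma smooth_fun_measurable: "smooth_fun f \<Longrightarrow> f \<in> borel_measurable borel"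
  by (rule borel_measurable_continuous_onI[OF smooth_fun_continuous])

lemma frechet_derivative_eq_sum:
  assumes "smooth_fun f"
  shows "frechet_derivative f (at x) h = (\<Sum>b\<in>Basis. (h \<bullet> b) *\<^sub>R partial b f x)"
proof -
  have lin: "linear (frechet_derivative f (at x))"
    using has_derivative_linear[OF smooth_fun_has_derivative[OF assms]] .
  have "frechet_derivative f (at x) (\<Sum>b\<in>Basis. (h \<bullet> b) *\<^sub>R b)
      = (\<Sum>b\<in>Basis. (h \<bullet> b) *\<^sub>R frechet_derivative f (at x) b)"
    by (simp add: linear_sum[OF lin] linear_cmul[OF lin])
  then show ?thesis by (simp add: euclidean_representation partial_eq)
qed

lemma smooth_fun_const: "smooth_fun (\<lambda>_. c)"
  by (rule smooth_fun_coinduct[where F = "range (\<lambda>c _. c)"])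
     (auto intro!: exI[of _ "\<lambda>_ _. 0"])

lemma smooth_fun_linear: "smooth_fun (\<lambda>x. of_real (x \<bullet> v))"
proof (rule smooth_fun_coinduct[where F = "insert (\<lambda>x. of_real (x \<bullet> v)) (range (\<lambda>c _. c))"])
  fix g :: "'a \<Rightarrow> complex"
  assume "g \<in> insert (\<lambda>x. of_real (x \<bullet> v)) (range (\<lambda>c _. c))"
  then consider "g = (\<lambda>x. of_real (x \<bullet> v))" | c where "g = (\<lambda>_. c)" by auto
  then show "\<exists>D. (\<forall>x. (g has_derivative D x) (at x)) \<and>
      (\<forall>b\<in>Basis. (\<lambda>x. D x b) \<in> insert (\<lambda>x. of_real (x \<bullet> v)) (range (\<lambda>c _. c)))"
  proof cases
    case 1
    then show ?thesis
      by (intro exI[of _ "\<lambda>_ h. of_real (h \<bullet> v)"]) (auto intro!: derivative_eq_intros)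
  next
    case 2
    then show ?thesis by (intro exI[of _ "\<lambda>_ _. 0"]) auto
  qed
qed simp

text \<open>A closed family for \<open>smooth_fun_coinduct\<close>: the product rule leads out of
  the products of two smooth functions, but not out of their finite sums.\<close>

inductive_set smooth_products :: "('a::euclidean_space \<Rightarrow> complex) set" where
  prod: "smooth_fun f \<Longrightarrow> smooth_fun g \<Longrightarrow> (\<lambda>x. f x * g x) \<in> smooth_products"
| add: "f \<in> smooth_products \<Longrightarrow> g \<in> smooth_products \<Longrightarrow> (\<lambda>x. f x + g x) \<in> smooth_products"

lemma smooth_products_smooth:
  assumes "f \<in> smooth_products"
  shows "smooth_fun f"
  using assms
proof (rule smooth_fun_coinduct)
  fix g :: "'a \<Rightarrow> complex"
  assume "g \<in> smooth_products"
  then show "\<exists>D. (\<forall>x. (g has_derivative D x) (at x)) \<and> (\<forall>b\<in>Basis. (\<lambda>x. D x b) \<in> smooth_products)"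
  proof induction
    case (prod f g)
    let ?D = "\<lambda>x h. f x * frechet_derivative g (at x) h + frechet_derivative f (at x) h * g x"
    have "((\<lambda>x. f x * g x) has_derivative ?D x) (at x)" for x
      by (rule has_derivative_mult) (use prod smooth_fun_has_derivative in auto)
    moreover have "(\<lambda>x. ?D x b) \<in> smooth_products" if "b \<in> Basis" for b
    proof -
      have "smooth_fun (partial b f)" "smooth_fun (partial b g)"
        using prod that by (auto intro!: smooth_fun_iterated_partial)
      then show ?thesis
        using prod unfolding partial_eq by (intro smooth_products.intros)
    qed
    ultimately show ?case by (intro exI[of _ ?D]) blast
  next
    case (add f g)
    then obtain D D' where "\<forall>x. (f has_derivative D x) (at x)" "\<forall>b\<in>Basis. (\<lambda>x. D x b) \<in> smooth_products"
       "\<forall>x. (g has_derivative D' x) (at x)" "\<forall>b\<in>Basis. (\<lambda>x. D' x b) \<in> smooth_products" by blast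
    then show ?case
      by (intro exI[of _ "\<lambda>x h. D x h + D' x h"]) (auto intro!: smooth_products.intros has_derivative_add)
  qed
qed

lemma smooth_fun_mult: "smooth_fun f \<Longrightarrow> smooth_fun g \<Longrightarrow> smooth_fun (\<lambda>x. f x * g x)"
  by (rule smooth_products_smooth, rule smooth_products.prod)

lemma smooth_fun_add:
  assumes "smooth_fun f" "smooth_fun g"
  shows "smooth_fun (\<lambda>x. f x + g x)"
proof -
  have "(\<lambda>x. f x * 1 + g x * 1) \<in> smooth_products"
    by (intro smooth_products.intros assms smooth_fun_const)
  then show ?thesis using smooth_products_smooth by force
qed

lemma smooth_fun_cmult: "smooth_fun f \<Longrightarrow> smooth_fun (\<lambda>x. c * f x)"
  by (intro smooth_fun_mult smooth_fun_const)

lemma iterated_partial_add_cmult: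
  assumes "smooth_fun f" "smooth_fun g" "bs \<in> lists Basis"
  shows "iterated_partial bs (\<lambda>x. f x + c * g x)
    = (\<lambda>x. iterated_partial bs f x + c * iterated_partial bs g x)"
  using assms(3)
proof (induction bs)
  case (Cons b bs)
  then have IH: "iterated_partial bs (\<lambda>x. f x + c * g x) =
    (\<lambda>x. iterated_partial bs f x + c * iterated_partial bs g x)" and bs: "bs \<in> lists Basis" by auto
  let ?f = "iterated_partial bs f" and ?g = "iterated_partial bs g"
  have "frechet_derivative (\<lambda>x. ?f x + c * ?g x) (at x)
      = (\<lambda>h. frechet_derivative ?f (at x) h + c * frechet_derivative ?g (at x) h)" for x
    by (rule frechet_derivative_at[symmetric])
       (intro has_derivative_add has_derivative_mult_right smooth_fun_has_derivative
         smooth_fun_iterated_partial assms bs)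
  then show ?case by (simp add: iterated_partial.simps IH)
qed simp

lemma has_derivative_affine_compose:
  assumes "(f has_derivative D) (at (a + c *\<^sub>R x))"
  shows "((\<lambda>x. f (a + c *\<^sub>R x)) has_derivative (\<lambda>h. D (c *\<^sub>R h))) (at x)"
proof (rule has_derivative_compose[where g = f])
  show "((\<lambda>x. a + c *\<^sub>R x) has_derivative (\<lambda>h. c *\<^sub>R h)) (at x)"
    by (auto intro!: derivative_eq_intros)
qed (rule assms)

lemma iterated_partial_affine:
  assumes "smooth_fun f" "bs \<in> lists Basis"
  shows "iterated_partial bs (\<lambda>x. f (a + c *\<^sub>R x))
    = (\<lambda>x. of_real c ^ length bs * iterated_partial bs f (a + c *\<^sub>R x))"
  using assms(2)
proof (induction bs)
  case (Cons b bs)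
  then have IH: "iterated_partial bs (\<lambda>x. f (a + c *\<^sub>R x)) =
     (\<lambda>x. of_real c ^ length bs * iterated_partial bs f (a + c *\<^sub>R x))" and bs: "bs \<in> lists Basis" by auto
  let ?f = "iterated_partial bs f"
  have "frechet_derivative (\<lambda>x. of_real c ^ length bs * ?f (a + c *\<^sub>R x)) (at x)
     = (\<lambda>h. of_real c ^ length bs * frechet_derivative ?f (at (a + c *\<^sub>R x)) (c *\<^sub>R h))" for x
    by (intro frechet_derivative_at[symmetric] has_derivative_mult_right has_derivative_affine_compose
      smooth_fun_has_derivative smooth_fun_iterated_partial assms bs)
  moreover have "linear (frechet_derivative ?f (at y))" for y
    using has_derivative_linear[OF smooth_fun_has_derivative] smooth_fun_iterated_partial assms bs by blast
  ultimately show ?case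
    by (simp add: iterated_partial.simps IH linear_cmul scaleR_conv_of_real mult_ac)
qed simp

lemma smooth_fun_affine:
  assumes "smooth_fun f"
  shows "smooth_fun (\<lambda>x. f (a + c *\<^sub>R x))"
  unfolding smooth_fun_def
proof
  fix bs :: "'a list" assume bs: "bs \<in> lists Basis"
  have "smooth_fun (iterated_partial bs f)" using assms bs by (rule smooth_fun_iterated_partial)
  then have "((\<lambda>x. iterated_partial bs f (a + c *\<^sub>R x)) has_derivative
       (\<lambda>h. frechet_derivative (iterated_partial bs f) (at (a + c *\<^sub>R x)) (c *\<^sub>R h))) (at x)" for x
    by (intro has_derivative_affine_compose smooth_fun_has_derivative)
  then have "(\<lambda>x. of_real c ^ length bs * iterated_partial bs f (a + c *\<^sub>R x)) differentiable (at x)" for x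
    by (intro differentiableI[OF has_derivative_mult_right])
  then show "iterated_partial bs (\<lambda>x. f (a + c *\<^sub>R x)) differentiable_on UNIV"
    by (simp add: iterated_partial_affine[OF assms bs] differentiable_on_def)
qed

section \<open>Test functions\<close>

lemma test_functions_iff:
  "f \<in> test_functions \<longleftrightarrow> smooth_fun f \<and> (\<exists>R. \<forall>x. R < norm x \<longrightarrow> f x = 0)"
proof -
  have "(\<forall>x\<in>{x. f x \<noteq> 0}. norm x \<le> R) \<longleftrightarrow> (\<forall>x. R < norm x \<longrightarrow> f x = 0)" for R
    by (simp, meson not_le)
  then have "compact (closure {x. f x \<noteq> 0}) \<longleftrightarrow> (\<exists>R. \<forall>x. R < norm x \<longrightarrow> f x = 0)"
    unfolding compact_closure bounded_iff by simp
  then show ?thesis by (simp add: test_functions_def)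
qed

lemma test_function_smooth: "f \<in> test_functions \<Longrightarrow> smooth_fun f"
  by (simp add: test_functions_iff)

lemma test_function_support:
  assumes "f \<in> test_functions"
  shows "\<exists>R>0. \<forall>x. R \<le> norm x \<longrightarrow> f x = 0"
proof -
  obtain R where "\<forall>x. R < norm x \<longrightarrow> f x = 0" using assms by (auto simp: test_functions_iff)
  then show ?thesis by (intro exI[of _ "\<bar>R\<bar> + 1"]) auto
qed

lemma test_function_partial:
  assumes "f \<in> test_functions" "b \<in> Basis"
  shows "partial b f \<in> test_functions"
proof -
  obtain R where R: "R > 0" "\<And>x. R \<le> norm x \<Longrightarrow> f x = 0" using test_function_support[OF assms(1)] by blast
  have "partial b f x = 0" if "R < norm x" for x
  proof -
    have "(f has_derivative (\<lambda>_. 0)) (at x)"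
    proof (rule has_derivative_transform_within_open[of "\<lambda>_. 0" _ _ _ "{x. R < norm x}"])
      show "open {x::'a. R < norm x}" by (intro open_Collect_less continuous_intros)
    qed (use that R in auto)
    from frechet_derivative_at[OF this] show ?thesis by (simp add: partial_eq fun_eq_iff)
  qed
  moreover have "smooth_fun (partial b f)"
    using smooth_fun_iterated_partial[OF test_function_smooth[OF assms(1)], of "[b]"] assms(2) by simp
  ultimately show ?thesis unfolding test_functions_iff by blast
qed

lemma test_function_iterated_partial:
  assumes "f \<in> test_functions" "bs \<in> lists Basis"
  shows "iterated_partial bs f \<in> test_functions"
  using assms(2)
proof (induction bs)
  case (Cons b bs)
  then have "partial b (iterated_partial bs f) \<in> test_functions"
    by (intro test_function_partial) auto
  then show ?case by (simp add: iterated_partial.simps)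
qed (use assms in simp)

lemma test_function_mult_smooth:
  assumes "f \<in> test_functions" "smooth_fun g"
  shows "(\<lambda>x. f x * g x) \<in> test_functions"
proof -
  obtain R where "\<forall>x. R < norm x \<longrightarrow> f x = 0" using assms by (auto simp: test_functions_iff)
  then have "\<forall>x. R < norm x \<longrightarrow> f x * g x = 0" by simp
  then show ?thesis using assms smooth_fun_mult unfolding test_functions_iff by blast
qed

lemma test_function_affine:
  assumes "f \<in> test_functions" "c \<noteq> 0"
  shows "(\<lambda>x. f (a + c *\<^sub>R x)) \<in> test_functions"
proof -
  obtain R where R: "R > 0" "\<And>x. R \<le> norm x \<Longrightarrow> f x = 0" using test_function_support[OF assms(1)] by blast
  have "f (a + c *\<^sub>R x) = 0" if "(R + norm a) / \<bar>c\<bar> < norm x" for x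
  proof -
    have "R + norm a < \<bar>c\<bar> * norm x" using that assms(2) by (simp add: field_simps)
    then have "R \<le> norm (a + c *\<^sub>R x)" using norm_diff_ineq[of "c *\<^sub>R x" a] by (simp add: add.commute)
    then show ?thesis by (rule R)
  qed
  then show ?thesis
    using assms by (auto simp: test_functions_iff intro!: smooth_fun_affine)
qed

lemma compactly_supported_bounded:
  fixes f :: "'a::euclidean_space \<Rightarrow> complex"
  assumes "continuous_on UNIV f" "\<And>x. R \<le> norm x \<Longrightarrow> f x = 0"
  obtains B where "B \<ge> 0" "\<And>x. norm (f x) \<le> B"
proof -
  have "compact (f ` cball 0 R)"
    using assms(1) by (intro compact_continuous_image) (auto intro: continuous_on_subset)
  then obtain B where B: "\<And>x. x \<in> cball 0 R \<Longrightarrow> norm (f x) \<le> B"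
    by (meson compact_imp_bounded bounded_iff imageI)
  have "norm (f x) \<le> \<bar>B\<bar>" for x
    using B[of x] assms(2)[of x] by (cases "norm x \<le> R") auto
  then show ?thesis by (intro that[of "\<bar>B\<bar>"]) auto
qed

lemma compactly_supported_integrable:
  fixes f :: "'a::euclidean_space \<Rightarrow> complex"
  assumes "continuous_on UNIV f" "\<And>x. R \<le> norm x \<Longrightarrow> f x = 0"
  shows "integrable lborel f"
proof -
  have "integrable lborel (\<lambda>x. indicator (cball 0 R) x *\<^sub>R f x)"
    using assms(1) by (intro borel_integrable_compact) (auto intro: continuous_on_subset)
  also have "(\<lambda>x. indicator (cball 0 R) x *\<^sub>R f x) = f"
    using assms(2) by (auto simp: indicator_def fun_eq_iff)
  finally show ?thesis .
qed

lemma test_function_bounded: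
  assumes "f \<in> test_functions"
  obtains B where "B \<ge> 0" "\<And>x. norm (f x) \<le> B"
proof -
  obtain R where "R > 0" "\<And>x. R \<le> norm x \<Longrightarrow> f x = 0" using test_function_support[OF assms] by blast
  then show ?thesis
    using compactly_supported_bounded[OF smooth_fun_continuous[OF test_function_smooth[OF assms]]] that
    by blast
qed

lemma test_function_integrable:
  assumes "f \<in> test_functions"
  shows "integrable lborel f"
proof -
  obtain R where "R > 0" "\<And>x. R \<le> norm x \<Longrightarrow> f x = 0" using test_function_support[OF assms] by blast
  then show ?thesis
    using compactly_supported_integrable[OF smooth_fun_continuous[OF test_function_smooth[OF assms]]]
    by blast
qed

lemma norm_inner_Basis_sum_le:
  "norm (\<Sum>b\<in>Basis. (h \<bullet> b) *\<^sub>R (z b :: complex)) \<le> norm h * (\<Sum>b\<in>Basis. norm (z b))"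
proof -
  have "norm (\<Sum>b\<in>Basis. (h \<bullet> b) *\<^sub>R z b) \<le> (\<Sum>b\<in>Basis. norm h * norm (z b))"
    by (intro sum_norm_le) (auto intro!: mult_right_mono simp: Basis_le_norm)
  then show ?thesis by (simp add: sum_distrib_left)
qed

lemma test_function_lipschitz:
  assumes "f \<in> test_functions"
  obtains L where "L \<ge> 0" "\<And>x y. norm (f x - f y) \<le> L * norm (x - y)"
proof -
  have "\<exists>B\<ge>0. \<forall>x. norm (partial b f x) \<le> B" if "b \<in> Basis" for b
    using test_function_bounded[OF test_function_partial[OF assms that]] by metis
  then obtain B where B: "\<And>b. b \<in> Basis \<Longrightarrow> B b \<ge> 0" "\<And>b x. b \<in> Basis \<Longrightarrow> norm (partial b f x) \<le> B b"
    by metis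
  have "norm (f x - f y) \<le> (\<Sum>b\<in>Basis. B b) * norm (x - y)" for x y
  proof (rule differentiable_bound[where S = UNIV])
    fix z :: 'a
    show "(f has_derivative frechet_derivative f (at z)) (at z within UNIV)"
      using smooth_fun_has_derivative[OF test_function_smooth[OF assms]] by simp
    have "norm (frechet_derivative f (at z) h) \<le> (\<Sum>b\<in>Basis. B b) * norm h" for h
      unfolding frechet_derivative_eq_sum[OF test_function_smooth[OF assms]]
      by (rule order_trans[OF norm_inner_Basis_sum_le])
         (auto simp: mult.commute[of _ "norm h"] intro!: mult_left_mono sum_mono B)
    then show "onorm (frechet_derivative f (at z)) \<le> (\<Sum>b\<in>Basis. B b)" by (rule onorm_le)
  qed auto
  then show ?thesis by (intro that[of "\<Sum>b\<in>Basis. B b"]) (auto intro!: sum_nonneg B)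
qed

text \<open>The partial derivatives are test functions again, hence Lipschitz, so the linearisation
  error is quadratic with one constant for all base points. This uniformity is what allows the
  remainder to be integrated in \<open>smear_has_derivative\<close>.\<close>

lemma test_function_quadratic_remainder:
  assumes "f \<in> test_functions"
  obtains C where "C \<ge> 0"
    "\<And>x h. norm (f (x + h) - f x - (\<Sum>b\<in>Basis. (h \<bullet> b) *\<^sub>R partial b f x)) \<le> C * norm h ^ 2"
proof -
  note sm = test_function_smooth[OF assms]
  have "\<exists>L\<ge>0. \<forall>x y. norm (partial b f x - partial b f y) \<le> L * norm (x - y)" if "b \<in> Basis" for b
    using test_function_lipschitz[OF test_function_partial[OF assms that]] by metis
  then obtain L where L: "\<And>b. b \<in> Basis \<Longrightarrow> L b \<ge> 0"
      "\<And>b x y. b \<in> Basis \<Longrightarrow> norm (partial b f x - partial b f y) \<le> L b * norm (x - y)"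
    by metis
  define C where "C = (\<Sum>b\<in>Basis. L b)"
  have C0: "C \<ge> 0" unfolding C_def by (intro sum_nonneg L)
  have "norm (f (x + h) - f x - (\<Sum>b\<in>Basis. (h \<bullet> b) *\<^sub>R partial b f x)) \<le> C * norm h ^ 2" for x h
  proof -
    have "norm (f (x + h) - f x - frechet_derivative f (at x) ((x + h) - x))
        \<le> norm ((x + h) - x) * (C * norm h)"
    proof (rule differentiable_bound_linearization[where S = "cball x (norm h)"])
      fix z assume z: "z \<in> cball x (norm h)"
      show "(f has_derivative frechet_derivative f (at z)) (at z within cball x (norm h))"
        using smooth_fun_has_derivative[OF sm] has_derivative_at_withinI by blast
      have "norm ((frechet_derivative f (at z) - frechet_derivative f (at x)) k) \<le> C * norm h * norm k" for k
      proof -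
        have "norm ((frechet_derivative f (at z) - frechet_derivative f (at x)) k)
            = norm (\<Sum>b\<in>Basis. (k \<bullet> b) *\<^sub>R (partial b f z - partial b f x))"
          unfolding minus_apply frechet_derivative_eq_sum[OF sm] by (simp only: scaleR_diff_right sum_subtractf)
        also have "\<dots> \<le> norm k * (\<Sum>b\<in>Basis. norm (partial b f z - partial b f x))"
          by (rule norm_inner_Basis_sum_le)
        also have "\<dots> \<le> norm k * (\<Sum>b\<in>Basis. L b * norm h)"
        proof (intro mult_left_mono sum_mono)
          fix b :: 'a assume b: "b \<in> Basis"
          have "norm (z - x) \<le> norm h" using z by (simp add: dist_norm norm_minus_commute)
          then have "L b * norm (z - x) \<le> L b * norm h" using L(1)[OF b] by (rule mult_left_mono)
          with L(2)[OF b, of z x] show "norm (partial b f z - partial b f x) \<le> L b * norm h" by linarith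
        qed simp
        finally show ?thesis by (simp only: C_def sum_distrib_right[symmetric] mult_ac)
      qed
      then show "onorm (frechet_derivative f (at z) - frechet_derivative f (at x)) \<le> C * norm h"
        by (rule onorm_le)
    qed (auto simp: dist_norm mult_left_le_one_le)
    then show ?thesis
      unfolding frechet_derivative_eq_sum[OF sm] by (simp add: power2_eq_square mult_ac)
  qed
  with C0 show ?thesis by (rule that)
qed

section \<open>Differentiation under the integral sign\<close>

lemma has_derivative_quadratic_remainder:
  assumes "bounded_linear D" "\<And>h. norm (f (y + h) - f y - D h) \<le> C * norm h ^ 2"
  shows "(f has_derivative D) (at y)"
  unfolding has_derivative_at
proof
  have "((\<lambda>h. C * norm h) \<longlongrightarrow> 0) (at 0)"
    by (auto intro!: tendsto_eq_intros)
  then show "((\<lambda>h. norm (f (y + h) - f y - D h) / norm h) \<longlongrightarrow> 0) (at 0)"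
  proof (rule Lim_null_comparison[rotated])
    show "\<forall>\<^sub>F h in at 0. norm (norm (f (y + h) - f y - D h) / norm h) \<le> C * norm h"
      using assms(2) by (auto simp: eventually_at_filter field_simps power2_eq_square)
  qed
qed (rule assms)

lemma bounded_linear_inner_Basis_sum:
  "bounded_linear (\<lambda>h. \<Sum>b\<in>Basis. (h \<bullet> b) *\<^sub>R (z b :: complex))"
  by (intro bounded_linear_sum bounded_linear_scaleR_const bounded_linear_inner_left)

lemma inner_Basis_sum_Basis:
  "b \<in> Basis \<Longrightarrow> (\<Sum>b'\<in>Basis. (b \<bullet> b') *\<^sub>R (z b' :: complex)) = z b"
  by (subst sum.remove[of _ b]) (auto simp: inner_Basis split: if_splits intro!: sum.neutral)

text \<open>Takes the place of dominated convergence: integrating the pointwise bound, with its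
  integrable weight \<open>w\<close>, leaves a quadratic remainder for the integral whose constant
  is the integral of \<open>w\<close>.\<close>

lemma has_derivative_integral:
  fixes f :: "'a::euclidean_space \<Rightarrow> 'b \<Rightarrow> complex"
  assumes "\<And>y. integrable M (f y)" "\<And>b. b \<in> Basis \<Longrightarrow> integrable M (g b)" "integrable M w"
    and bound: "\<And>h t. norm (f (y + h) t - f y t - (\<Sum>b\<in>Basis. (h \<bullet> b) *\<^sub>R g b t)) \<le> norm h ^ 2 * w t"
  shows "((\<lambda>y. \<integral>t. f y t \<partial>M) has_derivative (\<lambda>h. \<Sum>b\<in>Basis. (h \<bullet> b) *\<^sub>R (\<integral>t. g b t \<partial>M))) (at y)"
proof (rule has_derivative_quadratic_remainder[OF bounded_linear_inner_Basis_sum])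
  fix h :: 'a
  have "(\<integral>t. f (y + h) t \<partial>M) - (\<integral>t. f y t \<partial>M) - (\<Sum>b\<in>Basis. (h \<bullet> b) *\<^sub>R (\<integral>t. g b t \<partial>M))
     = (\<integral>t. f (y + h) t - f y t - (\<Sum>b\<in>Basis. (h \<bullet> b) *\<^sub>R g b t) \<partial>M)"
    using assms(1,2) by simp
  also have "norm \<dots> \<le> (\<integral>t. norm h ^ 2 * w t \<partial>M)"
    using assms
    by (intro order_trans[OF integral_norm_bound] integral_mono integrable_norm
      Bochner_Integration.integrable_diff Bochner_Integration.integrable_sum) auto
  finally show "norm ((\<integral>t. f (y + h) t \<partial>M) - (\<integral>t. f y t \<partial>M)
      - (\<Sum>b\<in>Basis. (h \<bullet> b) *\<^sub>R (\<integral>t. g b t \<partial>M))) \<le> (\<integral>t. w t \<partial>M) * norm h ^ 2"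
    by (simp add: mult.commute)
qed

lemma integral_affine:
  fixes f :: "'a::euclidean_space \<Rightarrow> complex"
  assumes "c \<noteq> 0" and [measurable]: "f \<in> borel_measurable borel"
  shows "(\<integral>x. f x \<partial>lborel) = \<bar>c\<bar> ^ DIM('a) *\<^sub>R (\<integral>x. f (t + c *\<^sub>R x) \<partial>lborel)"
  by (subst lborel_affine[OF assms(1), of t]) (simp add: integral_density integral_distr)

lemma integrable_affine:
  fixes f :: "'a::euclidean_space \<Rightarrow> complex"
  assumes "c \<noteq> 0" "integrable lborel f"
  shows "integrable lborel (\<lambda>x. f (t + c *\<^sub>R x))"
proof -
  have [measurable]: "f \<in> borel_measurable borel" using assms(2) by simp
  have "integrable (density (distr lborel borel (\<lambda>x. t + c *\<^sub>R x)) (\<lambda>_. \<bar>c\<bar> ^ DIM('a))) f"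
    using assms(2) lborel_affine[OF assms(1), of t] by simp
  then have "integrable lborel (\<lambda>x. \<bar>c\<bar> ^ DIM('a) *\<^sub>R f (t + c *\<^sub>R x))"
    by (simp add: integrable_density integrable_distr_eq)
  from integrable_scaleR_right[OF this, of "1 / \<bar>c\<bar> ^ DIM('a)"] assms(1)
  show ?thesis by simp
qed

lemma integrable_indicator_ball:
  "integrable lborel (indicator (ball (a::'a::euclidean_space) r) :: 'a \<Rightarrow> complex)"
  using integrable_of_real[OF integrable_real_indicator[of "ball a r" lborel]]
    emeasure_bounded_finite[of "ball a r"]
  by (simp add: of_real_indicator)

section \<open>A bump function\<close>

text \<open>\<open>flat 0\<close> is the classical smooth function vanishing to infinite order at
  \<open>0\<close>. The negative powers of \<open>t\<close> are included because differentiation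
  produces them: the derivative of \<open>flat n\<close> is a combination of
  \<open>flat (n + 2)\<close> and \<open>flat (n + 1)\<close>.\<close>

definition flat :: "nat \<Rightarrow> real \<Rightarrow> real" where
  "flat n t = (if t \<le> 0 then 0 else exp (- 1 / t) / t ^ n)"

lemma power_over_fact_le_exp:
  fixes x :: real
  assumes "x \<ge> 0"
  shows "x ^ n / fact n \<le> exp x"
proof -
  have "(\<Sum>k\<in>{n}. x ^ k /\<^sub>R fact k) \<le> (\<Sum>k. x ^ k /\<^sub>R fact k)"
    using assms by (intro sum_le_suminf summable_exp_generic) auto
  then show ?thesis by (simp add: exp_def divide_real_def mult.commute)
qed

lemma flat_nonneg: "flat n t \<ge> 0"
  by (auto simp: flat_def)

text \<open>A single term of the exponential series,
  \<open>(1 / t) ^ (n + 2) / fact (n + 2) \<le> exp (1 / t)\<close>, beats the factor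
  \<open>1 / t ^ n\<close> with two powers to spare. The quadratic bound yields derivative
  \<open>0\<close> at the origin, for every \<open>n\<close>.\<close>

lemma flat_le_square: "flat n t \<le> fact (n + 2) * t\<^sup>2"
proof (cases "t \<le> 0")
  case False
  then have t: "t > 0" by simp
  have "(1 / t) ^ m / fact m \<le> exp (1 / t)" for m
    using t by (intro power_over_fact_le_exp) auto
  then have "1 / exp (1 / t) \<le> fact m * t ^ m" for m
    using t by (simp add: field_simps)
  from this[of "n + 2"] have "1 / exp (1 / t) \<le> fact (n + 2) * t ^ (n + 2)" .
  then have "exp (- 1 / t) / t ^ n \<le> (fact (n + 2) * t ^ (n + 2)) / t ^ n"
    using t by (intro divide_right_mono) (auto simp: exp_minus inverse_eq_divide)
  then show ?thesis using t by (simp add: flat_def power_add power2_eq_square del: fact_Suc)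
qed (auto simp: flat_def)

lemma flat_has_derivative:
  "(flat n has_real_derivative (flat (n + 2) t - real n * flat (n + 1) t)) (at t)"
proof -
  consider "t < 0" | "t = 0" | "t > 0" by linarith
  then show ?thesis
  proof cases
    case 1
    have "(flat n has_real_derivative 0) (at t)"
      by (rule has_field_derivative_transform_within_open[of "\<lambda>_. 0" _ _ "{..<0}"])
         (use 1 in \<open>auto simp: flat_def\<close>)
    then show ?thesis using 1 by (simp add: flat_def)
  next
    case 2
    have "(flat n has_derivative (*) 0) (at 0)"
    proof (rule has_derivative_quadratic_remainder[OF bounded_linear_mult_right])
      show "norm (flat n (0 + h) - flat n 0 - 0 * h) \<le> fact (n + 2) * norm h ^ 2" for h
        using flat_le_square[of n h] flat_nonneg[of n h] by (simp add: flat_def del: fact_Suc)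
    qed
    then show ?thesis using 2 by (simp add: flat_def has_field_derivative_def)
  next
    case 3
    have "((\<lambda>t. exp (- 1 / t) / t ^ n) has_real_derivative (flat (n + 2) t - real n * flat (n + 1) t)) (at t)"
      using 3 by (auto intro!: derivative_eq_intros simp: flat_def field_simps power_add)
        (cases n; simp add: field_simps power2_eq_square)
    then show ?thesis
      by (rule has_field_derivative_transform_within_open[of _ _ _ "{0<..}"])
         (use 3 in \<open>auto simp: flat_def\<close>)
  qed
qed

definition bump :: "'a::euclidean_space \<Rightarrow> complex" where
  "bump x = of_real (flat 0 (1 - x \<bullet> x))"

text \<open>The closed family containing \<open>bump\<close>: differentiating
  \<open>flat n (1 - x \<bullet> x)\<close> raises the index and produces a linear factor, which the
  smooth coefficient \<open>p\<close> absorbs.\<close>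

inductive_set bump_products :: "('a::euclidean_space \<Rightarrow> complex) set" where
  prod: "smooth_fun p \<Longrightarrow> (\<lambda>x. p x * of_real (flat n (1 - x \<bullet> x))) \<in> bump_products"
| add: "f \<in> bump_products \<Longrightarrow> g \<in> bump_products \<Longrightarrow> (\<lambda>x. f x + g x) \<in> bump_products"

lemma bump_products_smooth:
  assumes "f \<in> bump_products"
  shows "smooth_fun f"
  using assms
proof (rule smooth_fun_coinduct)
  fix g :: "'a \<Rightarrow> complex"
  assume "g \<in> bump_products"
  then show "\<exists>D. (\<forall>x. (g has_derivative D x) (at x)) \<and> (\<forall>b\<in>Basis. (\<lambda>x. D x b) \<in> bump_products)"
  proof induction
    case (prod p n)
    let ?s = "\<lambda>x::'a. 1 - x \<bullet> x"
    let ?f' = "\<lambda>x. flat (n + 2) (?s x) - real n * flat (n + 1) (?s x)"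
    let ?D = "\<lambda>x h. p x * of_real (?f' x * (- 2 * (x \<bullet> h)))
      + frechet_derivative p (at x) h * of_real (flat n (?s x))"
    have "((\<lambda>x. p x * of_real (flat n (?s x))) has_derivative ?D x) (at x)" for x
    proof (rule has_derivative_mult)
      have "(?s has_derivative (\<lambda>h. - 2 * (x \<bullet> h))) (at x)"
        by (auto intro!: derivative_eq_intros simp: inner_commute)
      then have "((\<lambda>x. flat n (?s x)) has_derivative (\<lambda>h. ?f' x * (- 2 * (x \<bullet> h)))) (at x)"
        by (rule has_derivative_compose[where g = "flat n"])
           (use flat_has_derivative[of n "?s x"] in \<open>simp add: has_field_derivative_def\<close>)
      then show "((\<lambda>x. of_real (flat n (?s x)) :: complex) has_derivative
          (\<lambda>h. of_real (?f' x * (- 2 * (x \<bullet> h))))) (at x)"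
        by (rule has_derivative_of_real)
    qed (use prod smooth_fun_has_derivative in auto)
    moreover have "(\<lambda>x. ?D x b) \<in> bump_products" if b: "b \<in> Basis" for b
    proof -
      have "smooth_fun (partial b p)"
        using smooth_fun_iterated_partial[OF prod, of "[b]"] b by simp
      then have "(\<lambda>x. ((p x * (- 2 * of_real (x \<bullet> b))) * of_real (flat (n + 2) (?s x))
         + (p x * (2 * of_nat n * of_real (x \<bullet> b))) * of_real (flat (n + 1) (?s x)))
         + partial b p x * of_real (flat n (?s x))) \<in> bump_products"
        using prod by (intro bump_products.intros smooth_fun_mult smooth_fun_const smooth_fun_linear)
      then show ?thesis by (simp add: partial_eq algebra_simps)
    qed
    ultimately show ?case by (intro exI[of _ ?D]) blast
  next
    case (add f g)
    then obtain D D' where "\<forall>x. (f has_derivative D x) (at x)" "\<forall>b\<in>Basis. (\<lambda>x. D x b) \<in> bump_products"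
       "\<forall>x. (g has_derivative D' x) (at x)" "\<forall>b\<in>Basis. (\<lambda>x. D' x b) \<in> bump_products" by blast
    then show ?case
      by (intro exI[of _ "\<lambda>x h. D x h + D' x h"]) (auto intro!: bump_products.intros has_derivative_add)
  qed
qed

lemma bump_outside: "1 \<le> norm x \<Longrightarrow> bump x = 0"
  using power_mono[of 1 "norm x" 2] by (auto simp: bump_def flat_def power2_norm_eq_inner)

lemma bump_test_function: "bump \<in> test_functions"
proof -
  have "(\<lambda>x::'a. 1 * of_real (flat 0 (1 - x \<bullet> x))) \<in> bump_products"
    by (intro bump_products.intros smooth_fun_const)
  from bump_products_smooth[OF this] have "smooth_fun (bump :: 'a \<Rightarrow> complex)"
    by (simp add: bump_def[abs_def])
  moreover have "\<forall>x::'a. 1 < norm x \<longrightarrow> bump x = 0" by (simp add: bump_outside less_imp_le)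
  ultimately show ?thesis unfolding test_functions_iff by blast
qed

lemma bump_minus: "bump (- x) = bump x"
  by (simp add: bump_def)

text \<open>With integral zero, the nonempty open set where \<open>f\<close> is nonzero would be a
  null set.\<close>

lemma continuous_nonneg_integral_pos:
  fixes f :: "'a::euclidean_space \<Rightarrow> real"
  assumes "integrable lborel f" "continuous_on UNIV f" "\<And>x. f x \<ge> 0" "f a > 0"
  shows "(\<integral>x. f x \<partial>lborel) > 0"
proof (rule ccontr)
  assume "\<not> ?thesis"
  then have "(\<integral>x. f x \<partial>lborel) = 0" using Bochner_Integration.integral_nonneg[of lborel f] assms(3) by (simp add: order_antisym)
  then have "AE x in lborel. f x = 0" using assms by (simp add: integral_nonneg_eq_0_iff_AE)
  moreover have op: "open {x. f x \<noteq> 0}" using assms(2) by (intro open_Collect_neq) auto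
  ultimately have "{x. f x \<noteq> 0} \<in> null_sets lborel"
    using AE_iff_null_sets[of "{x. f x \<noteq> 0}" lborel] by simp
  then have "negligible {x. f x \<noteq> 0}"
    unfolding negligible_iff_null_sets by (rule null_sets_completionI)
  moreover note op
  ultimately show False using open_not_negligible assms(4) by force
qed

lemma bump_integral:
  obtains c where "c > 0" "(\<integral>x. bump (x::'a::euclidean_space) \<partial>lborel) = of_real c"
proof -
  have "(\<integral>x. flat 0 (1 - x \<bullet> (x::'a)) \<partial>lborel) > 0"
  proof (rule continuous_nonneg_integral_pos[of _ 0])
    have "integrable lborel (\<lambda>x::'a. Re (bump x))"
      by (intro integrable_Re test_function_integrable bump_test_function)
    then show "integrable lborel (\<lambda>x::'a. flat 0 (1 - x \<bullet> x))" by (simp add: bump_def)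
    have "continuous_on UNIV (\<lambda>x::'a. Re (bump x))"
      by (intro continuous_intros smooth_fun_continuous test_function_smooth bump_test_function)
    then show "continuous_on UNIV (\<lambda>x::'a. flat 0 (1 - x \<bullet> x))" by (simp add: bump_def)
  qed (auto simp: flat_nonneg, auto simp: flat_def)
  then show ?thesis by (intro that) (auto simp: bump_def)
qed

section \<open>Averages of translates of a test function\<close>

text \<open>For \<open>w v = v\<close> this is convolution with \<open>k\<close>; for
  \<open>w v = (1 / m) *\<^sub>R v\<close> it averages translates of \<open>f\<close> by amounts
  that shrink as \<open>m\<close> grows. Derivatives fall on \<open>f\<close> alone, so a merely
  integrable \<open>k\<close>, such as an indicator or a cut-off character, still gives a smooth
  function.\<close>

definition smear :: "('a::euclidean_space \<Rightarrow> complex) \<Rightarrow> ('a \<Rightarrow> 'a) \<Rightarrow> ('a \<Rightarrow> complex) \<Rightarrow> 'a \<Rightarrow> complex" where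
  "smear f w k y = (\<integral>v. f (y - w v) * k v \<partial>lborel)"

lemma integrable_bounded_mult:
  fixes f k :: "'a \<Rightarrow> complex"
  assumes "f \<in> borel_measurable M" "\<And>x. norm (f x) \<le> B" "integrable M k"
  shows "integrable M (\<lambda>x. f x * k x)"
proof (rule Bochner_Integration.integrable_bound)
  show "integrable M (\<lambda>x. B * norm (k x))" using assms by auto
  show "AE x in M. norm (f x * k x) \<le> norm (B * norm (k x))"
  proof (rule AE_I2)
    fix x
    have "0 \<le> B" using assms(2)[of x] norm_ge_zero by (rule order_trans[rotated])
    then show "norm (f x * k x) \<le> norm (B * norm (k x))"
      using mult_right_mono[OF assms(2)[of x] norm_ge_zero[of "k x"]] by (simp add: norm_mult)
  qed
qed (use assms in measurable)

lemma smear_integrable: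
  assumes "f \<in> test_functions" "w \<in> borel_measurable borel" "integrable lborel k"
  shows "integrable lborel (\<lambda>v. f (y - w v) * k v)"
proof -
  note [measurable] = assms(2) smooth_fun_measurable[OF test_function_smooth[OF assms(1)]]
  obtain B where "B \<ge> 0" "\<And>x. norm (f x) \<le> B" using test_function_bounded[OF assms(1)] by blast
  then show ?thesis by (intro integrable_bounded_mult[of _ _ B] assms) auto
qed

lemma smear_has_derivative:
  assumes "f \<in> test_functions" "w \<in> borel_measurable borel" "integrable lborel k"
  shows "(smear f w k has_derivative (\<lambda>h. \<Sum>b\<in>Basis. (h \<bullet> b) *\<^sub>R smear (partial b f) w k y)) (at y)"
proof -
  obtain C where C: "C \<ge> 0"
      "\<And>x h. norm (f (x + h) - f x - (\<Sum>b\<in>Basis. (h \<bullet> b) *\<^sub>R partial b f x)) \<le> C * norm h ^ 2"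
    using test_function_quadratic_remainder[OF assms(1)] by blast
  have "((\<lambda>y. \<integral>v. f (y - w v) * k v \<partial>lborel) has_derivative
      (\<lambda>h. \<Sum>b\<in>Basis. (h \<bullet> b) *\<^sub>R (\<integral>v. partial b f (y - w v) * k v \<partial>lborel))) (at y)"
  proof (rule has_derivative_integral)
    show "integrable lborel (\<lambda>v. C * norm (k v))" using assms by auto
    fix h v :: 'a
    have "f (y + h - w v) * k v - f (y - w v) * k v - (\<Sum>b\<in>Basis. (h \<bullet> b) *\<^sub>R (partial b f (y - w v) * k v))
      = (f (y - w v + h) - f (y - w v) - (\<Sum>b\<in>Basis. (h \<bullet> b) *\<^sub>R partial b f (y - w v))) * k v"
      by (simp add: algebra_simps sum_distrib_left sum_distrib_right)
    also have "norm \<dots> \<le> (C * norm h ^ 2) * norm (k v)"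
      unfolding norm_mult by (intro mult_right_mono C) auto
    finally show "norm (f (y + h - w v) * k v - f (y - w v) * k v
        - (\<Sum>b\<in>Basis. (h \<bullet> b) *\<^sub>R (partial b f (y - w v) * k v))) \<le> norm h ^ 2 * (C * norm (k v))"
      by (simp add: mult_ac)
  qed (use assms in \<open>auto intro!: smear_integrable test_function_partial\<close>)
  then show ?thesis by (simp add: smear_def[abs_def])
qed

lemma smear_smooth:
  assumes "f \<in> test_functions" "w \<in> borel_measurable borel" "integrable lborel k"
  shows "smooth_fun (smear f w k)"
proof (rule smooth_fun_coinduct[where F = "{smear f w k | f. f \<in> test_functions}"])
  fix g assume "g \<in> {smear f w k | f. f \<in> test_functions}"
  then obtain f where g: "g = smear f w k" "f \<in> test_functions" by blast
  let ?D = "\<lambda>y h. \<Sum>b\<in>Basis. (h \<bullet> b) *\<^sub>R smear (partial b f) w k y"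
  have "\<forall>y. (g has_derivative ?D y) (at y)" using smear_has_derivative g assms by blast
  moreover have "\<forall>b\<in>Basis. (\<lambda>y. ?D y b) \<in> {smear f w k | f. f \<in> test_functions}"
  proof
    fix b :: 'a assume b: "b \<in> Basis"
    then have "(\<lambda>y. ?D y b) = smear (partial b f) w k" by (simp add: inner_Basis_sum_Basis)
    then show "(\<lambda>y. ?D y b) \<in> {smear f w k | f. f \<in> test_functions}"
      using test_function_partial[OF g(2) b] by blast
  qed
  ultimately show "\<exists>D. (\<forall>x. (g has_derivative D x) (at x)) \<and>
     (\<forall>b\<in>Basis. (\<lambda>x. D x b) \<in> {smear f w k | f. f \<in> test_functions})"
    by (intro exI[of _ ?D]) blast
qed (use assms in blast)

lemma iterated_partial_smear:
  assumes "f \<in> test_functions" "w \<in> borel_measurable borel" "integrable lborel k" "bs \<in> lists Basis"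
  shows "iterated_partial bs (smear f w k) = smear (iterated_partial bs f) w k"
  using assms(4)
proof (induction bs)
  case (Cons b bs)
  then have b: "b \<in> Basis" and bs: "bs \<in> lists Basis"
    and IH: "iterated_partial bs (smear f w k) = smear (iterated_partial bs f) w k" by auto
  let ?f = "iterated_partial bs f"
  have "frechet_derivative (smear ?f w k) (at y) b = smear (partial b ?f) w k y" for y
    using frechet_derivative_at[OF smear_has_derivative[of ?f w k y], symmetric]
      test_function_iterated_partial[OF assms(1) bs] assms b
    by (simp add: inner_Basis_sum_Basis)
  then show ?case by (simp add: iterated_partial.simps IH)
qed simp

section \<open>The Fourier transform\<close>

lemma fourier_kernel: "exp (- 2 * of_real pi * \<i> * of_real t) = cis (- 2 * pi * t)"
  by (simp add: cis_conv_exp mult_ac)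

lemma fourier_eq: "fourier f y = (\<integral>x. f x * cis (- 2 * pi * (x \<bullet> y)) \<partial>lborel)"
  unfolding fourier_def fourier_kernel ..

lemma cis_quadratic_remainder: "norm (cis t - 1 - \<i> * of_real t) \<le> t\<^sup>2"
  using Taylor_exp[of "\<i> * of_real t" 1] by (simp add: cis_conv_exp norm_mult power2_eq_square algebra_simps)

lemma cis_measurable [measurable]: "cis \<in> borel_measurable borel"
  by (intro borel_measurable_continuous_onI continuous_intros)

lemma fourier_integrable:
  fixes f :: "'a::euclidean_space \<Rightarrow> complex"
  assumes "integrable lborel f"
  shows "integrable lborel (\<lambda>x. f x * cis (- 2 * pi * (x \<bullet> y)))"
proof -
  have "integrable lborel (\<lambda>x. cis (- 2 * pi * (x \<bullet> y)) * f x)"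
    using assms by (intro integrable_bounded_mult[of _ _ 1]) auto
  then show ?thesis by (simp add: mult.commute)
qed

text \<open>The quadratic remainder of \<open>cis\<close> costs a factor
  \<open>(x \<bullet> h)\<^sup>2\<close>, hence the weight \<open>norm x ^ 2 * norm (f x)\<close>,
  integrable because \<open>f\<close> has bounded support. The assumptions are inherited by
  \<open>(x \<bullet> b) * f x\<close> with the same \<open>R\<close>, so the transforms of such
  functions form a family closed under partial derivatives.\<close>

lemma fourier_has_derivative:
  fixes f :: "'a::euclidean_space \<Rightarrow> complex"
  assumes "continuous_on UNIV f" "\<And>x. R \<le> norm x \<Longrightarrow> f x = 0"
  shows "(fourier f has_derivative
    (\<lambda>h. \<Sum>b\<in>Basis. (h \<bullet> b) *\<^sub>R fourier (\<lambda>x. - 2 * pi * \<i> * of_real (x \<bullet> b) * f x) y)) (at y)"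
proof -
  let ?e = "\<lambda>x y::'a. cis (- 2 * pi * (x \<bullet> y))"
  let ?g = "\<lambda>b x. - 2 * pi * \<i> * of_real (x \<bullet> b) * f x"
  have int: "integrable lborel (\<lambda>x. p x * f x)" if "continuous_on UNIV p" for p :: "'a \<Rightarrow> complex"
    using that assms by (intro compactly_supported_integrable[of _ R]) (auto intro!: continuous_intros)
  have "((\<lambda>y. \<integral>x. f x * ?e x y \<partial>lborel) has_derivative
      (\<lambda>h. \<Sum>b\<in>Basis. (h \<bullet> b) *\<^sub>R (\<integral>x. ?g b x * ?e x y \<partial>lborel))) (at y)"
  proof (rule has_derivative_integral)
    show "integrable lborel (\<lambda>x. f x * ?e x y)" for y
      using int[of "\<lambda>_. 1"] by (intro fourier_integrable) simp
    show "integrable lborel (\<lambda>x. ?g b x * ?e x y)" for b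
      by (intro fourier_integrable int continuous_intros)
    have "integrable lborel (\<lambda>x. norm (of_real (4 * pi\<^sup>2 * norm x ^ 2) * f x))"
      by (intro integrable_norm int continuous_intros)
    then show "integrable lborel (\<lambda>x. 4 * pi\<^sup>2 * norm x ^ 2 * norm (f x))"
      by (simp add: norm_mult norm_power)
    fix h x :: 'a
    have "(\<Sum>b\<in>Basis. (h \<bullet> b) *\<^sub>R (?g b x * ?e x y))
       = \<i> * of_real (- 2 * pi * (\<Sum>b\<in>Basis. (h \<bullet> b) * (x \<bullet> b))) * (f x * ?e x y)"
      by (simp add: sum_distrib_left sum_distrib_right scaleR_conv_of_real sum_negf[symmetric] mult_ac)
    also have "(\<Sum>b\<in>Basis. (h \<bullet> b) * (x \<bullet> b)) = x \<bullet> h"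
      by (simp add: euclidean_inner[of x h] mult.commute)
    finally have "f x * ?e x (y + h) - f x * ?e x y - (\<Sum>b\<in>Basis. (h \<bullet> b) *\<^sub>R (?g b x * ?e x y))
      = f x * ?e x y * (?e x h - 1 - \<i> * of_real (- 2 * pi * (x \<bullet> h)))"
      by (simp only: inner_add_right distrib_left cis_mult[symmetric]) (simp only: algebra_simps mult_1_left)
    also have "norm \<dots> \<le> norm (f x) * (- 2 * pi * (x \<bullet> h))\<^sup>2"
      unfolding norm_mult using cis_quadratic_remainder[of "- 2 * pi * (x \<bullet> h)"]
      by (simp add: mult_left_mono)
    also have "\<dots> \<le> norm (f x) * (2 * pi * (norm x * norm h))\<^sup>2"
    proof (intro mult_left_mono)
      have "\<bar>- 2 * pi * (x \<bullet> h)\<bar> \<le> \<bar>2 * pi * (norm x * norm h)\<bar>"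
        using Cauchy_Schwarz_ineq2[of x h] by (simp add: abs_mult)
      then show "(- 2 * pi * (x \<bullet> h))\<^sup>2 \<le> (2 * pi * (norm x * norm h))\<^sup>2"
        by (simp only: abs_le_square_iff)
    qed simp
    finally show "norm (f x * ?e x (y + h) - f x * ?e x y - (\<Sum>b\<in>Basis. (h \<bullet> b) *\<^sub>R (?g b x * ?e x y)))
       \<le> norm h ^ 2 * (4 * pi\<^sup>2 * norm x ^ 2 * norm (f x))"
      by (simp add: power_mult_distrib mult_ac)
  qed
  then show ?thesis by (simp add: fourier_eq[abs_def])
qed

lemma fourier_smooth:
  fixes f :: "'a::euclidean_space \<Rightarrow> complex"
  assumes "continuous_on UNIV f" "\<And>x. R \<le> norm x \<Longrightarrow> f x = 0"
  shows "smooth_fun (fourier f)"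
proof -
  define F where "F = {fourier f | f :: 'a \<Rightarrow> complex. continuous_on UNIV f \<and> (\<forall>x. R \<le> norm x \<longrightarrow> f x = 0)}"
  show ?thesis
  proof (rule smooth_fun_coinduct[where F = F])
    fix g assume "g \<in> F"
    then obtain f where g: "g = fourier f" "continuous_on UNIV f" "\<And>x. R \<le> norm x \<Longrightarrow> f x = 0"
      by (auto simp: F_def)
    let ?g = "\<lambda>b x. - 2 * pi * \<i> * of_real (x \<bullet> b) * f x"
    let ?D = "\<lambda>y h. \<Sum>b\<in>Basis. (h \<bullet> b) *\<^sub>R fourier (?g b) y"
    have "\<forall>y. (g has_derivative ?D y) (at y)"
      unfolding g(1) using fourier_has_derivative[OF g(2,3)] by blast
    moreover have "(\<lambda>y. ?D y b) \<in> F" if b: "b \<in> Basis" for b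
    proof -
      have "(\<lambda>y. ?D y b) = fourier (?g b)" using b by (simp add: inner_Basis_sum_Basis)
      moreover have "continuous_on UNIV (?g b)" by (intro continuous_intros g)
      ultimately show ?thesis using g(3) by (auto simp: F_def)
    qed
    ultimately show "\<exists>D. (\<forall>x. (g has_derivative D x) (at x)) \<and> (\<forall>b\<in>Basis. (\<lambda>x. D x b) \<in> F)"
      by (intro exI[of _ ?D]) blast
  qed (use assms F_def in blast)
qed

lemma fourier_test_function_smooth:
  assumes "f \<in> test_functions"
  shows "smooth_fun (fourier f)"
proof -
  obtain R where "R > 0" "\<And>x. R \<le> norm x \<Longrightarrow> f x = 0" using test_function_support[OF assms] by blast
  then show ?thesis
    using fourier_smooth[OF smooth_fun_continuous[OF test_function_smooth[OF assms]]] by blast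
qed

text \<open>Characters are eigenfunctions of convolution, with eigenvalue
  \<open>fourier f y\<close>. As a character is not integrable it is cut off at radius
  \<open>R + 1\<close>; for \<open>norm z < 1\<close> the cut happens where \<open>f (z - v)\<close>
  vanishes anyway.\<close>

lemma smear_character:
  fixes f :: "'a::euclidean_space \<Rightarrow> complex"
  assumes "f \<in> test_functions" "\<And>x. R \<le> norm x \<Longrightarrow> f x = 0" "norm z < 1"
  shows "smear f (\<lambda>v. v) (\<lambda>v. indicator (ball 0 (R + 1)) v * cis (2 * pi * (v \<bullet> y))) z
    = cis (2 * pi * (z \<bullet> y)) * fourier f y"
proof -
  have [measurable]: "f \<in> borel_measurable borel"
    using assms(1) smooth_fun_measurable test_function_smooth by blast
  have "f (z - v) * (indicator (ball 0 (R + 1)) v * cis (2 * pi * (v \<bullet> y)))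
      = f (z - v) * cis (2 * pi * (v \<bullet> y))" for v
  proof (cases "v \<in> ball 0 (R + 1)")
    case False
    then have "R \<le> norm (z - v)" using norm_triangle_sub[of v z] assms(3) by (simp add: norm_minus_commute)
    then show ?thesis using assms(2) by simp
  qed simp
  then have "smear f (\<lambda>v. v) (\<lambda>v. indicator (ball 0 (R + 1)) v * cis (2 * pi * (v \<bullet> y))) z
      = (\<integral>v. f (z - v) * cis (2 * pi * (v \<bullet> y)) \<partial>lborel)"
    by (simp only: smear_def)
  also have "\<dots> = (\<integral>x. f x * cis (2 * pi * ((z - x) \<bullet> y)) \<partial>lborel)"
    by (subst integral_affine[where c = "-1" and t = z]) auto
  also have "\<dots> = (\<integral>x. cis (2 * pi * (z \<bullet> y)) * (f x * cis (- 2 * pi * (x \<bullet> y))) \<partial>lborel)"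
    by (intro Bochner_Integration.integral_cong refl) (simp add: inner_diff_left cis_mult right_diff_distrib)
  also have "\<dots> = cis (2 * pi * (z \<bullet> y)) * fourier f y"
    by (simp add: fourier_eq)
  finally show ?thesis .
qed

text \<open>Integration by parts, obtained by comparing two derivatives at \<open>0\<close> of the function in
  \<open>smear_character\<close>.\<close>

lemma fourier_partial:
  assumes "f \<in> test_functions" "b \<in> Basis"
  shows "fourier (partial b f) y = 2 * pi * \<i> * of_real (y \<bullet> b) * fourier f y"
proof -
  obtain R1 where R1: "\<And>x. R1 \<le> norm x \<Longrightarrow> f x = 0"
    using test_function_support[OF assms(1)] by blast
  obtain R2 where R2: "\<And>x. R2 \<le> norm x \<Longrightarrow> partial b f x = 0"
    using test_function_support[OF test_function_partial[OF assms]] by blast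
  define R where "R = max R1 R2"
  define k where "k v = indicator (ball 0 (R + 1)) v * cis (2 * pi * (v \<bullet> y))" for v
  define c where "c = fourier f y"
  have kint: "integrable lborel k"
  proof -
    have "integrable lborel (\<lambda>v. cis (2 * pi * (v \<bullet> y)) * (indicator (ball 0 (R + 1)) v :: complex))"
    proof (rule integrable_bounded_mult[of _ _ 1])
      show "integrable lborel (indicator (ball (0::'a) (R + 1)) :: _ \<Rightarrow> complex)"
        by (rule integrable_indicator_ball)
    qed auto
    then show ?thesis by (simp add: k_def[abs_def] mult.commute)
  qed
  have eq: "smear f (\<lambda>v. v) k z = cis (2 * pi * (z \<bullet> y)) * c" if "norm z < 1" for z
    unfolding k_def c_def by (rule smear_character) (use assms R1 that in \<open>auto simp: R_def\<close>)
  have "(smear f (\<lambda>v. v) k has_derivative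
      (\<lambda>h. \<Sum>b\<in>Basis. (h \<bullet> b) *\<^sub>R smear (partial b f) (\<lambda>v. v) k 0)) (at 0)"
    by (rule smear_has_derivative) (use assms kint in auto)
  then have 1: "((\<lambda>z. cis (2 * pi * (z \<bullet> y)) * c) has_derivative
      (\<lambda>h. \<Sum>b\<in>Basis. (h \<bullet> b) *\<^sub>R smear (partial b f) (\<lambda>v. v) k 0)) (at 0)"
    by (rule has_derivative_transform_within_open[where s = "ball 0 1"]) (auto simp: eq)
  have 2: "((\<lambda>z. cis (2 * pi * (z \<bullet> y)) * c) has_derivative (\<lambda>h. \<i> * of_real (2 * pi * (h \<bullet> y)) * c)) (at 0)"
  proof (rule has_derivative_quadratic_remainder)
    show "bounded_linear (\<lambda>h. \<i> * of_real (2 * pi * (h \<bullet> y)) * c)"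
      by (intro bounded_linear_mult_const bounded_linear_const_mult bounded_linear_compose[OF bounded_linear_of_real]
         bounded_linear_inner_left)
    fix h :: 'a
    have "cis (2 * pi * ((0 + h) \<bullet> y)) * c - cis (2 * pi * (0 \<bullet> y)) * c - \<i> * of_real (2 * pi * (h \<bullet> y)) * c
        = (cis (2 * pi * (h \<bullet> y)) - 1 - \<i> * of_real (2 * pi * (h \<bullet> y))) * c"
      by (simp add: algebra_simps)
    also have "norm \<dots> \<le> (2 * pi * (h \<bullet> y))\<^sup>2 * norm c"
      unfolding norm_mult by (intro mult_right_mono cis_quadratic_remainder) simp
    also have "\<dots> \<le> (2 * pi * (norm h * norm y))\<^sup>2 * norm c"
    proof (intro mult_right_mono)
      have "\<bar>2 * pi * (h \<bullet> y)\<bar> \<le> \<bar>2 * pi * (norm h * norm y)\<bar>"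
        using Cauchy_Schwarz_ineq2[of h y] by (simp add: abs_mult)
      then show "(2 * pi * (h \<bullet> y))\<^sup>2 \<le> (2 * pi * (norm h * norm y))\<^sup>2"
        by (simp only: abs_le_square_iff)
    qed simp
    finally show "norm (cis (2 * pi * ((0 + h) \<bullet> y)) * c - cis (2 * pi * (0 \<bullet> y)) * c - \<i> * of_real (2 * pi * (h \<bullet> y)) * c)
        \<le> (2 * pi * norm y)\<^sup>2 * norm c * norm h ^ 2"
      by (simp add: power_mult_distrib mult_ac)
  qed
  have "(\<Sum>b'\<in>Basis. (b \<bullet> b') *\<^sub>R smear (partial b' f) (\<lambda>v. v) k 0) = \<i> * of_real (2 * pi * (b \<bullet> y)) * c"
    using has_derivative_unique[OF 1 2] by (rule fun_cong)
  then have "smear (partial b f) (\<lambda>v. v) k 0 = \<i> * of_real (2 * pi * (b \<bullet> y)) * c"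
    using assms(2) by (simp add: inner_Basis_sum_Basis)
  moreover have "smear (partial b f) (\<lambda>v. v) k 0 = cis (2 * pi * (0 \<bullet> y)) * fourier (partial b f) y"
    unfolding k_def by (rule smear_character) (use assms R2 test_function_partial in \<open>auto simp: R_def\<close>)
  ultimately show ?thesis by (simp add: c_def inner_commute mult_ac)
qed

section \<open>Rapid decay of the Fourier transform of a test function\<close>

lemma fourier_partial_replicate:
  assumes "f \<in> test_functions" "b \<in> Basis"
  shows "fourier (iterated_partial (replicate n b) f) y = (2 * pi * \<i> * of_real (y \<bullet> b)) ^ n * fourier f y"
proof (induction n)
  case (Suc n)
  have "iterated_partial (replicate n b) f \<in> test_functions"
    using assms by (intro test_function_iterated_partial) auto
  then have "fourier (partial b (iterated_partial (replicate n b) f)) y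
      = 2 * pi * \<i> * of_real (y \<bullet> b) * fourier (iterated_partial (replicate n b) f) y"
    using assms(2) by (rule fourier_partial)
  moreover have "iterated_partial (replicate (Suc n) b) f = partial b (iterated_partial (replicate n b) f)"
    by (simp add: iterated_partial.simps)
  ultimately show ?case using Suc by (simp add: mult_ac)
qed simp

lemma norm_fourier_le: "norm (fourier f y) \<le> (\<integral>x. norm (f x) \<partial>lborel)"
  unfolding fourier_eq by (rule order_trans[OF integral_norm_bound]) (simp add: norm_mult)

text \<open>With \<open>M\<close> the maximum of \<open>1\<close> and the absolute coordinates,
  \<open>1 + norm y\<close> is at most \<open>(1 + DIM) * M\<close>, and \<open>M ^ n\<close> is one
  of the summands on the right. This reduces polynomial decay to pure powers of single
  coordinates.\<close>

lemma weight_le_coordinates: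
  fixes y :: "'a::euclidean_space"
  shows "(1 + norm y) ^ n \<le> (1 + real DIM('a)) ^ n * (1 + (\<Sum>b\<in>Basis. \<bar>y \<bullet> b\<bar> ^ n))"
proof -
  define A where "A = insert 1 ((\<lambda>b. \<bar>y \<bullet> b\<bar>) ` Basis)"
  define M where "M = Max A"
  have A: "finite A" "A \<noteq> {}" by (auto simp: A_def)
  have MA: "M \<in> A" unfolding M_def using A by (rule Max_in)
  have M: "t \<le> M" if "t \<in> A" for t unfolding M_def using A(1) that by (rule Max_ge)
  have "norm y \<le> (\<Sum>b\<in>Basis. \<bar>y \<bullet> b\<bar>)" by (rule norm_le_l1)
  also have "\<dots> \<le> (\<Sum>b\<in>(Basis::'a set). M)" by (intro sum_mono M) (auto simp: A_def)
  finally have "1 + norm y \<le> (1 + real DIM('a)) * M"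
    using M[of 1] by (simp add: A_def algebra_simps)
  then have "(1 + norm y) ^ n \<le> (1 + real DIM('a)) ^ n * M ^ n"
    unfolding power_mult_distrib[symmetric] by (intro power_mono) auto
  also have "M ^ n \<le> 1 + (\<Sum>b\<in>Basis. \<bar>y \<bullet> b\<bar> ^ n)"
  proof (cases "M = 1")
    case False
    then obtain b where "b \<in> Basis" "M = \<bar>y \<bullet> b\<bar>" using MA by (auto simp: A_def)
    then show ?thesis using member_le_sum[of b Basis "\<lambda>b. \<bar>y \<bullet> b\<bar> ^ n"] by simp
  qed (simp add: sum_nonneg)
  finally show ?thesis by (simp add: mult_left_mono)
qed

text \<open>A coordinate power times \<open>fourier f\<close> is, up to the factor
  \<open>(2 * pi) ^ n \<ge> 1\<close>, bounded by the transform of an \<open>n\<close>-fold pure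
  partial derivative, and hence by the integral of the norm of that derivative.\<close>

lemma fourier_decay:
  fixes f :: "'a::euclidean_space \<Rightarrow> complex"
  assumes "f \<in> test_functions"
  shows "\<exists>C\<ge>0. \<forall>y. (1 + norm y) ^ n * norm (fourier f y) \<le> C"
proof -
  define C where "C g = (\<integral>x. norm (g x) \<partial>lborel)" for g :: "'a \<Rightarrow> complex"
  have C0: "C g \<ge> 0" for g unfolding C_def by simp
  have 1: "\<bar>y \<bullet> b\<bar> ^ n * norm (fourier f y) \<le> C (iterated_partial (replicate n b) f)" if "b \<in> Basis" for b y
  proof -
    have "norm ((2 * pi * \<i> * of_real (y \<bullet> b)) ^ n * fourier f y) \<le> C (iterated_partial (replicate n b) f)"
      unfolding fourier_partial_replicate[OF assms that, symmetric] C_def by (rule norm_fourier_le)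
    moreover have "\<bar>y \<bullet> b\<bar> ^ n \<le> (2 * pi * \<bar>y \<bullet> b\<bar>) ^ n"
      using pi_gt3 by (intro power_mono) (auto simp: mult_le_cancel_right1)
    then have "\<bar>y \<bullet> b\<bar> ^ n * norm (fourier f y) \<le> (2 * pi * \<bar>y \<bullet> b\<bar>) ^ n * norm (fourier f y)"
      by (rule mult_right_mono) simp
    ultimately show ?thesis by (simp add: norm_mult norm_power abs_mult)
  qed
  let ?C = "(1 + real DIM('a)) ^ n * (C f + (\<Sum>b\<in>Basis. C (iterated_partial (replicate n b) f)))"
  have "(1 + norm y) ^ n * norm (fourier f y) \<le> ?C" for y
  proof -
    have "(1 + norm y) ^ n * norm (fourier f y)
       \<le> (1 + real DIM('a)) ^ n * (1 + (\<Sum>b\<in>Basis. \<bar>y \<bullet> b\<bar> ^ n)) * norm (fourier f y)"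
      by (intro mult_right_mono weight_le_coordinates) simp
    also have "\<dots> = (1 + real DIM('a)) ^ n * (norm (fourier f y) + (\<Sum>b\<in>Basis. \<bar>y \<bullet> b\<bar> ^ n * norm (fourier f y)))"
      by (simp add: sum_distrib_right sum_distrib_left algebra_simps)
    also have "\<dots> \<le> ?C"
      by (intro mult_left_mono add_mono sum_mono 1) (auto simp: C_def norm_fourier_le)
    finally show ?thesis .
  qed
  moreover have "?C \<ge> 0" by (intro mult_nonneg_nonneg add_nonneg_nonneg sum_nonneg C0) auto
  ultimately show ?thesis by blast
qed

text \<open>The weight lies below a sum of multiples of indicators of the balls of radius
  \<open>n + 1\<close>, with heights \<open>1 / (n + 1) ^ (DIM + 2)\<close>. Their volumes grow like
  \<open>(n + 1) ^ DIM\<close>; whole balls are used rather than shells, so the exponent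
  \<open>DIM + 2\<close> is what leaves the convergent series of
  \<open>1 / (n + 1) ^ 2\<close>.\<close>

lemma integrable_weight:
  "integrable lborel (\<lambda>x::'a::euclidean_space. 1 / (1 + norm x) ^ (DIM('a) + 2))"
proof (rule integrableI_nonneg)
  define p where "p = DIM('a) + 2"
  define V where "V = unit_ball_vol (DIM('a))"
  define u where "u n x = ennreal (1 / real (Suc n) ^ p) * indicator (ball 0 (real (Suc n))) x" for n and x :: 'a
  have [measurable]: "u n \<in> borel_measurable borel" for n
    unfolding u_def by (intro borel_measurable_times_ennreal borel_measurable_const borel_measurable_indicator) auto
  have "ennreal (1 / (1 + norm x) ^ p) \<le> (\<Sum>n. u n x)" for x :: 'a
  proof -
    define n where "n = nat \<lfloor>norm x\<rfloor>"
    have n: "real n \<le> norm x" "norm x < real (Suc n)" by (auto simp: n_def) linarith+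
    have "1 / (1 + norm x) ^ p \<le> 1 / real (Suc n) ^ p"
      using n by (intro divide_left_mono power_mono mult_pos_pos zero_less_power) auto
    then have "ennreal (1 / (1 + norm x) ^ p) \<le> u n x"
      using n by (simp add: u_def ennreal_leI)
    also have "\<dots> \<le> (\<Sum>n. u n x)"
      using sum_le_suminf[of "\<lambda>n. u n x" "{n}"] by simp
    finally show ?thesis .
  qed
  then have "(\<integral>\<^sup>+(x::'a). ennreal (1 / (1 + norm x) ^ p) \<partial>lborel) \<le> (\<integral>\<^sup>+(x::'a). (\<Sum>n. u n x) \<partial>lborel)"
    by (intro nn_integral_mono)
  also have "\<dots> = (\<Sum>n. \<integral>\<^sup>+(x::'a). u n x \<partial>lborel)"
    by (intro nn_integral_suminf) simp
  also have "\<dots> = (\<Sum>n. ennreal (V * (1 / real (Suc n) ^ 2)))"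
  proof (intro suminf_cong)
    fix n
    have "(\<integral>\<^sup>+(x::'a). u n x \<partial>lborel) = ennreal (1 / real (Suc n) ^ p) * emeasure lborel (ball (0::'a) (real (Suc n)))"
      unfolding u_def by (simp add: nn_integral_cmult_indicator)
    also have "\<dots> = ennreal (1 / real (Suc n) ^ p * (V * real (Suc n) ^ DIM('a)))"
      by (subst emeasure_ball) (simp_all add: V_def ennreal_mult[symmetric] del: of_nat_Suc)
    also have "1 / real (Suc n) ^ p * (V * real (Suc n) ^ DIM('a)) = V * (1 / real (Suc n) ^ 2)"
      by (simp add: p_def power_add power2_eq_square del: of_nat_Suc)
    finally show "(\<integral>\<^sup>+(x::'a). u n x \<partial>lborel) = ennreal (V * (1 / real (Suc n) ^ 2))" .
  qed
  also have "\<dots> < \<infinity>"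
  proof -
    have "summable (\<lambda>n. 1 / real (Suc n) ^ 2)"
      using inverse_power_summable[of 2, where 'a = real] summable_Suc_iff[of "\<lambda>n. inverse (real n ^ 2)"]
      by (simp add: inverse_eq_divide)
    then have "summable (\<lambda>n. V * (1 / real (Suc n) ^ 2))" by (rule summable_mult)
    moreover have "V \<ge> 0" by (simp add: V_def)
    ultimately show ?thesis by (simp add: suminf_ennreal2 less_top[symmetric])
  qed
  finally show "(\<integral>\<^sup>+x. ennreal (1 / (1 + norm x) ^ (DIM('a) + 2)) \<partial>(lborel :: 'a measure)) < \<infinity>"
    by (simp add: p_def)
qed auto

lemma abs_add_one_norm: "\<bar>1 + norm y\<bar> = 1 + norm y"
  by simp

lemma fourier_weighted_integrable:
  fixes f :: "'a::euclidean_space \<Rightarrow> complex"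
  assumes "f \<in> test_functions"
  shows "integrable lborel (\<lambda>y. of_real ((1 + norm y) ^ n) * fourier f y)"
proof -
  obtain C where C: "\<And>y. (1 + norm y) ^ (n + (DIM('a) + 2)) * norm (fourier f y) \<le> C"
    using fourier_decay[OF assms] by blast
  have [measurable]: "fourier f \<in> borel_measurable borel"
    by (intro smooth_fun_measurable fourier_test_function_smooth assms)
  show ?thesis
  proof (rule Bochner_Integration.integrable_bound)
    show "integrable lborel (\<lambda>y::'a. C * (1 / (1 + norm y) ^ (DIM('a) + 2)))"
      by (intro integrable_mult_right integrable_weight)
    show "AE y in lborel. norm (of_real ((1 + norm y) ^ n) * fourier f y)
       \<le> norm (C * (1 / (1 + norm y) ^ (DIM('a) + 2)))"
    proof (rule AE_I2)
      fix y :: 'a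
      have "0 < (1 + norm y) ^ (DIM('a) + 2)" by (intro zero_less_power add_pos_nonneg) auto
      then have "(1 + norm y) ^ n * norm (fourier f y) \<le> C / (1 + norm y) ^ (DIM('a) + 2)"
        using C[of y] by (simp only: pos_le_divide_eq power_add mult_ac)
      also have "\<dots> \<le> norm (C * (1 / (1 + norm y) ^ (DIM('a) + 2)))"
        unfolding real_norm_def by (rule order_trans[OF _ abs_ge_self]) simp
      finally show "norm (of_real ((1 + norm y) ^ n) * fourier f y) \<le> norm (C * (1 / (1 + norm y) ^ (DIM('a) + 2)))"
        unfolding norm_mult[of "of_real _"] norm_of_real power_abs abs_add_one_norm .
    qed
  qed measurable
qed

lemma fourier_test_function_integrable: "f \<in> test_functions \<Longrightarrow> integrable lborel (fourier f)"
  using fourier_weighted_integrable[of f 0] by simp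

section \<open>Fubini identities, and a test function whose transform has nonzero integral\<close>

lemma fourier_multiplication:
  fixes f g :: "'a::euclidean_space \<Rightarrow> complex"
  assumes "integrable lborel f" "integrable lborel g"
  shows "(\<integral>v. f v * fourier g v \<partial>lborel) = (\<integral>s. g s * fourier f s \<partial>lborel)"
proof -
  have [measurable]: "f \<in> borel_measurable borel" "g \<in> borel_measurable borel" using assms by auto
  let ?F = "\<lambda>v s. f v * g s * cis (- 2 * pi * (s \<bullet> v))"
  have "integrable (lborel \<Otimes>\<^sub>M lborel) (case_prod ?F)"
  proof (rule lborel_pair.Fubini_integrable)
    show "integrable lborel (\<lambda>x. \<integral>y. norm (case (x, y) of (x, y) \<Rightarrow> ?F x y) \<partial>lborel)"
      using assms by (simp add: norm_mult)
    show "AE x in lborel. integrable lborel (\<lambda>y. case (x, y) of (x, y) \<Rightarrow> ?F x y)"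
      using fourier_integrable[OF assms(2)] by (simp add: mult.assoc)
  qed measurable
  from lborel_pair.Fubini_integral[OF this]
  have "(\<integral>s. (\<integral>v. ?F v s \<partial>lborel) \<partial>lborel) = (\<integral>v. (\<integral>s. ?F v s \<partial>lborel) \<partial>lborel)" .
  moreover have "(\<integral>s. ?F v s \<partial>lborel) = f v * fourier g v" for v
    by (simp add: fourier_eq mult.assoc)
  moreover have "(\<integral>v. ?F v s \<partial>lborel) = g s * fourier f s" for s
    by (simp add: fourier_eq mult.assoc mult.left_commute[of "f _"] inner_commute)
  ultimately show ?thesis by simp
qed

lemma fourier_smear:
  fixes f g :: "'a::euclidean_space \<Rightarrow> complex"
  assumes "f \<in> test_functions" "integrable lborel g"
  shows "fourier (smear f (\<lambda>v. v) g) y = fourier f y * fourier g y"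
proof -
  have fi: "integrable lborel f" using assms(1) by (rule test_function_integrable)
  have [measurable]: "f \<in> borel_measurable borel" "g \<in> borel_measurable borel" using assms fi by auto
  let ?F = "\<lambda>v x. f (x - v) * g v * cis (- 2 * pi * (x \<bullet> y))"
  have shift: "(\<integral>x. h (x - v) \<partial>lborel) = (\<integral>x. h x \<partial>lborel)"
    if [measurable]: "h \<in> borel_measurable borel" for h :: "'a \<Rightarrow> complex" and v
    using integral_affine[of 1 h "- v"] by simp
  have shift': "(\<integral>x. norm (f (x - v)) \<partial>lborel) = (\<integral>x. norm (f x) \<partial>lborel)" for v
  proof -
    have "(\<integral>x. of_real (norm (f (x - v))) \<partial>lborel) = (\<integral>x. of_real (norm (f x)) \<partial>lborel :: complex)"
      by (rule shift[of "\<lambda>x. of_real (norm (f x))"]) measurable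
    then show ?thesis by simp
  qed
  have inner: "(\<integral>x. ?F v x \<partial>lborel) = g v * cis (- 2 * pi * (v \<bullet> y)) * fourier f y" for v
  proof -
    have "(\<integral>x. ?F v x \<partial>lborel) = (\<integral>x. g v * cis (- 2 * pi * (v \<bullet> y)) * (f (x - v) * cis (- 2 * pi * ((x - v) \<bullet> y))) \<partial>lborel)"
      by (intro Bochner_Integration.integral_cong refl) (simp add: cis_mult inner_diff_left algebra_simps)
    also have "\<dots> = g v * cis (- 2 * pi * (v \<bullet> y)) * fourier f y"
      using shift[of "\<lambda>x. f x * cis (- 2 * pi * (x \<bullet> y))" v] by (simp add: fourier_eq)
    finally show ?thesis .
  qed
  have "integrable (lborel \<Otimes>\<^sub>M lborel) (case_prod ?F)"
  proof (rule lborel_pair.Fubini_integrable)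
    show "integrable lborel (\<lambda>x. \<integral>y. norm (case (x, y) of (x, y) \<Rightarrow> ?F x y) \<partial>lborel)"
      using assms(2) by (simp add: norm_mult shift')
    have "integrable lborel (\<lambda>x. f (x - v))" for v
      using integrable_affine[of 1 f "- v"] fi by simp
    from fourier_integrable[OF this]
    have "integrable lborel (\<lambda>x. g v * (f (x - v) * cis (- 2 * pi * (x \<bullet> y))))" for v
      by (intro integrable_mult_right)
    then show "AE v in lborel. integrable lborel (\<lambda>x. case (v, x) of (v, x) \<Rightarrow> ?F v x)"
      by (simp add: mult_ac)
  qed measurable
  from lborel_pair.Fubini_integral[OF this]
  have "(\<integral>x. (\<integral>v. ?F v x \<partial>lborel) \<partial>lborel) = (\<integral>v. (\<integral>x. ?F v x \<partial>lborel) \<partial>lborel)" .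
  then have "fourier (smear f (\<lambda>v. v) g) y = (\<integral>v. (\<integral>x. ?F v x \<partial>lborel) \<partial>lborel)"
    by (simp add: fourier_eq smear_def)
  also have "\<dots> = fourier f y * fourier g y"
    unfolding inner by (simp add: fourier_eq[of g] mult.commute)
  finally show ?thesis .
qed

lemma smear_test_function:
  assumes "f \<in> test_functions" "integrable lborel g" "\<And>x. R \<le> norm x \<Longrightarrow> g x = 0"
  shows "smear f (\<lambda>v. v) g \<in> test_functions"
proof -
  obtain R' where R': "\<And>x. R' \<le> norm x \<Longrightarrow> f x = 0"
    using test_function_support[OF assms(1)] by blast
  have "smear f (\<lambda>v. v) g y = 0" if "R + R' < norm y" for y
  proof -
    have "f (y - v) * g v = 0" for v
      using that R'[of "y - v"] assms(3)[of v] norm_triangle_ineq2[of y v] by fastforce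
    then show ?thesis by (simp only: smear_def Bochner_Integration.integral_zero)
  qed
  moreover have "smooth_fun (smear f (\<lambda>v. v) g)" using assms by (intro smear_smooth) auto
  ultimately show ?thesis unfolding test_functions_iff by blast
qed

text \<open>Since \<open>bump\<close> is real and even, its transform is real, and the transform of
  its convolution square is the square of that real function. It is nonnegative, and positive at
  \<open>0\<close>, where \<open>fourier bump\<close> is the integral of
  \<open>bump\<close>.\<close>

lemma ex_test_function_fourier_integral_nonzero:
  "\<exists>\<psi>\<in>test_functions. (\<integral>y. fourier \<psi> (y::'a::euclidean_space) \<partial>lborel) \<noteq> 0"
proof
  let ?h = "bump :: 'a \<Rightarrow> complex"
  let ?\<psi> = "smear ?h (\<lambda>v. v) ?h"
  have hi: "integrable lborel ?h" by (intro test_function_integrable bump_test_function)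
  show \<psi>: "?\<psi> \<in> test_functions"
    by (rule smear_test_function[where R = 1]) (auto simp: bump_test_function hi bump_outside)
  have cnj: "cnj (fourier ?h y) = fourier ?h y" for y
  proof -
    have [measurable]: "?h \<in> borel_measurable borel" using hi by auto
    have "cnj (fourier ?h y) = (\<integral>x. cnj (?h x * cis (- 2 * pi * (x \<bullet> y))) \<partial>lborel)"
      unfolding fourier_eq by (rule Bochner_Integration.integral_cnj[symmetric])
    also have "\<dots> = (\<integral>x. ?h x * cis (2 * pi * (x \<bullet> y)) \<partial>lborel)"
      by (simp add: bump_def cis_cnj)
    also have "\<dots> = fourier ?h y"
      using integral_affine[of "-1" "\<lambda>x. ?h x * cis (2 * pi * (x \<bullet> y))" 0] by (simp add: fourier_eq bump_minus)
    finally show ?thesis .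
  qed
  have sq: "fourier ?\<psi> y = of_real ((Re (fourier ?h y))\<^sup>2)" for y
  proof -
    have "fourier ?h y = of_real (Re (fourier ?h y))"
      using cnj[of y] by (simp add: complex_eq_iff)
    then have "fourier ?h y * fourier ?h y = of_real ((Re (fourier ?h y))\<^sup>2)"
      by (metis of_real_mult power2_eq_square)
    then show ?thesis using fourier_smear[OF bump_test_function hi, of y] by simp
  qed
  have "(\<integral>y. (Re (fourier ?h y))\<^sup>2 \<partial>lborel) > 0"
  proof (rule continuous_nonneg_integral_pos[of _ 0])
    have "integrable lborel (\<lambda>y. Re (fourier ?\<psi> y))"
      by (intro integrable_Re fourier_test_function_integrable \<psi>)
    then show "integrable lborel (\<lambda>y. (Re (fourier ?h y))\<^sup>2)" by (simp add: sq)
    show "continuous_on UNIV (\<lambda>y. (Re (fourier ?h y))\<^sup>2)"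
      by (intro continuous_intros smooth_fun_continuous fourier_test_function_smooth bump_test_function)
    obtain c where "c > 0" "(\<integral>x. bump (x::'a) \<partial>lborel) = of_real c" by (rule bump_integral)
    then show "0 < (Re (fourier ?h 0))\<^sup>2" by (simp add: fourier_eq)
  qed auto
  then show "(\<integral>y. fourier ?\<psi> y \<partial>lborel) \<noteq> 0" by (simp add: sq del: of_real_power)
qed

section \<open>Temperate distributions\<close>

lemma schwartz_space_smooth: "f \<in> schwartz_space \<Longrightarrow> smooth_fun f"
  by (simp add: schwartz_space_def)

lemma schwartz_space_bound:
  assumes "f \<in> schwartz_space" "bs \<in> lists Basis"
  obtains C where "\<And>x. (1 + norm x) ^ k * norm (iterated_partial bs f x) \<le> C"
  using assms unfolding schwartz_space_def bdd_above_def by blast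

lemma schwartz_spaceI:
  assumes "smooth_fun f"
    and "\<And>k bs. bs \<in> lists Basis \<Longrightarrow> \<exists>C. \<forall>x. (1 + norm x) ^ k * norm (iterated_partial bs f x) \<le> C"
  shows "f \<in> schwartz_space"
  using assms unfolding schwartz_space_def bdd_above_def by blast

lemma schwartz_seminorm_le:
  assumes "\<And>x. (1 + norm x) ^ k * norm (iterated_partial bs f x) \<le> C"
  shows "schwartz_seminorm k bs f \<le> C"
  unfolding schwartz_seminorm_def using assms by (intro cSUP_least) auto

lemma le_schwartz_seminorm:
  assumes "f \<in> schwartz_space" "bs \<in> lists Basis"
  shows "(1 + norm x) ^ k * norm (iterated_partial bs f x) \<le> schwartz_seminorm k bs f"
  unfolding schwartz_seminorm_def using assms unfolding schwartz_space_def by (intro cSUP_upper) auto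

lemma schwartz_space_add_cmult:
  assumes "f \<in> schwartz_space" "g \<in> schwartz_space"
  shows "(\<lambda>x. f x + c * g x) \<in> schwartz_space"
proof (rule schwartz_spaceI)
  show "smooth_fun (\<lambda>x. f x + c * g x)"
    using assms by (intro smooth_fun_add smooth_fun_cmult schwartz_space_smooth)
  fix k and bs :: "'a list" assume bs: "bs \<in> lists Basis"
  obtain C C' where C: "\<And>x. (1 + norm x) ^ k * norm (iterated_partial bs f x) \<le> C"
      "\<And>x. (1 + norm x) ^ k * norm (iterated_partial bs g x) \<le> C'"
    using schwartz_space_bound[OF assms(1) bs] schwartz_space_bound[OF assms(2) bs] by metis
  have "(1 + norm x) ^ k * norm (iterated_partial bs (\<lambda>x. f x + c * g x) x) \<le> C + norm c * C'" for x
  proof -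
    have "(1 + norm x) ^ k * norm (iterated_partial bs (\<lambda>x. f x + c * g x) x)
        \<le> (1 + norm x) ^ k * (norm (iterated_partial bs f x) + norm c * norm (iterated_partial bs g x))"
      unfolding iterated_partial_add_cmult[OF schwartz_space_smooth[OF assms(1)] schwartz_space_smooth[OF assms(2)] bs]
      by (intro mult_left_mono norm_triangle_le) (auto simp: norm_mult)
    also have "\<dots> = (1 + norm x) ^ k * norm (iterated_partial bs f x)
        + norm c * ((1 + norm x) ^ k * norm (iterated_partial bs g x))"
      by (simp add: algebra_simps)
    also have "\<dots> \<le> C + norm c * C'"
      using C[of x] by (intro add_mono mult_left_mono) auto
    finally show ?thesis .
  qed
  then show "\<exists>C. \<forall>x. (1 + norm x) ^ k * norm (iterated_partial bs (\<lambda>x. f x + c * g x) x) \<le> C" by blast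
qed

lemma schwartz_space_diff:
  assumes "f \<in> schwartz_space" "g \<in> schwartz_space"
  shows "(\<lambda>x. f x - g x) \<in> schwartz_space"
  using schwartz_space_add_cmult[OF assms, of "-1"] by simp

lemma schwartz_space_cmult:
  assumes "g \<in> schwartz_space"
  shows "(\<lambda>x. c * g x) \<in> schwartz_space"
  using schwartz_space_add_cmult[OF assms assms, of "c - 1"] by (simp add: algebra_simps)

lemma test_function_schwartz:
  assumes "f \<in> test_functions"
  shows "f \<in> schwartz_space"
proof (rule schwartz_spaceI)
  show "smooth_fun f" using assms by (rule test_function_smooth)
  fix k and bs :: "'a list" assume bs: "bs \<in> lists Basis"
  have t: "iterated_partial bs f \<in> test_functions"
    using assms bs by (rule test_function_iterated_partial)
  obtain R where R: "R > 0" "\<And>x. R \<le> norm x \<Longrightarrow> iterated_partial bs f x = 0"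
    using test_function_support[OF t] by blast
  have "continuous_on UNIV (\<lambda>x. of_real ((1 + norm x) ^ k) * iterated_partial bs f x)"
    by (intro continuous_intros smooth_fun_continuous test_function_smooth t)
  then obtain B where "\<And>x. norm (of_real ((1 + norm x) ^ k) * iterated_partial bs f x) \<le> B"
    by (rule compactly_supported_bounded[where R = R]) (use R in auto)
  then have "\<forall>x. (1 + norm x) ^ k * norm (iterated_partial bs f x) \<le> B"
    unfolding norm_mult norm_of_real power_abs abs_add_one_norm by blast
  then show "\<exists>C. \<forall>x. (1 + norm x) ^ k * norm (iterated_partial bs f x) \<le> C" by blast
qed

lemma schwartz_seminorm_triangle:
  assumes "f \<in> schwartz_space" "g \<in> schwartz_space" "bs \<in> lists Basis"
  shows "schwartz_seminorm k bs (\<lambda>x. f x + g x) \<le> schwartz_seminorm k bs f + schwartz_seminorm k bs g"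
proof (rule schwartz_seminorm_le)
  fix x
  have "iterated_partial bs (\<lambda>x. f x + g x) x = iterated_partial bs f x + iterated_partial bs g x"
    using iterated_partial_add_cmult[OF schwartz_space_smooth[OF assms(1)] schwartz_space_smooth[OF assms(2)] assms(3), of 1]
    by (simp add: fun_eq_iff)
  then have "(1 + norm x) ^ k * norm (iterated_partial bs (\<lambda>x. f x + g x) x)
      \<le> (1 + norm x) ^ k * (norm (iterated_partial bs f x) + norm (iterated_partial bs g x))"
    by (intro mult_left_mono) (auto simp: norm_triangle_ineq)
  also have "\<dots> \<le> schwartz_seminorm k bs f + schwartz_seminorm k bs g"
    using le_schwartz_seminorm[OF assms(1,3), of x k] le_schwartz_seminorm[OF assms(2,3), of x k]
    by (simp add: distrib_left)
  finally show "(1 + norm x) ^ k * norm (iterated_partial bs (\<lambda>x. f x + g x) x)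
      \<le> schwartz_seminorm k bs f + schwartz_seminorm k bs g" .
qed

text \<open>The topology is given by generators, so the passage from seminorms to open sets goes by
  induction on how \<open>U\<close> is generated. A generator containing \<open>f\<close> may be
  centred elsewhere, at \<open>g\<close>; the triangle inequality for the seminorm then leaves the
  positive slack \<open>e\<close> minus the distance from \<open>f\<close> to
  \<open>g\<close>.\<close>

lemma schwartz_topology_eventually:
  fixes f :: "'a::euclidean_space \<Rightarrow> complex"
  assumes U: "openin schwartz_topology U" and "f \<in> U"
    and f: "f \<in> schwartz_space" "\<And>n. F n \<in> schwartz_space"
    and lim: "\<And>k bs. bs \<in> lists Basis \<Longrightarrow> (\<lambda>n. schwartz_seminorm k bs (\<lambda>x. F n x - f x)) \<longlonglongrightarrow> 0"
  shows "\<forall>\<^sub>F n in sequentially. F n \<in> U"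
  using U[unfolded schwartz_topology_def openin_topology_generated_by_iff] \<open>f \<in> U\<close>
proof induction
  case (Int a b)
  then show ?case by (auto intro: eventually_conj)
next
  case (UN K)
  then obtain k where k: "k \<in> K" "f \<in> k" by blast
  with UN have "\<forall>\<^sub>F n in sequentially. F n \<in> k" by blast
  then show ?case by eventually_elim (use k in blast)
next
  case (Basis s)
  then obtain g k bs e where s: "s = {h \<in> schwartz_space. schwartz_seminorm k bs (\<lambda>x. h x - g x) < e}"
      and g: "g \<in> schwartz_space" "bs \<in> lists Basis" by blast
  have "schwartz_seminorm k bs (\<lambda>x. f x - g x) < e" using Basis s by blast
  then have "\<forall>\<^sub>F n in sequentially. schwartz_seminorm k bs (\<lambda>x. F n x - f x) < e - schwartz_seminorm k bs (\<lambda>x. f x - g x)"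
    by (intro order_tendstoD(2)[OF lim[OF g(2)]]) simp
  then show ?case
  proof eventually_elim
    case (elim n)
    have "schwartz_seminorm k bs (\<lambda>x. (F n x - f x) + (f x - g x))
        \<le> schwartz_seminorm k bs (\<lambda>x. F n x - f x) + schwartz_seminorm k bs (\<lambda>x. f x - g x)"
      using f g by (intro schwartz_seminorm_triangle schwartz_space_diff)
    then show ?case using elim f(2)[of n] by (simp add: s)
  qed
qed simp

text \<open>The sequential form in which the continuity of a temperate distribution is applied
  below.\<close>

lemma temperate_distribution_tendsto:
  fixes f :: "'a::euclidean_space \<Rightarrow> complex"
  assumes T: "temperate_distribution T"
    and f: "f \<in> schwartz_space" "\<And>n. F n \<in> schwartz_space"
    and lim: "\<And>k bs. bs \<in> lists Basis \<Longrightarrow> (\<lambda>n. schwartz_seminorm k bs (\<lambda>x. F n x - f x)) \<longlonglongrightarrow> 0"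
  shows "(\<lambda>n. T (F n)) \<longlonglongrightarrow> T f"
proof (rule topological_tendstoI)
  fix S assume S: "open S" "T f \<in> S"
  have cm: "continuous_map schwartz_topology euclidean T"
    using T by (simp add: temperate_distribution_def)
  then have op: "openin schwartz_topology {x \<in> topspace schwartz_topology. T x \<in> S}"
    using S(1) unfolding continuous_map_def by simp
  \<comment> \<open>The unit ball around \<open>f\<close> for the supremum seminorm is a generator,
    which places \<open>f\<close> in \<open>topspace\<close>.\<close>
  have "schwartz_seminorm 0 [] (\<lambda>x. f x - f x) \<le> 0"
    by (rule schwartz_seminorm_le) simp
  then have *: "f \<in> {g \<in> schwartz_space. schwartz_seminorm 0 [] (\<lambda>x. g x - f x) < 1}" using f(1) by simp
  have "f \<in> topspace schwartz_topology"
    unfolding schwartz_topology_def topology_generated_by_topspace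
    by (rule UnionI[OF CollectI *], intro exI[of _ f] exI[of _ "0::nat"] exI[of _ "[]"] exI[of _ "1::real"])
       (use f(1) in simp)
  with S(2) have "\<forall>\<^sub>F n in sequentially. F n \<in> {x \<in> topspace schwartz_topology. T x \<in> S}"
    by (intro schwartz_topology_eventually[OF op _ f lim]) auto
  then show "\<forall>\<^sub>F n in sequentially. T (F n) \<in> S" by eventually_elim simp
qed

text \<open>The Lipschitz bound on \<open>f\<close> supplies the rate \<open>norm v / m\<close>. The
  weight in \<open>y\<close> is paid for by moments of \<open>k\<close>, which is why
  \<open>k\<close> is required to be integrable against every power of
  \<open>1 + norm v\<close>.\<close>

lemma smear_approximates:
  fixes f k :: "'a::euclidean_space \<Rightarrow> complex"
  assumes f: "f \<in> test_functions"
    and k: "\<And>n. integrable lborel (\<lambda>v. of_real ((1 + norm v) ^ n) * k v)"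
  shows "\<exists>C. \<forall>m\<ge>1. \<forall>y. (1 + norm y) ^ p * norm (smear f (\<lambda>v. (1 / m) *\<^sub>R v) k y
    - (\<integral>v. k v \<partial>lborel) * f y) \<le> C / m"
proof -
  have ki: "integrable lborel k" using k[of 0] by simp
  obtain R where R: "R > 0" "\<And>x. R \<le> norm x \<Longrightarrow> f x = 0" using test_function_support[OF f] by blast
  obtain L where L: "L \<ge> 0" "\<And>x y. norm (f x - f y) \<le> L * norm (x - y)"
    using test_function_lipschitz[OF f] by blast
  define C where "C = (\<integral>v. (1 + R) ^ p * L * norm (of_real ((1 + norm v) ^ (p + 1)) * k v) \<partial>lborel)"
  have "(1 + norm y) ^ p * norm (smear f (\<lambda>v. (1 / m) *\<^sub>R v) k y - (\<integral>v. k v \<partial>lborel) * f y) \<le> C / m"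
    if m: "m \<ge> 1" for m y
  proof -
    let ?d = "\<lambda>v. f (y - (1 / m) *\<^sub>R v) - f y"
    have int: "integrable lborel (\<lambda>v. f (y - (1 / m) *\<^sub>R v) * k v)"
      using f ki by (intro smear_integrable) auto
    have int': "integrable lborel (\<lambda>v. ?d v * k v)"
      using int ki by (simp add: left_diff_distrib)
    have "smear f (\<lambda>v. (1 / m) *\<^sub>R v) k y - (\<integral>v. k v \<partial>lborel) * f y = (\<integral>v. ?d v * k v \<partial>lborel)"
      unfolding left_diff_distrib smear_def
      using Bochner_Integration.integral_diff[OF int integrable_mult_right[of "f y", OF ki]]
      by (simp add: mult.commute)
    then have "(1 + norm y) ^ p * norm (smear f (\<lambda>v. (1 / m) *\<^sub>R v) k y - (\<integral>v. k v \<partial>lborel) * f y)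
        \<le> (1 + norm y) ^ p * (\<integral>v. norm (?d v * k v) \<partial>lborel)"
      by (simp add: mult_left_mono)
    also have "\<dots> = (\<integral>v. (1 + norm y) ^ p * norm (?d v * k v) \<partial>lborel)" by simp
    also have "\<dots> \<le> (\<integral>v. (1 / m) * ((1 + R) ^ p * L * norm (of_real ((1 + norm v) ^ (p + 1)) * k v)) \<partial>lborel)"
    proof (rule integral_mono)
      show "integrable lborel (\<lambda>v. (1 + norm y) ^ p * norm (?d v * k v))"
        by (intro integrable_mult_right integrable_norm int')
      show "integrable lborel (\<lambda>v. (1 / m) * ((1 + R) ^ p * L * norm (of_real ((1 + norm v) ^ (p + 1)) * k v)))"
        by (intro integrable_mult_right integrable_norm k)
      fix v
      have *: "(1 + norm y) ^ p * norm (?d v) \<le> (1 + R) ^ p * (1 + norm v) ^ p * (L * ((1 / m) * norm v))"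
      proof (cases "?d v = 0")
        case False
        have "norm ((1 / m) *\<^sub>R v) \<le> norm v" using m by (simp add: divide_le_eq mult_le_cancel_left1)
        \<comment> \<open>A nonzero difference requires \<open>y\<close> or its translate in the
          support ball, so \<open>norm y \<le> R + norm v\<close>; this turns the weight in
          \<open>y\<close> into a weight in \<open>v\<close>.\<close>
        moreover have "norm y \<le> R \<or> norm (y - (1 / m) *\<^sub>R v) \<le> R" using False R(2) by force
        ultimately have "norm y \<le> R + norm v"
          using norm_triangle_ineq2[of y "(1 / m) *\<^sub>R v"] norm_ge_zero[of v] by linarith
        then have "1 + norm y \<le> (1 + R) * (1 + norm v)"
          using R(1) by (simp add: algebra_simps) (smt (verit) mult_nonneg_nonneg norm_ge_zero)
        then have "(1 + norm y) ^ p \<le> (1 + R) ^ p * (1 + norm v) ^ p"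
          unfolding power_mult_distrib[symmetric] by (intro power_mono) auto
        moreover have "norm (?d v) \<le> L * ((1 / m) * norm v)"
          using L(2)[of "y - (1 / m) *\<^sub>R v" y] m by simp
        ultimately show ?thesis using R(1) by (intro mult_mono) auto
      qed (use m R L in simp)
      have "(1 + norm y) ^ p * norm (?d v * k v) = (1 + norm y) ^ p * norm (?d v) * norm (k v)"
        by (simp add: norm_mult)
      also have "\<dots> \<le> (1 + R) ^ p * (1 + norm v) ^ p * (L * ((1 / m) * norm v)) * norm (k v)"
        using * by (rule mult_right_mono) simp
      also have "\<dots> \<le> (1 + R) ^ p * (1 + norm v) ^ p * (L * ((1 / m) * (1 + norm v))) * norm (k v)"
        using m R(1) L(1) by (intro mult_right_mono mult_left_mono) auto
      also have "\<dots> = (1 / m) * ((1 + R) ^ p * L * norm (of_real ((1 + norm v) ^ (p + 1)) * k v))"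
        unfolding norm_mult norm_of_real power_abs abs_add_one_norm by (simp add: mult_ac)
      finally show "(1 + norm y) ^ p * norm (?d v * k v)
          \<le> (1 / m) * ((1 + R) ^ p * L * norm (of_real ((1 + norm v) ^ (p + 1)) * k v))" .
    qed
    also have "\<dots> = C / m" by (simp add: C_def)
    finally show ?thesis .
  qed
  then show ?thesis by blast
qed

text \<open>Averaging commutes with partial derivatives, so \<open>smear_approximates\<close>,
  applied to every iterated partial derivative of \<open>f\<close>, gives convergence at rate
  \<open>1 / n\<close> in each seminorm.\<close>

lemma temperate_distribution_smear_tendsto:
  fixes f k :: "'a::euclidean_space \<Rightarrow> complex"
  assumes f: "f \<in> test_functions"
    and k: "\<And>n. integrable lborel (\<lambda>v. of_real ((1 + norm v) ^ n) * k v)"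
    and T: "temperate_distribution T"
  shows "(\<lambda>n. T (smear f (\<lambda>v. (1 / real (Suc n)) *\<^sub>R v) k)) \<longlonglongrightarrow> (\<integral>v. k v \<partial>lborel) * T f"
proof -
  have ki: "integrable lborel k" using k[of 0] by simp
  define c where "c = (\<integral>v. k v \<partial>lborel)"
  define F where "F n = smear f (\<lambda>v. (1 / real (Suc n)) *\<^sub>R v) k" for n
  have fS: "f \<in> schwartz_space" using f by (rule test_function_schwartz)
  then have cfS: "(\<lambda>x. c * f x) \<in> schwartz_space" by (rule schwartz_space_cmult)
  have smooth: "smooth_fun (F n)" for n
    unfolding F_def using f ki by (intro smear_smooth) auto
  have smooth_cf: "smooth_fun (\<lambda>x. c * f x)" using cfS by (rule schwartz_space_smooth)
  have diff: "iterated_partial bs (\<lambda>x. F n x - c * f x) x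
     = smear (iterated_partial bs f) (\<lambda>v. (1 / real (Suc n)) *\<^sub>R v) k x - c * iterated_partial bs f x"
    if "bs \<in> lists Basis" for bs n x
  proof -
    have "iterated_partial bs (\<lambda>x. F n x + (- c) * f x) = (\<lambda>x. iterated_partial bs (F n) x + (- c) * iterated_partial bs f x)"
      using smooth[of n] test_function_smooth[OF f] that by (rule iterated_partial_add_cmult)
    moreover have "iterated_partial bs (F n) = smear (iterated_partial bs f) (\<lambda>v. (1 / real (Suc n)) *\<^sub>R v) k"
      unfolding F_def using f ki that by (intro iterated_partial_smear) auto
    ultimately show ?thesis by (simp add: fun_eq_iff)
  qed
  have ex: "\<exists>C. \<forall>n x. (1 + norm x) ^ p * norm (iterated_partial bs (\<lambda>x. F n x - c * f x) x) \<le> C / real (Suc n)"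
    if bs: "bs \<in> lists Basis" for p bs
  proof -
    obtain C where C: "\<And>m y. m \<ge> 1 \<Longrightarrow> (1 + norm y) ^ p *
        norm (smear (iterated_partial bs f) (\<lambda>v. (1 / m) *\<^sub>R v) k y - c * iterated_partial bs f y) \<le> C / m"
      unfolding c_def using smear_approximates[OF test_function_iterated_partial[OF f bs] k, of p] by blast
    show ?thesis
      unfolding diff[OF bs] using C[of "real (Suc _)"] by (intro exI[of _ C]) simp
  qed
  \<comment> \<open>The averages have no bounded support in general. The error bound shows that the
    error is a Schwartz function, and the average is the error plus \<open>c * f\<close>.\<close>
  have dS: "(\<lambda>x. F n x - c * f x) \<in> schwartz_space" for n
  proof (rule schwartz_spaceI)
    show "smooth_fun (\<lambda>x. F n x - c * f x)"
      using smooth_fun_add[OF smooth smooth_fun_cmult[OF smooth_cf, of "-1"]] by simp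
    show "\<exists>C. \<forall>x. (1 + norm x) ^ p * norm (iterated_partial bs (\<lambda>x. F n x - c * f x) x) \<le> C"
      if "bs \<in> lists Basis" for p bs
      using ex[OF that, of p] by blast
  qed
  have FS: "F n \<in> schwartz_space" for n
    using schwartz_space_add_cmult[OF dS[of n] cfS, of 1] by simp
  have "(\<lambda>n. T (F n)) \<longlonglongrightarrow> T (\<lambda>x. c * f x)"
  proof (rule temperate_distribution_tendsto[OF T cfS FS])
    fix p and bs :: "'a list" assume bs: "bs \<in> lists Basis"
    obtain C where C: "\<And>n x. (1 + norm x) ^ p * norm (iterated_partial bs (\<lambda>x. F n x - c * f x) x)
        \<le> C / real (Suc n)"
      using ex[OF bs, of p] by blast
    show "(\<lambda>n. schwartz_seminorm p bs (\<lambda>x. F n x - c * f x)) \<longlonglongrightarrow> 0"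
    proof (rule tendsto_sandwich[of "\<lambda>_. 0" _ _ "\<lambda>n. C / real (Suc n)"])
      show "\<forall>\<^sub>F n in sequentially. 0 \<le> schwartz_seminorm p bs (\<lambda>x. F n x - c * f x)"
        using le_schwartz_seminorm[OF schwartz_space_diff[OF FS cfS] bs, of 0 p]
        by (intro always_eventually allI) (rule order_trans[rotated], assumption, simp)
      show "\<forall>\<^sub>F n in sequentially. schwartz_seminorm p bs (\<lambda>x. F n x - c * f x) \<le> C / real (Suc n)"
        by (intro always_eventually allI schwartz_seminorm_le C)
      show "(\<lambda>n. C / real (Suc n)) \<longlonglongrightarrow> 0"
        using tendsto_mult_right_zero[OF LIMSEQ_inverse_real_of_nat, of "C"] by (simp add: divide_inverse)
    qed simp
  qed
  moreover have "T (\<lambda>x. c * f x) = c * T f"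
    using T fS by (simp add: temperate_distribution_def)
  ultimately show "(\<lambda>n. T (smear f (\<lambda>v. (1 / real (Suc n)) *\<^sub>R v) k)) \<longlonglongrightarrow> (\<integral>v. k v \<partial>lborel) * T f"
    by (simp add: F_def c_def)
qed

text \<open>The multiplication formula moves the transform from \<open>g\<close> onto
  \<open>v \<mapsto> f (y - v / m)\<close>, whose transform carries a factor \<open>m ^ DIM\<close>,
  a character in \<open>y\<close> and a reflected, dilated \<open>fourier f\<close>. Rescaling the
  variable by \<open>m\<close> removes the factor, and what remains is a Fourier integral at
  \<open>y\<close>.\<close>

lemma smear_fourier:
  fixes f g :: "'a::euclidean_space \<Rightarrow> complex"
  assumes "f \<in> test_functions" "g \<in> test_functions" "m > 0"
  shows "smear f (\<lambda>v. (1 / m) *\<^sub>R v) (fourier g)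
    = fourier (\<lambda>s. g ((1 / m) *\<^sub>R s) * fourier f (- s))"
proof
  fix y :: 'a
  have fi: "integrable lborel f" and gi: "integrable lborel g"
    using assms by (auto intro: test_function_integrable)
  have [measurable]: "f \<in> borel_measurable borel" "g \<in> borel_measurable borel" using fi gi by auto
  have [measurable]: "fourier f \<in> borel_measurable borel"
    using assms(1) by (intro smooth_fun_measurable fourier_test_function_smooth)
  let ?D = "DIM('a)"
  let ?h = "\<lambda>v. f (y - (1 / m) *\<^sub>R v)"
  have hi: "integrable lborel ?h"
    using integrable_affine[of "- 1 / m" f y] fi assms(3) by simp
  have h: "fourier ?h s = m ^ ?D *\<^sub>R (cis (- 2 * pi * m * (s \<bullet> y)) * fourier f (- (m *\<^sub>R s)))" for s
  proof -
    have "fourier ?h s = m ^ ?D *\<^sub>R (\<integral>x. f x * cis (- 2 * pi * ((m *\<^sub>R y - m *\<^sub>R x) \<bullet> s)) \<partial>lborel)"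
      unfolding fourier_eq
      using assms(3) by (subst integral_affine[where c = "- m" and t = "m *\<^sub>R y"]) (auto simp: algebra_simps)
    also have "(\<integral>x. f x * cis (- 2 * pi * ((m *\<^sub>R y - m *\<^sub>R x) \<bullet> s)) \<partial>lborel)
      = (\<integral>x. cis (- 2 * pi * m * (s \<bullet> y)) * (f x * cis (- 2 * pi * (x \<bullet> (- (m *\<^sub>R s))))) \<partial>lborel)"
      by (intro Bochner_Integration.integral_cong refl)
         (simp add: cis_mult inner_diff_left inner_commute algebra_simps)
    also have "\<dots> = cis (- 2 * pi * m * (s \<bullet> y)) * fourier f (- (m *\<^sub>R s))"
      by (simp add: fourier_eq)
    finally show ?thesis .
  qed
  have "smear f (\<lambda>v. (1 / m) *\<^sub>R v) (fourier g) y = (\<integral>s. g s * fourier ?h s \<partial>lborel)"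
    unfolding smear_def using hi gi by (rule fourier_multiplication)
  also have "\<dots> = m ^ ?D *\<^sub>R (\<integral>s. g s * (cis (- 2 * pi * m * (s \<bullet> y)) * fourier f (- (m *\<^sub>R s))) \<partial>lborel)"
    unfolding h by simp
  also have "\<dots> = (\<integral>s. g ((1 / m) *\<^sub>R s) * fourier f (- s) * cis (- 2 * pi * (s \<bullet> y)) \<partial>lborel)"
    using assms(3) by (subst (2) integral_affine[where c = m and t = 0]) (auto simp: mult_ac)
  finally show "smear f (\<lambda>v. (1 / m) *\<^sub>R v) (fourier g) y
      = fourier (\<lambda>s. g ((1 / m) *\<^sub>R s) * fourier f (- s)) y"
    by (simp add: fourier_eq)
qed

section \<open>Atomic measures\<close>

lemma singleton_bounded_borel: "{x} \<in> bounded_borel"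
  by (simp add: bounded_borel_def)

lemma cball_bounded_borel: "cball a R \<in> bounded_borel"
  by (simp add: bounded_borel_def)

text \<open>Evaluation at singletons identifies the unknown coefficients as \<open>m {x}\<close>.
  Afterwards an atomic measure is determined by its atoms, so in the end it suffices to compare
  \<open>\<mu> {q}\<close> with \<open>\<nu> {q}\<close>.\<close>

lemma atomic_measure_has_sum:
  assumes "atomic_measure m" "A \<in> bounded_borel"
  shows "((\<lambda>x. m {x}) has_sum m A) A"
proof -
  obtain L a where a: "\<And>A. A \<in> bounded_borel \<Longrightarrow> (a has_sum m A) (L \<inter> A)"
    using assms(1) unfolding atomic_measure_def by blast
  have pt: "m {x} = (if x \<in> L then a x else 0)" for x
  proof -
    have "(a has_sum m {x}) (L \<inter> {x})" by (rule a[OF singleton_bounded_borel])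
    moreover have "(a has_sum (if x \<in> L then a x else 0)) (L \<inter> {x})"
      by (rule has_sum_finiteI) auto
    ultimately show ?thesis by (rule has_sum_unique)
  qed
  have "((\<lambda>x. m {x}) has_sum m A) A \<longleftrightarrow> (a has_sum m A) (L \<inter> A)"
    by (rule has_sum_cong_neutral) (auto simp: pt)
  with a[OF assms(2)] show ?thesis by simp
qed

lemma atomic_measure_abs_summable:
  assumes "atomic_measure m" "A \<in> bounded_borel"
  shows "(\<lambda>x. norm (m {x})) summable_on A"
  using summable_on_iff_abs_summable_on_complex[THEN iffD1,
    OF has_sum_imp_summable[OF atomic_measure_has_sum[OF assms]]] .

lemma atomic_integral_abs_summable:
  assumes "atomic_measure m" "f \<in> test_functions"
  shows "(\<lambda>x. norm (m {x} * f x)) summable_on UNIV"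
proof -
  obtain R where R: "\<And>x. R \<le> norm x \<Longrightarrow> f x = 0" using test_function_support[OF assms(2)] by blast
  obtain B where B: "B \<ge> 0" "\<And>x. norm (f x) \<le> B" using test_function_bounded[OF assms(2)] by blast
  have "(\<lambda>x. B * norm (m {x})) summable_on cball 0 R"
    by (intro summable_on_cmult_right atomic_measure_abs_summable assms(1) cball_bounded_borel)
  then have "(\<lambda>x. norm (m {x} * f x)) summable_on cball 0 R"
    by (rule summable_on_comparison_test)
       (use B in \<open>auto simp: norm_mult mult.commute[of B] intro!: mult_left_mono\<close>)
  then show ?thesis
    by (subst summable_on_cong_neutral[where T = "cball 0 R" and g = "\<lambda>x. norm (m {x} * f x)"])
       (auto simp: R)
qed

text \<open>A partition of a singleton consists of \<open>{x}\<close> and possibly the empty set, so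
  the supremum runs over a single value. A distribution extending the total variation sees exactly
  these atoms, through \<open>atomic_integral\<close>.\<close>

lemma total_variation_singleton:
  assumes "atomic_measure m"
  shows "total_variation m {x} = of_real (norm (m {x}))"
proof -
  have m0: "m {} = 0"
  proof -
    have "{} \<in> (bounded_borel :: 'a set set)" by (simp add: bounded_borel_def)
    from atomic_measure_has_sum[OF assms this] show ?thesis
      using has_sum_empty has_sum_unique by blast
  qed
  let ?P = "{P. finite P \<and> P \<subseteq> sets borel \<and> disjoint P \<and> \<Union>P = {x}}"
  have sum: "(\<Sum>B\<in>P. norm (m B)) = norm (m {x})" if P: "P \<in> ?P" for P
  proof -
    have UP: "\<Union>P = {x}" using P by simp
    then have sub: "B = {} \<or> B = {x}" if "B \<in> P" for B
      using Union_upper[OF that] by (simp add: subset_singleton_iff)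
    obtain B where "B \<in> P" "x \<in> B" using UP by (metis UnionE singletonI)
    with sub have "{x} \<in> P" by fastforce
    then have "(\<Sum>B\<in>P. norm (m B)) = norm (m {x}) + (\<Sum>B\<in>P - {{x}}. norm (m B))"
      using P by (subst sum.remove[of P "{x}"]) auto
    also have "(\<Sum>B\<in>P - {{x}}. norm (m B)) = 0"
      using sub m0 by (intro sum.neutral) auto
    finally show ?thesis by simp
  qed
  have ne: "{{x}} \<in> ?P" by auto
  have "(\<lambda>P. \<Sum>B\<in>P. norm (m B)) ` ?P = {norm (m {x})}"
  proof
    show "(\<lambda>P. \<Sum>B\<in>P. norm (m B)) ` ?P \<subseteq> {norm (m {x})}" using sum by blast
    show "{norm (m {x})} \<subseteq> (\<lambda>P. \<Sum>B\<in>P. norm (m B)) ` ?P"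
      using imageI[OF ne, of "\<lambda>P. \<Sum>B\<in>P. norm (m B)"] sum[OF ne] by simp
  qed
  then show ?thesis by (simp add: total_variation_def)
qed

section \<open>Polynomial growth of atoms when the total variation is temperate\<close>

lemma bump_eq_norm: "bump x = of_real (norm (bump x))"
  by (simp add: bump_def flat_nonneg)

lemma bump_ge: "norm x \<le> 1 / 2 \<Longrightarrow> exp (- 2) \<le> norm (bump x)"
proof -
  assume "norm x \<le> 1 / 2"
  then have "x \<bullet> x \<le> (1 / 2)\<^sup>2" unfolding power2_norm_eq_inner[symmetric] by (rule power_mono) simp
  then have s: "1 - x \<bullet> x \<ge> 1 / 2" by (simp add: power2_eq_square)
  then have "1 / (1 - x \<bullet> x) \<le> 1 / (1 / 2)" by (intro divide_left_mono) auto
  then show ?thesis using s by (simp add: bump_def flat_def)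
qed

definition atomic_mass :: "('a::euclidean_space set \<Rightarrow> complex) \<Rightarrow> nat \<Rightarrow> real" where
  "atomic_mass m n = (\<Sum>\<^sub>\<infinity>x\<in>cball 0 (real n). norm (m {x}))"

text \<open>If the bound fails for every exponent \<open>K\<close>, let \<open>N K\<close> be a
  radius at which it fails. Suitably scaled, widely dilated bumps then tend to \<open>0\<close> in
  the Schwartz space, while the distribution \<open>T\<close> extending the total variation stays at
  least \<open>exp (- 2)\<close> in norm on them.\<close>

lemma atomic_mass_polynomial_growth:
  fixes m :: "'a::euclidean_space set \<Rightarrow> complex"
  assumes m: "atomic_measure m" and tv: "temperate_atomic_measure (total_variation m)"
  shows "\<exists>K. \<forall>n. atomic_mass m n \<le> real (Suc K) * (1 + real n) ^ K"
proof (rule ccontr)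
  assume "\<not> ?thesis"
  then obtain N where N: "\<And>K. real (Suc K) * (1 + real (N K)) ^ K < atomic_mass m (N K)"
    by (metis not_le)
  obtain T where T: "temperate_distribution T"
    and ext: "\<And>f. f \<in> test_functions \<Longrightarrow> T f = atomic_integral (total_variation m) f"
    using tv unfolding temperate_atomic_measure_def extends_atomic_measure_def by blast
  \<comment> \<open>This dilation maps \<open>cball 0 (real (N K))\<close> into the ball of radius
    \<open>1 / 2\<close>, where \<open>bump\<close> is at least \<open>exp (- 2)\<close>.\<close>
  define r where "r K = 2 * (1 + real (N K))" for K
  have r: "r K \<ge> 2" "r K > 0" for K by (auto simp: r_def)
  \<comment> \<open>The reciprocal of the violated bound: times the mass it exceeds
    \<open>1\<close>, while \<open>r K ^ k * s K \<le> 2 ^ k / Suc K\<close> once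
    \<open>K \<ge> k\<close>. The factor \<open>Suc K\<close> was put into the bound to make the
    seminorms tend to \<open>0\<close>.\<close>
  define s where "s K = 1 / (real (Suc K) * (1 + real (N K)) ^ K)" for K
  have s: "s K > 0" for K by (simp add: s_def add_pos_nonneg)
  define f0 where "f0 K x = bump (0 + (1 / r K) *\<^sub>R (x::'a))" for K x
  define f where "f K x = of_real (s K) * f0 K x" for K x
  have f0: "f0 K \<in> test_functions" for K
    unfolding f0_def using r(2)[of K] by (intro test_function_affine bump_test_function) simp
  have zero: "(\<lambda>_. 0) \<in> (test_functions :: ('a \<Rightarrow> complex) set)"
    by (auto simp: test_functions_iff smooth_fun_const)
  have ft: "f K \<in> test_functions" for K
    using test_function_mult_smooth[OF f0 smooth_fun_const, of K "of_real (s K)"]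
    by (simp add: f_def[abs_def] mult.commute)
  have bnd: "\<exists>C. \<forall>K\<ge>k. schwartz_seminorm k bs (f K) \<le> C / real (Suc K)" if bs: "bs \<in> lists Basis" for k bs
  proof -
    obtain C where C: "\<And>x. (1 + norm x) ^ k * norm (iterated_partial bs bump (x::'a)) \<le> C"
      using schwartz_space_bound[OF test_function_schwartz[OF bump_test_function] bs] by metis
    have C0: "0 \<le> C" using C[of 0] by (rule order_trans[rotated]) simp
    have "schwartz_seminorm k bs (f K) \<le> 2 ^ k * C / real (Suc K)" if K: "K \<ge> k" for K
    proof (rule schwartz_seminorm_le)
      fix x :: 'a
      let ?u = "(1 / r K) *\<^sub>R x"
      let ?D = "iterated_partial bs bump ?u"
      have "iterated_partial bs (\<lambda>x. 0 + of_real (s K) * f0 K x) x = 0 + of_real (s K) * iterated_partial bs (f0 K) x"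
        using iterated_partial_add_cmult[OF test_function_smooth[OF zero] test_function_smooth[OF f0] bs]
          iterated_partial_add_cmult[OF test_function_smooth[OF zero] test_function_smooth[OF zero] bs, of "-1"]
        by (simp add: fun_eq_iff)
      then have "iterated_partial bs (f K) x = of_real (s K) * (of_real (1 / r K) ^ length bs * ?D)"
        unfolding f0_def iterated_partial_affine[OF test_function_smooth[OF bump_test_function] bs]
        by (simp add: f_def[abs_def] f0_def[abs_def])
      then have "norm (iterated_partial bs (f K) x) = s K * ((1 / r K) ^ length bs * norm ?D)"
        using r[of K] s[of K] by (simp add: norm_mult norm_power norm_divide)
      also have "\<dots> \<le> s K * (1 * norm ?D)"
        using r[of K] s[of K] by (intro mult_left_mono mult_right_mono power_le_one) auto
      finally have 1: "norm (iterated_partial bs (f K) x) \<le> s K * norm ?D" by simp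
      have "1 + norm x \<le> r K * (1 + norm ?u)" using r[of K] by (simp add: algebra_simps)
      then have 2: "(1 + norm x) ^ k \<le> r K ^ k * (1 + norm ?u) ^ k"
        unfolding power_mult_distrib[symmetric] by (intro power_mono) auto
      have "(1 + norm x) ^ k * norm (iterated_partial bs (f K) x)
          \<le> (r K ^ k * (1 + norm ?u) ^ k) * (s K * norm ?D)"
        using 1 2 r[of K] by (intro mult_mono) auto
      also have "\<dots> = r K ^ k * s K * ((1 + norm ?u) ^ k * norm ?D)" by simp
      also have "\<dots> \<le> r K ^ k * s K * C"
        using C[of ?u] r[of K] s[of K] by (intro mult_left_mono) auto
      also have "r K ^ k * s K \<le> 2 ^ k * (1 / real (Suc K))"
      proof -
        have "(1 + real (N K)) ^ k \<le> (1 + real (N K)) ^ K" using K by (intro power_increasing) auto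
        then have "(1 + real (N K)) ^ k / (1 + real (N K)) ^ K \<le> 1" by (simp add: divide_le_eq)
        then have "2 ^ k * ((1 + real (N K)) ^ k / (1 + real (N K)) ^ K) / real (Suc K) \<le> 2 ^ k * 1 / real (Suc K)"
          by (intro divide_right_mono mult_left_mono) auto
        also have "2 ^ k * ((1 + real (N K)) ^ k / (1 + real (N K)) ^ K) / real (Suc K) = r K ^ k * s K"
          unfolding r_def s_def power_mult_distrib by simp
        finally show ?thesis by simp
      qed
      finally show "(1 + norm x) ^ k * norm (iterated_partial bs (f K) x) \<le> 2 ^ k * C / real (Suc K)"
        using C0 by (simp add: mult_right_mono)
    qed
    then show ?thesis by blast
  qed
  have "(\<lambda>K. T (f K)) \<longlonglongrightarrow> T (\<lambda>_. 0)"
  proof (rule temperate_distribution_tendsto[OF T])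
    fix k and bs :: "'a list" assume bs: "bs \<in> lists Basis"
    obtain C where C: "\<And>K. K \<ge> k \<Longrightarrow> schwartz_seminorm k bs (f K) \<le> C / real (Suc K)"
      using bnd[OF bs] by metis
    show "(\<lambda>K. schwartz_seminorm k bs (\<lambda>x. f K x - 0)) \<longlonglongrightarrow> 0"
    proof (rule tendsto_sandwich[of "\<lambda>_. 0" _ _ "\<lambda>n. C / real (Suc n)"])
      have "0 \<le> schwartz_seminorm k bs (f K)" for K
        using le_schwartz_seminorm[OF test_function_schwartz[OF ft] bs, of 0 k K]
        by (rule order_trans[rotated]) simp
      then show "\<forall>\<^sub>F K in sequentially. 0 \<le> schwartz_seminorm k bs (\<lambda>x. f K x - 0)" by simp
      show "\<forall>\<^sub>F K in sequentially. schwartz_seminorm k bs (\<lambda>x. f K x - 0) \<le> C / real (Suc K)"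
        using C by (auto simp: eventually_sequentially)
      show "(\<lambda>n. C / real (Suc n)) \<longlonglongrightarrow> 0"
        using tendsto_mult_right_zero[OF LIMSEQ_inverse_real_of_nat, of C] by (simp add: divide_inverse)
    qed simp
  qed (auto intro: test_function_schwartz ft zero)
  moreover have "T (\<lambda>_. 0) = 0" using ext[OF zero] by (simp add: atomic_integral_def)
  ultimately have lim: "(\<lambda>K. T (f K)) \<longlonglongrightarrow> 0" by simp
  have "exp (- 2) \<le> norm (T (f K))" for K
  proof -
    let ?g = "\<lambda>x. norm (m {x} * f K x)"
    have g: "?g summable_on UNIV" using m ft by (rule atomic_integral_abs_summable)
    have "T (f K) = (\<Sum>\<^sub>\<infinity>x. of_real (norm (m {x})) * f K x)"
      using ext[OF ft] by (simp add: atomic_integral_def total_variation_singleton[OF m])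
    \<comment> \<open>Bump and total variation are both nonnegative, so nothing cancels and the
      terms inside \<open>cball 0 (real (N K))\<close> bound the integral from below.\<close>
    also have "\<dots> = (\<Sum>\<^sub>\<infinity>x. of_real (?g x))"
    proof (rule infsum_cong)
      fix x :: 'a
      have "f K x = of_real (norm (f K x))"
        using s[of K] by (simp add: f_def f0_def norm_mult bump_eq_norm[symmetric])
      then show "of_real (norm (m {x})) * f K x = of_real (?g x)" by (metis norm_mult of_real_mult)
    qed
    also have "\<dots> = of_real (\<Sum>\<^sub>\<infinity>x. ?g x)"
      using has_sum_of_real[OF has_sum_infsum[OF g]] by (rule infsumI)
    finally have "norm (T (f K)) = \<bar>\<Sum>\<^sub>\<infinity>x. ?g x\<bar>" by simp
    also have "(\<Sum>\<^sub>\<infinity>x. ?g x) \<ge> (\<Sum>\<^sub>\<infinity>x\<in>cball 0 (real (N K)). (s K * exp (- 2)) * norm (m {x}))"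
    proof (rule infsum_mono_neutral)
      show "(\<lambda>x. (s K * exp (- 2)) * norm (m {x})) summable_on cball 0 (real (N K))"
        by (intro summable_on_cmult_right atomic_measure_abs_summable m cball_bounded_borel)
      fix x :: 'a assume "x \<in> cball 0 (real (N K)) \<inter> UNIV"
      then have "norm (0 + (1 / r K) *\<^sub>R x) \<le> 1 / 2"
        using r[of K] by (simp add: r_def divide_simps)
      from bump_ge[OF this] have "s K * exp (- 2) * norm (m {x}) \<le> s K * norm (f0 K x) * norm (m {x})"
        using s[of K] unfolding f0_def by (intro mult_right_mono mult_left_mono) auto
      then show "(s K * exp (- 2)) * norm (m {x}) \<le> ?g x"
        using s[of K] by (simp add: f_def norm_mult mult_ac)
    qed (use g in auto)
    then have "(s K * exp (- 2)) * atomic_mass m (N K) \<le> (\<Sum>\<^sub>\<infinity>x. ?g x)"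
      by (simp add: infsum_cmult_right' atomic_mass_def)
    moreover have "1 \<le> s K * atomic_mass m (N K)"
    proof -
      have "0 < real (Suc K) * (1 + real (N K)) ^ K" by (simp add: add_pos_nonneg)
      then show ?thesis using N[of K] by (simp add: s_def pos_le_divide_eq)
    qed
    then have "exp (- 2) * 1 \<le> exp (- 2) * (s K * atomic_mass m (N K))" by (rule mult_left_mono) simp
    moreover have "exp (- 2) * (s K * atomic_mass m (N K)) = (s K * exp (- 2)) * atomic_mass m (N K)"
      by (simp only: mult_ac)
    ultimately show ?thesis by linarith
  qed
  moreover have "(\<lambda>K. norm (T (f K))) \<longlonglongrightarrow> 0" using tendsto_norm[OF lim] by simp
  ultimately have "exp (- 2) \<le> (0::real)" by (intro LIMSEQ_le_const) auto
  then show False by simp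
qed

text \<open>Summation by shells \<open>j \<le> norm x < j + 1\<close>: a shell has mass
  \<open>O((j + 1) ^ K)\<close>, so dividing by \<open>(1 + norm x) ^ (K + 2)\<close> leaves
  \<open>D / (j + 1) ^ 2\<close>. The factor \<open>2 ^ K\<close> in \<open>D\<close> comes from
  \<open>1 + (j + 1) \<le> 2 * (j + 1)\<close>.\<close>

lemma atomic_measure_weighted_summable:
  fixes m :: "'a::euclidean_space set \<Rightarrow> complex"
  assumes m: "atomic_measure m" and tv: "temperate_atomic_measure (total_variation m)"
  shows "\<exists>K::nat. (\<lambda>x. norm (m {x}) / (1 + norm x) ^ K) summable_on UNIV"
proof -
  obtain K where K: "\<And>n. atomic_mass m n \<le> real (Suc K) * (1 + real n) ^ K"
    using atomic_mass_polynomial_growth[OF assms] by blast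
  define D where "D = real (Suc K) * 2 ^ K"
  define g where "g x = norm (m {x}) / (1 + norm x) ^ (K + 2)" for x
  define n where "n x = nat \<lfloor>norm x\<rfloor>" for x :: 'a
  have n: "real (n x) \<le> norm x" "norm x \<le> real (n x) + 1" for x
  proof -
    have "real (n x) = of_int \<lfloor>norm x\<rfloor>" by (simp add: n_def)
    then show "real (n x) \<le> norm x" "norm x \<le> real (n x) + 1" by linarith+
  qed
  have sm: "summable (\<lambda>j. D / real (Suc j) ^ 2)"
  proof -
    have "summable (\<lambda>n. 1 / real (Suc n) ^ 2)"
      using inverse_power_summable[of 2, where 'a = real] summable_Suc_iff[of "\<lambda>n. inverse (real n ^ 2)"]
      by (simp add: inverse_eq_divide)
    from summable_mult[OF this, of D] show ?thesis by simp
  qed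
  have D0: "D \<ge> 0" by (simp add: D_def)
  have shell: "(\<Sum>x | x \<in> F \<and> n x = j. g x) \<le> D / real (Suc j) ^ 2" if F: "finite F" for F j
  proof -
    have "(\<Sum>x | x \<in> F \<and> n x = j. g x) \<le> (\<Sum>x | x \<in> F \<and> n x = j. norm (m {x}) / real (Suc j) ^ (K + 2))"
    proof (rule sum_mono)
      fix x assume "x \<in> {x. x \<in> F \<and> n x = j}"
      then have "real (Suc j) \<le> 1 + norm x" using n(1)[of x] by simp
      then show "g x \<le> norm (m {x}) / real (Suc j) ^ (K + 2)"
        unfolding g_def by (intro divide_left_mono power_mono mult_pos_pos zero_less_power) auto
    qed
    also have "\<dots> = (\<Sum>x | x \<in> F \<and> n x = j. norm (m {x})) / real (Suc j) ^ (K + 2)"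
      by (simp add: sum_divide_distrib)
    also have "(\<Sum>x | x \<in> F \<and> n x = j. norm (m {x})) \<le> atomic_mass m (Suc j)"
      unfolding atomic_mass_def
    proof (rule finite_sum_le_infsum)
      show "(\<lambda>x. norm (m {x})) summable_on cball 0 (real (Suc j))"
        by (intro atomic_measure_abs_summable m cball_bounded_borel)
      show "{x. x \<in> F \<and> n x = j} \<subseteq> cball 0 (real (Suc j))" using n(2) by (auto simp: add.commute)
    qed (use F in auto)
    also have "\<dots> \<le> real (Suc K) * (1 + real (Suc j)) ^ K" by (rule K)
    also have "\<dots> \<le> real (Suc K) * (2 * real (Suc j)) ^ K"
      by (intro mult_left_mono power_mono) auto
    finally have "(\<Sum>x | x \<in> F \<and> n x = j. g x) \<le> real (Suc K) * (2 * real (Suc j)) ^ K / real (Suc j) ^ (K + 2)"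
      by (simp add: divide_right_mono)
    also have "\<dots> = D / real (Suc j) ^ 2"
      by (simp add: D_def power_mult_distrib power_add power2_eq_square del: of_nat_Suc)
    finally show ?thesis .
  qed
  have "g summable_on UNIV"
  proof (rule nonneg_bdd_above_summable_on)
    show "bdd_above (sum g ` {F. F \<subseteq> UNIV \<and> finite F})"
    proof (rule bdd_aboveI2)
      fix F assume "F \<in> {F. F \<subseteq> (UNIV::'a set) \<and> finite F}"
      then have F: "finite F" by simp
      have "sum g F = (\<Sum>j\<in>n ` F. \<Sum>x | x \<in> F \<and> n x = j. g x)" by (rule sum.image_gen[OF F])
      also have "\<dots> \<le> (\<Sum>j\<in>n ` F. D / real (Suc j) ^ 2)" by (intro sum_mono shell F)
      also have "\<dots> \<le> (\<Sum>j. D / real (Suc j) ^ 2)" using sm F D0 by (intro sum_le_suminf) auto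
      finally show "sum g F \<le> (\<Sum>j. D / real (Suc j) ^ 2)" .
    qed
  qed (simp add: g_def)
  then show ?thesis unfolding g_def by blast
qed

section \<open>Almost periodicity\<close>

text \<open>Decay of \<open>fourier f\<close> to order \<open>K + 1\<close> leaves one spare power
  \<open>1 + norm x\<close>. It is spent in the limit where the damping factors
  \<open>\<psi> (x / n)\<close> tend to \<open>\<psi> 0\<close>: by the Lipschitz bound their error
  is of order \<open>norm x / n\<close>.\<close>

lemma fourier_series_abs_summable:
  fixes m :: "'a::euclidean_space set \<Rightarrow> complex"
  assumes "(\<lambda>x. norm (m {x}) / (1 + norm x) ^ K) summable_on UNIV" "f \<in> test_functions"
  shows "(\<lambda>x. norm (m {x} * fourier f (- x)) * (1 + norm x)) summable_on UNIV"
proof -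
  obtain C where C: "\<And>y. (1 + norm y) ^ (K + 1) * norm (fourier f y) \<le> C"
    using fourier_decay[OF assms(2)] by blast
  have "(\<lambda>x. C * (norm (m {x}) / (1 + norm x) ^ K)) summable_on UNIV"
    using assms(1) by (rule summable_on_cmult_right)
  then show ?thesis
  proof (rule summable_on_comparison_test)
    fix x :: 'a
    have p: "0 < (1 + norm x) ^ K" by (intro zero_less_power add_pos_nonneg) auto
    have "norm (fourier f (- x)) * (1 + norm x) \<le> C / (1 + norm x) ^ K"
      using C[of "- x"] p by (simp add: pos_le_divide_eq mult_ac)
    then have "norm (m {x}) * (norm (fourier f (- x)) * (1 + norm x)) \<le> norm (m {x}) * (C / (1 + norm x) ^ K)"
      by (rule mult_left_mono) simp
    then show "norm (m {x} * fourier f (- x)) * (1 + norm x) \<le> C * (norm (m {x}) / (1 + norm x) ^ K)"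
      by (simp add: norm_mult mult_ac)
  qed simp
qed

text \<open>The limit of \<open>T\<close> on the averages is computed twice. By continuity it is
  \<open>I * T f\<close>; since the averages are transforms of test functions, it is also the limit
  of series damped by \<open>\<psi> (x / n)\<close>, namely \<open>\<psi> 0\<close> times the
  undamped series. So the constant is \<open>\<psi> 0 / I\<close>, the same for every
  \<open>f\<close>.\<close>

lemma temperate_distribution_fourier_series:
  fixes m :: "'a::euclidean_space set \<Rightarrow> complex"
  assumes m: "atomic_measure m" "temperate_atomic_measure (total_variation m)"
    and T: "temperate_distribution T" "extends_atomic_measure (fourier_distribution T) m"
  shows "\<exists>c. \<forall>f\<in>test_functions. (\<lambda>x. norm (m {x} * fourier f (- x))) summable_on UNIV \<and>
    T f = c * (\<Sum>\<^sub>\<infinity>x. m {x} * fourier f (- x))"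
proof -
  obtain K where K: "(\<lambda>x. norm (m {x}) / (1 + norm x) ^ K) summable_on UNIV"
    using atomic_measure_weighted_summable[OF m] by blast
  obtain \<psi> :: "'a \<Rightarrow> complex" where \<psi>: "\<psi> \<in> test_functions" and I: "(\<integral>y. fourier \<psi> y \<partial>lborel) \<noteq> 0"
    using ex_test_function_fourier_integral_nonzero by blast
  define I where "I = (\<integral>y. fourier \<psi> y \<partial>lborel)"
  obtain L where L: "L \<ge> 0" "\<And>x y. norm (\<psi> x - \<psi> y) \<le> L * norm (x - y)"
    using test_function_lipschitz[OF \<psi>] by blast
  have "(\<lambda>x. norm (m {x} * fourier f (- x))) summable_on UNIV \<and>
    T f = \<psi> 0 / I * (\<Sum>\<^sub>\<infinity>x. m {x} * fourier f (- x))" if f: "f \<in> test_functions" for f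
  proof
    define a where "a x = m {x} * fourier f (- x)" for x
    have wa: "(\<lambda>x. norm (a x) * (1 + norm x)) summable_on UNIV"
      unfolding a_def by (rule fourier_series_abs_summable[OF K f])
    have aa: "(\<lambda>x. norm (a x)) summable_on UNIV"
      using wa by (rule summable_on_comparison_test) (auto simp: mult_le_cancel_left1)
    then show "(\<lambda>x. norm (m {x} * fourier f (- x))) summable_on UNIV" by (simp add: a_def)
    have wa': "(\<lambda>x. norm (a x) * norm x) summable_on UNIV"
      using wa by (rule summable_on_comparison_test) (auto intro!: mult_left_mono)
    let ?F = "\<lambda>n. smear f (\<lambda>v. (1 / real (Suc n)) *\<^sub>R v) (fourier \<psi>)"
    let ?b = "\<lambda>n x. \<psi> ((1 / real (Suc n)) *\<^sub>R x) * a x"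
    have "(\<lambda>n. T (?F n)) \<longlonglongrightarrow> I * T f"
      unfolding I_def using f fourier_weighted_integrable[OF \<psi>] T(1)
      by (rule temperate_distribution_smear_tendsto)
    moreover have TF: "T (?F n) = (\<Sum>\<^sub>\<infinity>x. ?b n x)" and sb: "?b n summable_on UNIV" for n
    proof -
      let ?g = "\<lambda>s. \<psi> ((1 / real (Suc n)) *\<^sub>R s) * fourier f (- s)"
      have "(\<lambda>s. \<psi> (0 + (1 / real (Suc n)) *\<^sub>R s)) \<in> test_functions"
        by (intro test_function_affine \<psi>) simp
      moreover have "smooth_fun (\<lambda>s. fourier f (0 + (- 1) *\<^sub>R s))"
        by (intro smooth_fun_affine fourier_test_function_smooth f)
      ultimately have g: "?g \<in> test_functions"
        using test_function_mult_smooth by force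
      have "T (?F n) = T (fourier ?g)"
        using smear_fourier[OF f \<psi>, of "real (Suc n)"] by simp
      also have "\<dots> = atomic_integral m ?g"
        using T(2) g by (simp add: extends_atomic_measure_def fourier_distribution_def)
      also have "\<dots> = (\<Sum>\<^sub>\<infinity>x. ?b n x)" by (simp add: atomic_integral_def a_def mult_ac)
      finally show "T (?F n) = (\<Sum>\<^sub>\<infinity>x. ?b n x)" .
      have "(\<lambda>x. norm (?b n x)) summable_on UNIV"
        using atomic_integral_abs_summable[OF m(1) g] by (simp add: a_def mult_ac)
      then show "?b n summable_on UNIV" by (rule abs_summable_summable)
    qed
    moreover have "(\<lambda>n. \<Sum>\<^sub>\<infinity>x. ?b n x) \<longlonglongrightarrow> \<psi> 0 * (\<Sum>\<^sub>\<infinity>x. a x)"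
    proof (rule LIM_zero_cancel)
      define A where "A = (\<Sum>\<^sub>\<infinity>x. norm (a x) * norm x)"
      have "norm ((\<Sum>\<^sub>\<infinity>x. ?b n x) - \<psi> 0 * (\<Sum>\<^sub>\<infinity>x. a x)) \<le> L * A * inverse (real (Suc n))" for n
      proof -
        have as: "a summable_on UNIV" using aa by (rule abs_summable_summable)
        have "(\<Sum>\<^sub>\<infinity>x. ?b n x) - \<psi> 0 * (\<Sum>\<^sub>\<infinity>x. a x) = (\<Sum>\<^sub>\<infinity>x. ?b n x) + (\<Sum>\<^sub>\<infinity>x. - \<psi> 0 * a x)"
          unfolding infsum_cmult_right' by simp
        also have "\<dots> = (\<Sum>\<^sub>\<infinity>x. ?b n x + - \<psi> 0 * a x)"
          by (intro infsum_add[symmetric] sb summable_on_cmult_right as)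
        finally have eq: "(\<Sum>\<^sub>\<infinity>x. ?b n x) - \<psi> 0 * (\<Sum>\<^sub>\<infinity>x. a x) = (\<Sum>\<^sub>\<infinity>x. ?b n x + - \<psi> 0 * a x)" .
        have w: "(\<lambda>x. L * inverse (real (Suc n)) * (norm (a x) * norm x)) summable_on UNIV"
          by (intro summable_on_cmult_right wa')
        have le: "norm (?b n x + - \<psi> 0 * a x) \<le> L * inverse (real (Suc n)) * (norm (a x) * norm x)" for x
        proof -
          have "norm (?b n x + - \<psi> 0 * a x) = norm (\<psi> ((1 / real (Suc n)) *\<^sub>R x) - \<psi> 0) * norm (a x)"
            by (simp add: norm_mult[symmetric] algebra_simps)
          also have "\<dots> \<le> (L * (inverse (real (Suc n)) * norm x)) * norm (a x)"
            using L(2)[of "(1 / real (Suc n)) *\<^sub>R x" 0] by (intro mult_right_mono) (auto simp: divide_inverse)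
          finally show ?thesis by (simp only: mult_ac)
        qed
        have s: "(\<lambda>x. norm (?b n x + - \<psi> 0 * a x)) summable_on UNIV"
          using w by (rule summable_on_comparison_test) (use le in auto)
        then have "norm (\<Sum>\<^sub>\<infinity>x. ?b n x + - \<psi> 0 * a x) \<le> (\<Sum>\<^sub>\<infinity>x. norm (?b n x + - \<psi> 0 * a x))"
          by (rule norm_infsum_bound)
        also have "\<dots> \<le> (\<Sum>\<^sub>\<infinity>x. L * inverse (real (Suc n)) * (norm (a x) * norm x))"
          using s w le by (rule infsum_mono)
        also have "\<dots> = L * A * inverse (real (Suc n))"
          by (simp add: infsum_cmult_right' A_def)
        finally show ?thesis unfolding eq .
      qed
      then have "\<forall>\<^sub>F n in sequentially. norm ((\<Sum>\<^sub>\<infinity>x. ?b n x) - \<psi> 0 * (\<Sum>\<^sub>\<infinity>x. a x)) \<le> L * A * inverse (real (Suc n))"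
        by simp
      then show "(\<lambda>n. (\<Sum>\<^sub>\<infinity>x. ?b n x) - \<psi> 0 * (\<Sum>\<^sub>\<infinity>x. a x)) \<longlonglongrightarrow> 0"
        by (rule Lim_null_comparison) (rule tendsto_mult_right_zero[OF LIMSEQ_inverse_real_of_nat])
    qed
    ultimately have "I * T f = \<psi> 0 * (\<Sum>\<^sub>\<infinity>x. a x)"
      using LIMSEQ_unique by simp
    then show "T f = \<psi> 0 / I * (\<Sum>\<^sub>\<infinity>x. m {x} * fourier f (- x))"
      using I by (simp add: a_def I_def field_simps)
  qed
  then show ?thesis by blast
qed

lemma norm_cis_minus_one_le: "norm (cis t - 1) \<le> \<bar>t\<bar>"
  using Taylor_exp[of "\<i> * of_real t" 0] by (simp add: cis_conv_exp norm_mult)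

text \<open>Pigeonhole: colour \<open>z\<close> by the fractional parts of \<open>z \<bullet> \<gamma>\<close> up to \<open>1/n\<close>; the difference of two
  points of the same colour is an almost period.\<close>

lemma common_almost_periods_relatively_dense:
  fixes F :: "'a::euclidean_space set"
  assumes "finite F" "\<delta> > 0"
  shows "\<exists>L. \<forall>z. \<exists>\<tau>. norm (\<tau> - z) \<le> L \<and> (\<forall>\<gamma>\<in>F. norm (cis (2 * pi * (\<tau> \<bullet> \<gamma>)) - 1) \<le> \<delta>)"
proof -
  obtain n :: nat where n: "2 * pi / \<delta> < real n" using reals_Archimedean2 by blast
  have n0: "real n > 0" using n assms(2) by (smt (verit) divide_pos_pos pi_gt_zero)
  define col where "col z = (\<lambda>\<gamma>\<in>F. \<lfloor>real n * frac (z \<bullet> \<gamma>)\<rfloor>)" for z :: 'a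
  have "range col \<subseteq> F \<rightarrow>\<^sub>E {0..int n}"
  proof -
    have "\<lfloor>real n * frac t\<rfloor> \<in> {0..int n}" for t
    proof -
      have "0 \<le> real n * frac t" "real n * frac t \<le> real n * 1"
        using frac_ge_0[of t] less_imp_le[OF frac_lt_1[of t]] by (simp, intro mult_left_mono) auto
      then have "0 \<le> \<lfloor>real n * frac t\<rfloor>" "\<lfloor>real n * frac t\<rfloor> \<le> int n" by (auto simp: floor_le_iff)
      then show ?thesis by simp
    qed
    then show ?thesis by (auto simp: col_def)
  qed
  moreover have "finite (F \<rightarrow>\<^sub>E {0..int n})" using assms(1) by (intro finite_PiE) auto
  ultimately have "finite (range col)" by (rule finite_subset)
  \<comment> \<open>One fixed representative per colour: there are finitely many, \<open>L\<close>
    bounds their norms, and subtracting from \<open>z\<close> the representative of its colour moves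
    \<open>z\<close> by at most \<open>L\<close>.\<close>
  then have "finite (inv col ` range col)" by (rule finite_imageI)
  then obtain L where L: "\<And>s. s \<in> inv col ` range col \<Longrightarrow> norm s \<le> L"
    using finite_imp_bounded bounded_iff by metis
  have "\<exists>\<tau>. norm (\<tau> - z) \<le> L \<and> (\<forall>\<gamma>\<in>F. norm (cis (2 * pi * (\<tau> \<bullet> \<gamma>)) - 1) \<le> \<delta>)" for z
  proof (intro exI[of _ "z - inv col (col z)"] conjI ballI)
    let ?s = "inv col (col z)"
    show "norm (z - ?s - z) \<le> L" using L[of ?s] by simp
    fix \<gamma> assume \<gamma>: "\<gamma> \<in> F"
    have "col ?s = col z" by (rule f_inv_into_f) simp
    then have "\<lfloor>real n * frac (?s \<bullet> \<gamma>)\<rfloor> = \<lfloor>real n * frac (z \<bullet> \<gamma>)\<rfloor>"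
      using \<gamma> by (auto simp: col_def dest: fun_cong[of _ _ \<gamma>])
    then have "\<bar>real n * frac (z \<bullet> \<gamma>) - real n * frac (?s \<bullet> \<gamma>)\<bar> < 1" by linarith
    then have lt: "real n * \<bar>frac (z \<bullet> \<gamma>) - frac (?s \<bullet> \<gamma>)\<bar> < 1"
      using n0 by (simp add: right_diff_distrib[symmetric] abs_mult)
    let ?d = "frac (z \<bullet> \<gamma>) - frac (?s \<bullet> \<gamma>)"
    have "(z - ?s) \<bullet> \<gamma> = ?d + of_int (\<lfloor>z \<bullet> \<gamma>\<rfloor> - \<lfloor>?s \<bullet> \<gamma>\<rfloor>)"
      by (simp add: frac_def inner_diff_left)
    then have "cis (2 * pi * ((z - ?s) \<bullet> \<gamma>)) = cis (2 * pi * ?d) * cis (2 * pi * of_int (\<lfloor>z \<bullet> \<gamma>\<rfloor> - \<lfloor>?s \<bullet> \<gamma>\<rfloor>))"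
      by (simp only: distrib_left cis_mult)
    also have "cis (2 * pi * of_int (\<lfloor>z \<bullet> \<gamma>\<rfloor> - \<lfloor>?s \<bullet> \<gamma>\<rfloor>)) = 1"
      by (rule cis_multiple_2pi) simp
    finally have "norm (cis (2 * pi * ((z - ?s) \<bullet> \<gamma>)) - 1) \<le> 2 * pi * \<bar>?d\<bar>"
      using norm_cis_minus_one_le[of "2 * pi * ?d"] by (simp add: abs_mult)
    also have "\<dots> \<le> 2 * pi * (1 / real n)"
      using lt n0 by (intro mult_left_mono) (auto simp: field_simps)
    also have "\<dots> \<le> \<delta>" using n n0 assms(2) by (simp add: field_simps)
    finally show "norm (cis (2 * pi * ((z - ?s) \<bullet> \<gamma>)) - 1) \<le> \<delta>" .
  qed
  then show ?thesis by blast
qed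

lemma fourier_translate:
  fixes f :: "'a::euclidean_space \<Rightarrow> complex"
  assumes "f \<in> test_functions"
  shows "fourier (\<lambda>t. f (t - \<tau>)) (- y) = cis (2 * pi * (\<tau> \<bullet> y)) * fourier f (- y)"
proof -
  have [measurable]: "f \<in> borel_measurable borel"
    using assms smooth_fun_measurable test_function_smooth by blast
  have "fourier (\<lambda>t. f (t - \<tau>)) (- y) = (\<integral>x. f x * cis (2 * pi * ((\<tau> + x) \<bullet> y)) \<partial>lborel)"
    unfolding fourier_eq by (subst integral_affine[where c = 1 and t = \<tau>]) auto
  also have "\<dots> = (\<integral>x. cis (2 * pi * (\<tau> \<bullet> y)) * (f x * cis (- 2 * pi * (x \<bullet> - y))) \<partial>lborel)"
    by (intro Bochner_Integration.integral_cong refl) (simp add: inner_add_left cis_mult distrib_left)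
  also have "\<dots> = cis (2 * pi * (\<tau> \<bullet> y)) * fourier f (- y)" by (simp add: fourier_eq)
  finally show ?thesis .
qed

text \<open>Translation by \<tau> multiplies the coefficient at frequency \<open>x\<close> by
  \<open>cis (2 * pi * (\<tau> \<bullet> x))\<close>. On a finite set \<open>F\<close> carrying
  almost all of the absolute sum this factor is close to \<open>1\<close>; off \<open>F\<close> its
  distance from \<open>1\<close> is at most \<open>2\<close>, against a small tail.\<close>

lemma atomic_integral_almost_periodic:
  fixes f :: "'a::euclidean_space \<Rightarrow> complex"
  assumes m: "atomic_measure m'" "temperate_atomic_measure (total_variation m')" "has_fourier_measure m m'"
    and f: "f \<in> test_functions" and "\<epsilon> > 0"
  shows "\<exists>F \<delta>. finite F \<and> \<delta> > 0 \<and> (\<forall>\<tau>. (\<forall>\<gamma>\<in>F. norm (cis (2 * pi * (\<tau> \<bullet> \<gamma>)) - 1) \<le> \<delta>) \<longrightarrow>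
    norm (atomic_integral m (\<lambda>t. f (t - \<tau>)) - atomic_integral m f) \<le> \<epsilon>)"
proof -
  obtain T where T: "temperate_distribution T" "extends_atomic_measure T m"
    "extends_atomic_measure (fourier_distribution T) m'"
    using m(3) unfolding has_fourier_measure_def by blast
  obtain c where c: "\<And>f. f \<in> test_functions \<Longrightarrow> (\<lambda>x. norm (m' {x} * fourier f (- x))) summable_on UNIV"
    "\<And>f. f \<in> test_functions \<Longrightarrow> T f = c * (\<Sum>\<^sub>\<infinity>x. m' {x} * fourier f (- x))"
    using temperate_distribution_fourier_series[OF m(1,2) T(1,3)] by blast
  define a where "a x = m' {x} * fourier f (- x)" for x
  have aa: "(\<lambda>x. norm (a x)) summable_on UNIV" using c(1)[OF f] by (simp add: a_def)
  then have as: "a summable_on UNIV" by (rule abs_summable_summable)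
  define A where "A = (\<Sum>\<^sub>\<infinity>x. norm (a x))"
  have A0: "A \<ge> 0" unfolding A_def by (intro infsum_nonneg) auto
  \<comment> \<open>The error is \<open>3 * \<eta>\<close>, one from \<open>F\<close> and two from
    the tail, times \<open>norm c\<close>; adding \<open>1\<close> guards against
    \<open>c = 0\<close>, as adding \<open>1\<close> to \<open>A\<close> does in \<delta>.\<close>
  define \<eta> where "\<eta> = \<epsilon> / (3 * (norm c + 1))"
  have \<eta>0: "\<eta> > 0" using \<open>\<epsilon> > 0\<close> by (simp add: \<eta>_def add_nonneg_pos)
  obtain F where F: "finite F" "dist (\<Sum>x\<in>F. norm (a x)) A \<le> \<eta>"
    using infsum_finite_approximation[OF aa \<eta>0] unfolding A_def by blast
  define \<delta> where "\<delta> = \<eta> / (A + 1)"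
  have \<delta>0: "\<delta> > 0" using \<eta>0 A0 by (simp add: \<delta>_def)
  have "norm (atomic_integral m (\<lambda>t. f (t - \<tau>)) - atomic_integral m f) \<le> \<epsilon>"
    if \<tau>: "\<And>\<gamma>. \<gamma> \<in> F \<Longrightarrow> norm (cis (2 * pi * (\<tau> \<bullet> \<gamma>)) - 1) \<le> \<delta>" for \<tau>
  proof -
    let ?e = "\<lambda>x. cis (2 * pi * (\<tau> \<bullet> x)) - 1"
    let ?f = "\<lambda>t. f (t - \<tau>)"
    have ft: "?f \<in> test_functions"
      using test_function_affine[OF f, of 1 "- \<tau>"] by simp
    have ea: "(\<lambda>x. norm ((?e x + 1) * a x)) summable_on UNIV"
      using c(1)[OF ft] by (simp add: fourier_translate[OF f] a_def mult_ac)
    have "atomic_integral m ?f - atomic_integral m f = T ?f - T f"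
      using T(2) f ft by (simp add: extends_atomic_measure_def)
    also have "\<dots> = c * ((\<Sum>\<^sub>\<infinity>x. (?e x + 1) * a x) + (\<Sum>\<^sub>\<infinity>x. (- 1) * a x))"
      unfolding infsum_cmult_right'
      by (simp add: c(2) f ft fourier_translate[OF f] a_def algebra_simps)
    also have "(\<Sum>\<^sub>\<infinity>x. (?e x + 1) * a x) + (\<Sum>\<^sub>\<infinity>x. (- 1) * a x) = (\<Sum>\<^sub>\<infinity>x. (?e x + 1) * a x + (- 1) * a x)"
      by (intro infsum_add[symmetric] summable_on_cmult_right as abs_summable_summable[OF ea])
    also have "\<dots> = (\<Sum>\<^sub>\<infinity>x. ?e x * a x)" by (simp add: algebra_simps)
    finally have eq: "atomic_integral m ?f - atomic_integral m f = c * (\<Sum>\<^sub>\<infinity>x. ?e x * a x)" .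
    have e2: "norm (?e x) \<le> 2" for x
      using norm_triangle_ineq4[of "cis (2 * pi * (\<tau> \<bullet> x))" 1] by simp
    have s: "(\<lambda>x. norm (?e x * a x)) summable_on UNIV"
      by (rule summable_on_comparison_test[OF summable_on_cmult_right[OF aa, of 2]])
         (auto simp: norm_mult intro!: mult_right_mono e2)
    have "(\<Sum>\<^sub>\<infinity>x\<in>-F. norm (a x)) \<le> \<eta>"
    proof -
      have "(\<Sum>\<^sub>\<infinity>x\<in>F \<union> - F. norm (a x)) = (\<Sum>\<^sub>\<infinity>x\<in>F. norm (a x)) + (\<Sum>\<^sub>\<infinity>x\<in>-F. norm (a x))"
        using F(1) summable_on_subset_banach[OF aa] by (intro infsum_Un_disjoint) auto
      then show ?thesis using F by (simp add: A_def dist_real_def)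
    qed
    moreover have "(\<Sum>\<^sub>\<infinity>x\<in>-F. norm (?e x * a x)) \<le> (\<Sum>\<^sub>\<infinity>x\<in>-F. 2 * norm (a x))"
      using summable_on_subset_banach[OF s] summable_on_subset_banach[OF aa]
      by (intro infsum_mono summable_on_cmult_right) (auto simp: norm_mult intro!: mult_right_mono e2)
    moreover have "(\<Sum>x\<in>F. norm (?e x * a x)) \<le> \<eta>"
    proof -
      have "(\<Sum>x\<in>F. norm (?e x * a x)) \<le> (\<Sum>x\<in>F. \<delta> * norm (a x))"
        unfolding norm_mult by (intro sum_mono mult_right_mono \<tau>) auto
      also have "\<dots> = \<delta> * (\<Sum>x\<in>F. norm (a x))" by (simp add: sum_distrib_left)
      also have "\<dots> \<le> \<delta> * A"
        unfolding A_def using \<delta>0 F(1) aa by (intro mult_left_mono finite_sum_le_infsum) auto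
      also have "\<dots> \<le> \<delta> * (A + 1)" using \<delta>0 by simp
      also have "\<dots> = \<eta>" using A0 by (simp add: \<delta>_def)
      finally show ?thesis .
    qed
    moreover have "(\<Sum>\<^sub>\<infinity>x\<in>F \<union> - F. norm (?e x * a x)) = (\<Sum>\<^sub>\<infinity>x\<in>F. norm (?e x * a x)) + (\<Sum>\<^sub>\<infinity>x\<in>-F. norm (?e x * a x))"
      using F(1) summable_on_subset_banach[OF s] by (intro infsum_Un_disjoint) auto
    ultimately have "(\<Sum>\<^sub>\<infinity>x. norm (?e x * a x)) \<le> 3 * \<eta>"
      using F(1) by (simp add: infsum_cmult_right')
    then have "norm (\<Sum>\<^sub>\<infinity>x. ?e x * a x) \<le> 3 * \<eta>" using norm_infsum_bound[OF s] by linarith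
    then have "norm c * norm (\<Sum>\<^sub>\<infinity>x. ?e x * a x) \<le> (norm c + 1) * (3 * \<eta>)"
      by (intro mult_mono) auto
    also have "\<dots> = \<epsilon>"
    proof -
      have "d * (3 * (\<epsilon> / (3 * d))) = \<epsilon>" if "d \<noteq> 0" for d using that by simp
      moreover have "norm c + 1 \<noteq> 0" using norm_ge_zero[of c] by linarith
      ultimately show ?thesis unfolding \<eta>_def by blast
    qed
    finally show ?thesis unfolding eq norm_mult .
  qed
  then show ?thesis using F(1) \<delta>0 by blast
qed

section \<open>Plateau functions\<close>

text \<open>The indicator of the ball whose radius is midway between \<open>a\<close> and
  \<open>b\<close>, convolved with a bump of radius \<open>d = (b - a) / 2\<close> and divided by
  the integral \<open>J\<close> of that bump: the smoothing reaches inwards exactly to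
  \<open>a\<close> and outwards exactly to \<open>b\<close>.\<close>

lemma ex_plateau_function:
  fixes q :: "'a::euclidean_space"
  assumes "a < b"
  shows "\<exists>f\<in>test_functions. (\<forall>t\<in>ball q a. f t = 1) \<and> (\<forall>t. t \<notin> ball q b \<longrightarrow> f t = 0) \<and> (\<forall>t. norm (f t) \<le> 1)"
proof -
  define d where "d = (b - a) / 2"
  have d: "d > 0" using assms by (simp add: d_def)
  define \<eta> where "\<eta> v = bump (0 + (1 / d) *\<^sub>R (v::'a))" for v
  have \<eta>: "\<eta> \<in> test_functions"
    unfolding \<eta>_def using d by (intro test_function_affine bump_test_function) simp
  then have \<eta>i: "integrable lborel \<eta>" by (rule test_function_integrable)
  have [measurable]: "\<eta> \<in> borel_measurable borel" using \<eta>i by auto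
  have \<eta>0: "\<eta> v = 0" if "d \<le> norm v" for v
    unfolding \<eta>_def using that d by (intro bump_outside) (simp add: pos_le_divide_eq)
  have \<eta>n: "\<eta> v = of_real (norm (\<eta> v))" for v
    unfolding \<eta>_def by (rule bump_eq_norm)
  define J where "J = (\<integral>v. norm (\<eta> v) \<partial>lborel)"
  have IJ: "(\<integral>v. \<eta> v \<partial>lborel) = of_real J"
    unfolding J_def by (subst \<eta>n) simp
  have "J > 0"
    unfolding J_def
  proof (rule continuous_nonneg_integral_pos[of _ 0])
    show "continuous_on UNIV (\<lambda>v. norm (\<eta> v))"
      by (intro continuous_intros smooth_fun_continuous test_function_smooth \<eta>)
    show "integrable lborel (\<lambda>v. norm (\<eta> v))" using \<eta>i by (rule integrable_norm)
    show "0 < norm (\<eta> 0)" by (simp add: \<eta>_def bump_def flat_def)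
  qed simp
  let ?K = "indicator (ball q (a + d)) :: 'a \<Rightarrow> complex"
  define s where "s = smear \<eta> (\<lambda>v. v) ?K"
  have Ki: "integrable lborel ?K" by (rule integrable_indicator_ball)
  have shift: "(\<integral>v. h (y - v) \<partial>lborel) = (\<integral>v. h v \<partial>lborel)"
    if [measurable]: "h \<in> borel_measurable borel" for h :: "'a \<Rightarrow> complex" and y
    using integral_affine[of "- 1" h y] by simp
  have s_test: "s \<in> test_functions"
    unfolding s_def
  proof (rule smear_test_function[OF \<eta> Ki, of "norm q + (a + d)"])
    show "?K v = 0" if "norm q + (a + d) \<le> norm v" for v
      using that norm_triangle_ineq2[of v q] by (auto simp: indicator_def dist_norm norm_minus_commute)
  qed
  have s_1: "s y = of_real J" if y: "y \<in> ball q a" for y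
  proof -
    have "\<eta> (y - v) * ?K v = \<eta> (y - v)" for v
    proof (cases "d \<le> norm (y - v)")
      case False
      then have "v \<in> ball q (a + d)"
        using y dist_triangle[of q v y] by (simp add: dist_norm[of y v])
      then show ?thesis by simp
    qed (simp add: \<eta>0)
    then have "s y = (\<integral>v. \<eta> (y - v) \<partial>lborel)" by (simp only: s_def smear_def)
    then show ?thesis using shift[of \<eta> y] IJ by simp
  qed
  have s_0: "s y = 0" if y: "y \<notin> ball q b" for y
  proof -
    have "\<eta> (y - v) * ?K v = 0" for v
    proof (cases "d \<le> norm (y - v)")
      case False
      then have "v \<notin> ball q (a + d)"
        using y dist_triangle[of q y v] by (auto simp: dist_norm[of v y] norm_minus_commute d_def field_simps)
      then show ?thesis by simp
    qed (simp add: \<eta>0)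
    then show ?thesis by (simp only: s_def smear_def Bochner_Integration.integral_zero)
  qed
  have s_le: "norm (s y) \<le> J" for y
  proof -
    have yi: "integrable lborel (\<lambda>v. \<eta> (y - v))"
      using integrable_affine[of "- 1" \<eta> y] \<eta>i by simp
    have "norm (s y) \<le> (\<integral>v. norm (\<eta> (y - v) * ?K v) \<partial>lborel)"
      unfolding s_def smear_def by (rule integral_norm_bound)
    also have "\<dots> \<le> (\<integral>v. norm (\<eta> (y - v)) \<partial>lborel)"
      by (intro integral_mono integrable_norm smear_integrable[OF \<eta> _ Ki] yi)
         (auto simp: norm_mult indicator_def)
    also have "\<dots> = J"
    proof -
      have "(\<integral>v. of_real (norm (\<eta> (y - v))) \<partial>lborel) = (\<integral>v. of_real (norm (\<eta> v)) \<partial>lborel :: complex)"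
        by (rule shift[of "\<lambda>v. of_real (norm (\<eta> v))"]) measurable
      then show ?thesis by (simp add: J_def)
    qed
    finally show ?thesis .
  qed
  have "(\<lambda>y. s y * of_real (1 / J)) \<in> test_functions"
    by (intro test_function_mult_smooth s_test smooth_fun_const)
  moreover have "norm (s y * of_real (1 / J)) \<le> 1" for y
    using s_le[of y] \<open>J > 0\<close> by (simp add: norm_mult norm_divide)
  moreover have "\<forall>y\<in>ball q a. s y * of_real (1 / J) = 1" using s_1 \<open>J > 0\<close> by simp
  moreover have "\<forall>y. y \<notin> ball q b \<longrightarrow> s y * of_real (1 / J) = 0" using s_0 by simp
  ultimately show ?thesis by (intro bexI[of _ "\<lambda>y. s y * of_real (1 / J)"]) blast+
qed

text \<open>All but \<epsilon> of the absolute mass of \<open>cball q 1\<close> sits on a finite set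
  \<open>F\<close>, and a small enough ball around \<open>q\<close> avoids every point of
  \<open>F\<close> other than \<open>q\<close>. The radius \<open>d\<close> depends on
  \<open>m\<close> and \<epsilon> but not on \<open>f\<close>, so \<open>f\<close> can be chosen
  afterwards.\<close>

lemma atomic_integral_near_point:
  fixes q :: "'a::euclidean_space"
  assumes m: "atomic_measure m" and "\<epsilon> > 0"
  shows "\<exists>d. 0 < d \<and> d \<le> 1 \<and> (\<forall>f\<in>test_functions. f q = 1 \<longrightarrow> (\<forall>t. norm (f t) \<le> 1) \<longrightarrow>
    (\<forall>t. t \<notin> ball q d \<longrightarrow> f t = 0) \<longrightarrow> norm (atomic_integral m f - m {q}) \<le> \<epsilon>)"
proof -
  let ?n = "\<lambda>t. norm (m {t})"
  let ?B = "cball q 1"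
  have sB: "?n summable_on ?B" by (intro atomic_measure_abs_summable m cball_bounded_borel)
  obtain F where F: "finite F" "F \<subseteq> ?B" "dist (sum ?n F) (infsum ?n ?B) \<le> \<epsilon>"
    using infsum_finite_approximation[OF sB \<open>\<epsilon> > 0\<close>] by blast
  obtain d0 where d0: "d0 > 0" "\<And>t. t \<in> F \<Longrightarrow> t \<noteq> q \<Longrightarrow> d0 \<le> dist q t"
    using finite_set_avoid[OF F(1), of q] by blast
  define d where "d = min d0 1"
  have tail: "infsum ?n (?B - F) \<le> \<epsilon>"
  proof -
    have "infsum ?n (F \<union> (?B - F)) = infsum ?n F + infsum ?n (?B - F)"
      using F(1) summable_on_subset_banach[OF sB] by (intro infsum_Un_disjoint) auto
    moreover have "F \<union> (?B - F) = ?B" using F(2) by blast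
    ultimately show ?thesis using F(1,3) by (simp add: dist_real_def)
  qed
  have "norm (atomic_integral m f - m {q}) \<le> \<epsilon>"
    if f: "f \<in> test_functions" "f q = 1" "\<And>t. norm (f t) \<le> 1" "\<And>t. t \<notin> ball q d \<Longrightarrow> f t = 0" for f
  proof -
    let ?g = "\<lambda>t. m {t} * f t"
    have gn: "(\<lambda>t. norm (?g t)) summable_on UNIV" using m f(1) by (rule atomic_integral_abs_summable)
    then have gs: "?g summable_on UNIV" by (rule abs_summable_summable)
    have "infsum ?g ({q} \<union> - {q}) = infsum ?g {q} + infsum ?g (- {q})"
      using summable_on_subset_banach[OF gs] by (intro infsum_Un_disjoint) auto
    then have "atomic_integral m f - m {q} = infsum ?g (- {q})"
      by (simp add: atomic_integral_def f(2))
    also have "norm \<dots> \<le> infsum (\<lambda>t. norm (?g t)) (- {q})"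
      by (rule norm_infsum_bound) (use summable_on_subset_banach[OF gn] in blast)
    also have "\<dots> \<le> infsum ?n (?B - F)"
    proof (rule infsum_mono_neutral)
      show "(\<lambda>t. norm (?g t)) summable_on - {q}" using summable_on_subset_banach[OF gn] by blast
      show "?n summable_on ?B - F" using summable_on_subset_banach[OF sB] by blast
      show "norm (?g t) \<le> ?n t" if "t \<in> - {q} \<inter> (?B - F)" for t
        using mult_left_mono[OF f(3)[of t], of "?n t"] by (simp add: norm_mult)
      show "norm (?g t) \<le> 0" if "t \<in> - {q} - (?B - F)" for t
      proof -
        have "t \<notin> ball q d" using that d0(2)[of t] by (auto simp: d_def)
        then show ?thesis using f(4) by simp
      qed
    qed simp
    also note tail
    finally show ?thesis .
  qed
  moreover have "0 < d" "d \<le> 1" using d0(1) by (auto simp: d_def)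
  ultimately show ?thesis by blast
qed

section \<open>Uniqueness\<close>

text \<open>\<open>Q\<close> holds on a neighbourhood of \<open>0\<close> in the Bohr topology. Such
  neighbourhoods are closed under finite intersection, which provides one almost period for finitely
  many functions and both measures.\<close>

definition almost_periodically :: "('a::euclidean_space \<Rightarrow> bool) \<Rightarrow> bool" where
  "almost_periodically Q \<longleftrightarrow> (\<exists>F \<delta>. finite F \<and> \<delta> > 0 \<and>
    (\<forall>\<tau>. (\<forall>\<gamma>\<in>F. norm (cis (2 * pi * (\<tau> \<bullet> \<gamma>)) - 1) \<le> \<delta>) \<longrightarrow> Q \<tau>))"

lemma almost_periodically_conj:
  assumes "almost_periodically P" "almost_periodically Q"
  shows "almost_periodically (\<lambda>\<tau>. P \<tau> \<and> Q \<tau>)"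
proof -
  obtain F \<delta> F' \<delta>' where "finite F" "\<delta> > 0" "finite F'" "\<delta>' > 0"
    and P: "\<And>\<tau>. \<forall>\<gamma>\<in>F. norm (cis (2 * pi * (\<tau> \<bullet> \<gamma>)) - 1) \<le> \<delta> \<Longrightarrow> P \<tau>"
    and Q: "\<And>\<tau>. \<forall>\<gamma>\<in>F'. norm (cis (2 * pi * (\<tau> \<bullet> \<gamma>)) - 1) \<le> \<delta>' \<Longrightarrow> Q \<tau>"
    using assms unfolding almost_periodically_def by metis
  then show ?thesis
    unfolding almost_periodically_def
    by (intro exI[of _ "F \<union> F'"] exI[of _ "min \<delta> \<delta>'"]) auto
qed

lemma almost_periodically_ball:
  assumes "finite I" "\<And>i. i \<in> I \<Longrightarrow> almost_periodically (Q i)"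
  shows "almost_periodically (\<lambda>\<tau>. \<forall>i\<in>I. Q i \<tau>)"
  using assms
proof (induction I)
  case empty
  show ?case unfolding almost_periodically_def by (intro exI[of _ "{}"] exI[of _ 1]) auto
next
  case (insert i I)
  then show ?case using almost_periodically_conj[of "Q i" "\<lambda>\<tau>. \<forall>i\<in>I. Q i \<tau>"] by simp
qed

lemma almost_periodically_relatively_dense:
  assumes "almost_periodically Q"
  shows "\<exists>L. \<forall>z. \<exists>\<tau>. norm (\<tau> - z) \<le> L \<and> Q \<tau>"
proof -
  obtain F \<delta> where F: "finite F" "\<delta> > 0"
    and Q: "\<And>\<tau>. \<forall>\<gamma>\<in>F. norm (cis (2 * pi * (\<tau> \<bullet> \<gamma>)) - 1) \<le> \<delta> \<Longrightarrow> Q \<tau>"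
    using assms unfolding almost_periodically_def by blast
  obtain L where "\<forall>z. \<exists>\<tau>. norm (\<tau> - z) \<le> L \<and> (\<forall>\<gamma>\<in>F. norm (cis (2 * pi * (\<tau> \<bullet> \<gamma>)) - 1) \<le> \<delta>)"
    using common_almost_periods_relatively_dense[OF F] by blast
  with Q show ?thesis by blast
qed

lemma atomic_restriction_singleton:
  "atomic_restriction m S {t} = (if t \<in> S then m {t} else 0)"
  by (simp add: atomic_restriction_def Int_insert_right)

text \<open>By the dichotomy \<open>dich\<close> the function is constantly \<open>1\<close> or
  constantly \<open>0\<close> on every visible cluster, so cluster masses enter as wholes and their
  variation never appears. The enclosing sets \<open>C n\<close> are kept apart from
  \<open>\<Lambda> n\<close> so that both measures can be treated with the same \<open>C\<close> and
  hence the same index set.\<close>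

lemma atomic_integral_clusters:
  fixes m :: "'a::euclidean_space set \<Rightarrow> complex"
  assumes m: "atomic_measure m"
    and \<Lambda>: "\<And>n. \<Lambda> n \<in> bounded_borel" "disjoint_family \<Lambda>" "\<And>n. \<Lambda> n \<subseteq> C n"
    and sums: "\<And>A. A \<in> bounded_borel \<Longrightarrow>
      (\<lambda>n. atomic_restriction m (\<Lambda> n) A) sums atomic_restriction m E A"
    and "ball y R \<subseteq> E" "b \<le> R" and I: "I = {n. C n \<inter> ball y R \<noteq> {}}" "finite I"
    and dich: "\<And>n. n \<in> I \<Longrightarrow> C n \<subseteq> ball y a \<or> C n \<inter> ball y b = {}"
    and f: "\<And>t. t \<in> ball y a \<Longrightarrow> f t = 1" "\<And>t. t \<notin> ball y b \<Longrightarrow> f t = 0"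
  shows "atomic_integral m f = (\<Sum>n | n \<in> I \<and> C n \<subseteq> ball y a. m (\<Lambda> n))"
proof -
  let ?J = "{n. n \<in> I \<and> C n \<subseteq> ball y a}"
  have J: "finite ?J" using I(2) by simp
  \<comment> \<open>The decomposition of the restriction to \<open>E\<close>, tested on the
    singleton \<open>{t}\<close>, is a series of zeros.\<close>
  have carried: "m {t} = 0" if t: "t \<in> E" "\<And>n. t \<notin> \<Lambda> n" for t
  proof -
    have "(\<lambda>_. 0) sums m {t}"
      using sums[OF singleton_bounded_borel, of t] t by (simp add: atomic_restriction_singleton)
    then show ?thesis using sums_zero sums_unique2 by blast
  qed
  have "atomic_integral m f = (\<Sum>\<^sub>\<infinity>t\<in>(\<Union>n\<in>?J. \<Lambda> n). m {t})"
    unfolding atomic_integral_def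
  proof (rule infsum_cong_neutral)
    fix t assume "t \<in> UNIV - (\<Union>n\<in>?J. \<Lambda> n)"
    then have t: "\<And>n. n \<in> ?J \<Longrightarrow> t \<notin> \<Lambda> n" by blast
    show "m {t} * f t = 0"
    proof (cases "t \<in> ball y b")
      case True
      then have tR: "t \<in> ball y R" using \<open>b \<le> R\<close> by auto
      have "t \<notin> \<Lambda> n" for n
      proof
        assume tn: "t \<in> \<Lambda> n"
        then have tC: "t \<in> C n" using \<Lambda>(3) by blast
        then have "n \<in> I" using tR I(1) by blast
        moreover from this have "C n \<subseteq> ball y a" using dich tC True by blast
        ultimately show False using t tn by blast
      qed
      then show ?thesis using carried tR \<open>ball y R \<subseteq> E\<close> by force
    qed (simp add: f(2))
  next
    fix t assume "t \<in> UNIV \<inter> (\<Union>n\<in>?J. \<Lambda> n)"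
    then have "t \<in> ball y a" using \<Lambda>(3) by blast
    then show "m {t} * f t = m {t}" by (simp add: f(1))
  qed simp
  also have "\<dots> = (\<Sum>n\<in>?J. \<Sum>\<^sub>\<infinity>t\<in>\<Lambda> n. m {t})"
  proof (rule sum_infsum[OF J, symmetric])
    show "(\<lambda>t. m {t}) summable_on \<Lambda> n" for n
      using atomic_measure_has_sum[OF m \<Lambda>(1)] by (rule has_sum_imp_summable)
    show "\<Lambda> i \<inter> \<Lambda> j = {}" if "i \<noteq> j" for i j
      using \<Lambda>(2) that by (auto simp: disjoint_family_on_def)
  qed
  also have "\<dots> = (\<Sum>n\<in>?J. m (\<Lambda> n))"
    using infsumI[OF atomic_measure_has_sum[OF m \<Lambda>(1)]] by simp
  finally show ?thesis .
qed

text \<open>\<open>N\<close> clusters of diameter less than \<open>g\<close> cannot meet \<open>N + 1\<close> annuli at mutual distance \<open>g\<close>.\<close>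

lemma ex_free_annulus:
  fixes y :: "'a::metric_space"
  assumes I: "finite I" "card I \<le> N" and C: "\<And>n. n \<in> I \<Longrightarrow> bounded (C n) \<and> diameter (C n) < g"
    and "g > 0"
  shows "\<exists>i\<le>N. \<forall>n\<in>I. C n \<subseteq> ball y ((2 * real i + 1) * g) \<or> C n \<inter> ball y ((2 * real i + 2) * g) = {}"
proof (rule ccontr)
  assume no: "\<not> ?thesis"
  have close: "dist t t' < g" if "n \<in> I" "t \<in> C n" "t' \<in> C n" for n t t'
    using diameter_bounded_bound[of "C n" t t'] C[OF that(1)] that by auto
  have "\<exists>n\<in>I. \<exists>t\<in>C n. (2 * real i + 1) * g \<le> dist y t \<and> dist y t < (2 * real i + 2) * g" if "i \<le> N" for i
  proof -
    from no that obtain n where n: "n \<in> I" "\<not> C n \<subseteq> ball y ((2 * real i + 1) * g)"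
        "C n \<inter> ball y ((2 * real i + 2) * g) \<noteq> {}" by blast
    then obtain t t' where t: "t \<in> C n" "(2 * real i + 1) * g \<le> dist y t"
        "t' \<in> C n" "dist y t' < (2 * real i + 2) * g"
      by (auto simp: subset_eq not_less)
    show ?thesis
    \<comment> \<open>Either \<open>t\<close> already lies in the annulus, or it is beyond the outer
      radius; then \<open>t'\<close>, which is less than \<open>g\<close> away from it, cannot be
      inside the inner radius.\<close>
    proof (cases "dist y t < (2 * real i + 2) * g")
      case True
      then show ?thesis using n t by blast
    next
      case False
      have "dist y t \<le> dist y t' + dist t' t" by (rule dist_triangle)
      moreover have "dist t' t < g" using close n t by blast
      moreover have "(2 * real i + 2) * g = (2 * real i + 1) * g + g" by (simp add: algebra_simps)
      ultimately have "(2 * real i + 1) * g \<le> dist y t'" using False by linarith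
      then show ?thesis using n t by blast
    qed
  qed
  then obtain n t where nt: "\<And>i. i \<le> N \<Longrightarrow> n i \<in> I" "\<And>i. i \<le> N \<Longrightarrow> t i \<in> C (n i)"
      "\<And>i. i \<le> N \<Longrightarrow> (2 * real i + 1) * g \<le> dist y (t i)"
      "\<And>i. i \<le> N \<Longrightarrow> dist y (t i) < (2 * real i + 2) * g"
    by metis
  have "n i \<noteq> n j" if "i < j" "j \<le> N" for i j
  proof
    assume eq: "n i = n j"
    \<comment> \<open>The gap between different annuli is at least \<open>g\<close>, more than the
      diameter of a cluster, so no cluster meets two annuli.\<close>
    have "(2 * real i + 2) * g + g \<le> (2 * real j + 1) * g"
    proof -
      have "(2 * real i + 3) * g \<le> (2 * real j + 1) * g"
        using that \<open>g > 0\<close> by (intro mult_right_mono) auto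
      then show ?thesis by (simp add: algebra_simps)
    qed
    moreover have "dist (t i) (t j) < g"
    proof (rule close)
      show "n j \<in> I" "t j \<in> C (n j)" using nt(1,2) that by auto
      show "t i \<in> C (n j)" using nt(2)[of i] eq that by simp
    qed
    moreover have "dist y (t j) \<le> dist y (t i) + dist (t i) (t j)" by (rule dist_triangle)
    ultimately show False using nt(3)[of j] nt(4)[of i] that by linarith
  qed
  then have "inj_on n {..N}" by (intro linorder_inj_onI) auto
  then have "card {..N} \<le> card I" using nt(1) I(1) by (intro card_inj_on_le) auto
  then show False using I(2) by simp
qed

text \<open>Side conditions accompany total operations: \<open>x k \<noteq> 0\<close> because a
  quotient by \<open>0\<close> is \<open>0\<close>, finiteness because \<open>card\<close> of an
  infinite set is \<open>0\<close>, boundedness because \<open>diameter\<close> is a supremum that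
  says nothing about unbounded sets. Equality is claimed on \<open>bounded_borel\<close>, where a
  complex Radon measure has its values.\<close>

theorem theorem3:
  fixes \<mu> \<nu> \<mu>hat \<nu>hat :: "'a::euclidean_space set \<Rightarrow> complex"
    and E :: "'a set"
    and \<Lambda> \<Gamma> :: "nat \<Rightarrow> 'a set"
    and x :: "nat \<Rightarrow> 'a"
    and r :: "nat \<Rightarrow> real"
    and N :: nat
  assumes "atomic_measure \<mu>" and "temperate_atomic_measure \<mu>"
    and "atomic_measure \<nu>" and "temperate_atomic_measure \<nu>"
    and "atomic_measure \<mu>hat" and "has_fourier_measure \<mu> \<mu>hat"
    and "atomic_measure \<nu>hat" and "has_fourier_measure \<nu> \<nu>hat"
    and "temperate_atomic_measure (total_variation \<mu>hat)"
    and "temperate_atomic_measure (total_variation \<nu>hat)"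
    and "\<And>n. \<Lambda> n \<in> sets borel" and "\<And>n. \<Lambda> n \<subseteq> E" and "disjoint_family \<Lambda>"
    and "\<And>n. \<Gamma> n \<in> sets borel" and "\<And>n. \<Gamma> n \<subseteq> E" and "disjoint_family \<Gamma>"
    and i: "filterlim r at_top sequentially"
      "\<forall>\<^sub>F k in sequentially. x k \<noteq> 0"
      "(\<lambda>k. r k / norm (x k)) \<longlonglongrightarrow> 0"
      "(\<Union>k. ball (x k) (r k)) \<subseteq> E"
    and ii: "\<And>A. A \<in> bounded_borel \<Longrightarrow>
        (\<lambda>n. atomic_restriction \<mu> (\<Lambda> n) A) sums atomic_restriction \<mu> E A"
      "\<And>A. A \<in> bounded_borel \<Longrightarrow>
        (\<lambda>n. atomic_restriction \<nu> (\<Gamma> n) A) sums atomic_restriction \<nu> E A"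
    and iii: "\<And>y. y \<in> E \<Longrightarrow> finite {n. (\<Lambda> n \<union> \<Gamma> n) \<inter> ball y 1 \<noteq> {}} \<and>
        card {n. (\<Lambda> n \<union> \<Gamma> n) \<inter> ball y 1 \<noteq> {}} \<le> N"
    and iv: "\<And>n. bounded (\<Lambda> n \<union> \<Gamma> n)"
      "(\<lambda>n. diameter (\<Lambda> n \<union> \<Gamma> n)) \<longlonglongrightarrow> 0"
      "(\<lambda>n. \<mu> (\<Lambda> n) - \<nu> (\<Gamma> n)) \<longlonglongrightarrow> 0"
  shows "\<forall>A\<in>bounded_borel. \<mu> A = \<nu> A"
proof -
  have \<Lambda>b: "\<Lambda> n \<in> bounded_borel" and \<Gamma>b: "\<Gamma> n \<in> bounded_borel" for n
    using assms(11)[of n] assms(14)[of n] iv(1)[of n] by (auto simp: bounded_borel_def)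
  let ?C = "\<lambda>n. \<Lambda> n \<union> \<Gamma> n"
  have main: "norm (\<mu> {q} - \<nu> {q}) \<le> (real N + 4) * \<epsilon>" if \<epsilon>: "\<epsilon> > 0" for q \<epsilon>
  proof -
    obtain d1 where d1: "0 < d1" "d1 \<le> 1" "\<And>f. f \<in> test_functions \<Longrightarrow> f q = 1 \<Longrightarrow> (\<And>t. norm (f t) \<le> 1) \<Longrightarrow>
        (\<And>t. t \<notin> ball q d1 \<Longrightarrow> f t = 0) \<Longrightarrow> norm (atomic_integral \<mu> f - \<mu> {q}) \<le> \<epsilon>"
      using atomic_integral_near_point[OF assms(1) \<epsilon>, of q] by blast
    obtain d2 where d2: "0 < d2" "d2 \<le> 1" "\<And>f. f \<in> test_functions \<Longrightarrow> f q = 1 \<Longrightarrow> (\<And>t. norm (f t) \<le> 1) \<Longrightarrow>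
        (\<And>t. t \<notin> ball q d2 \<Longrightarrow> f t = 0) \<Longrightarrow> norm (atomic_integral \<nu> f - \<nu> {q}) \<le> \<epsilon>"
      using atomic_integral_near_point[OF assms(3) \<epsilon>, of q] by blast
    define d where "d = min d1 d2"
    \<comment> \<open>The outermost radius \<open>?b N\<close> equals \<open>d\<close>, so all
      plateau functions of index at most \<open>N\<close> are supported in
      \<open>ball q d\<close>.\<close>
    define g where "g = d / (2 * real N + 2)"
    have g: "g > 0" using d1 d2 by (simp add: g_def d_def)
    let ?a = "\<lambda>i. (2 * real i + 1) * g" and ?b = "\<lambda>i. (2 * real i + 2) * g"
    have b: "?b i \<le> d" if "i \<le> N" for i
    proof -
      have "?b i \<le> (2 * real N + 2) * g" using that g by (intro mult_right_mono) auto
      then show ?thesis by (simp add: g_def)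
    qed
    have "\<exists>f. f \<in> test_functions \<and> (\<forall>t\<in>ball q (?a i). f t = 1) \<and> (\<forall>t. t \<notin> ball q (?b i) \<longrightarrow> f t = 0) \<and> (\<forall>t. norm (f t) \<le> 1)" for i
      using ex_plateau_function[of "?a i" "?b i" q] g by auto
    then obtain \<phi> where \<phi>: "\<And>i. \<phi> i \<in> test_functions" "\<And>i t. t \<in> ball q (?a i) \<Longrightarrow> \<phi> i t = 1"
        "\<And>i t. t \<notin> ball q (?b i) \<Longrightarrow> \<phi> i t = 0" "\<And>i t. norm (\<phi> i t) \<le> 1"
      by metis
    have \<phi>q: "\<phi> i q = 1" for i using g by (intro \<phi>(2)) auto
    let ?close = "\<lambda>m f \<tau>. norm (atomic_integral m (\<lambda>t. f (t - \<tau>)) - atomic_integral m f) \<le> \<epsilon>"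
    have "almost_periodically (\<lambda>\<tau>. \<forall>i\<in>{..N}. ?close \<mu> (\<phi> i) \<tau> \<and> ?close \<nu> (\<phi> i) \<tau>)"
    proof (intro almost_periodically_ball almost_periodically_conj)
      show "almost_periodically (?close \<mu> (\<phi> i))" for i
        unfolding almost_periodically_def
        using atomic_integral_almost_periodic[OF assms(5,9,6) \<phi>(1) \<epsilon>] .
      show "almost_periodically (?close \<nu> (\<phi> i))" for i
        unfolding almost_periodically_def
        using atomic_integral_almost_periodic[OF assms(7,10,8) \<phi>(1) \<epsilon>] .
    qed simp
    from almost_periodically_relatively_dense[OF this] obtain L
      where L: "\<And>z. \<exists>\<tau>. norm (\<tau> - z) \<le> L \<and> (\<forall>i\<in>{..N}. ?close \<mu> (\<phi> i) \<tau> \<and> ?close \<nu> (\<phi> i) \<tau>)"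
      by blast
    have "\<forall>\<^sub>F n in sequentially. diameter (?C n) < g \<and> norm (\<mu> (\<Lambda> n) - \<nu> (\<Gamma> n)) < \<epsilon>"
      using order_tendstoD(2)[OF iv(2) g] order_tendstoD(2)[OF tendsto_norm_zero[OF iv(3)] \<epsilon>]
      by (rule eventually_conj)
    then obtain n0 where n0: "\<And>n. n \<ge> n0 \<Longrightarrow> diameter (?C n) < g"
        "\<And>n. n \<ge> n0 \<Longrightarrow> norm (\<mu> (\<Lambda> n) - \<nu> (\<Gamma> n)) < \<epsilon>"
      by (auto simp: eventually_sequentially)
    \<comment> \<open>The clusters before \<open>n0\<close> need not be small or nearly balanced.
      Being finitely many bounded sets, they are avoided by going far out.\<close>
    have "bounded (\<Union>n<n0. ?C n)" using iv(1) by (intro bounded_UN) auto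
    then obtain B where B: "\<And>n t. n < n0 \<Longrightarrow> t \<in> ?C n \<Longrightarrow> norm t \<le> B"
      unfolding bounded_iff by blast
    \<comment> \<open>The point \<open>y\<close> will lie within \<open>L\<close> of
      \<open>x k\<close>. This margin keeps \<open>ball y 1\<close> inside
      \<open>ball (x k) (r k)\<close> and, as \<open>norm (x k) > r k\<close>, away from all points
      of norm at most \<open>B\<close>.\<close>
    have "\<forall>\<^sub>F k in sequentially. r k > \<bar>B\<bar> + \<bar>L\<bar> + 2"
      using i(1) by (simp add: filterlim_at_top_dense)
    moreover have "\<forall>\<^sub>F k in sequentially. r k / norm (x k) < 1"
      using order_tendstoD(2)[OF i(3)] by simp
    moreover note i(2)
    ultimately have "\<forall>\<^sub>F k in sequentially. r k > \<bar>B\<bar> + \<bar>L\<bar> + 2 \<and> norm (x k) > r k"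
      by eventually_elim (simp add: divide_less_eq)
    then obtain k where k: "r k > \<bar>B\<bar> + \<bar>L\<bar> + 2" "norm (x k) > r k"
      by (auto simp: eventually_sequentially)
    \<comment> \<open>An almost period near \<open>x k - q\<close> carries the plateau functions,
      centred at \<open>q\<close>, to \<open>y = q + \<tau>\<close> near \<open>x k\<close>.\<close>
    obtain \<tau> where \<tau>: "norm (\<tau> - (x k - q)) \<le> L"
        "\<And>i. i \<le> N \<Longrightarrow> ?close \<mu> (\<phi> i) \<tau>" "\<And>i. i \<le> N \<Longrightarrow> ?close \<nu> (\<phi> i) \<tau>"
      using L[of "x k - q"] by auto
    define y where "y = q + \<tau>"
    have yx: "dist (x k) y \<le> L"
      using \<tau>(1) by (simp add: y_def dist_norm norm_minus_commute algebra_simps)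
    have yE: "ball y 1 \<subseteq> E"
    proof
      fix t assume "t \<in> ball y 1"
      then have "t \<in> ball (x k) (r k)" using yx k(1) dist_triangle[of "x k" t y] by simp
      then show "t \<in> E" using i(4) by blast
    qed
    define I where "I = {n. ?C n \<inter> ball y 1 \<noteq> {}}"
    have I: "finite I" "card I \<le> N" using iii[of y] yE by (auto simp: I_def subset_eq)
    have In0: "n \<ge> n0" if n: "n \<in> I" for n
    proof (rule ccontr)
      assume "\<not> n0 \<le> n"
      from n obtain t where "t \<in> ?C n \<inter> ball y 1" unfolding I_def by blast
      then have t: "t \<in> ?C n" "dist y t < 1" by auto
      then have "norm t \<le> B" using B[of n t] \<open>\<not> n0 \<le> n\<close> by simp
      moreover have "norm (x k) \<le> norm t + dist (x k) t"
        using norm_triangle_sub[of "x k" t] by (simp add: dist_norm)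
      moreover have "dist (x k) t \<le> dist (x k) y + dist y t" by (rule dist_triangle)
      ultimately show False using yx t(2) k by linarith
    qed
    \<comment> \<open>\<open>I\<close> depends on \<tau> through \<open>y\<close>, hence
      \<open>j\<close> is found after \<tau>; the estimates for \<tau> hold for every index up to
      \<open>N\<close>.\<close>
    obtain j where j: "j \<le> N" "\<And>n. n \<in> I \<Longrightarrow> ?C n \<subseteq> ball y (?a j) \<or> ?C n \<inter> ball y (?b j) = {}"
      using ex_free_annulus[of I N ?C g y] I iv(1) n0(1) In0 g by blast
    let ?f = "\<lambda>t. \<phi> j (t - \<tau>)"
    have dy: "dist q (t - \<tau>) = dist y t" for t by (simp add: y_def dist_norm algebra_simps)
    have f1: "?f t = 1" if "t \<in> ball y (?a j)" for t
      using that by (intro \<phi>(2)) (simp add: dy)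
    have f0: "?f t = 0" if "t \<notin> ball y (?b j)" for t
      using that by (intro \<phi>(3)) (simp add: dy)
    have bj: "?b j \<le> 1" using b[OF j(1)] d1(2) by (simp add: d_def)
    \<comment> \<open>Defined through the unions \<open>?C n\<close>, this index set is common to
      both measures, so the two sums can be subtracted term by term.\<close>
    let ?J = "{n. n \<in> I \<and> ?C n \<subseteq> ball y (?a j)}"
    have "atomic_integral \<mu> ?f = (\<Sum>n\<in>?J. \<mu> (\<Lambda> n))"
      by (rule atomic_integral_clusters[OF assms(1) \<Lambda>b assms(13) _ ii(1) yE bj I_def I(1) j(2) f1 f0]) auto
    moreover have "atomic_integral \<nu> ?f = (\<Sum>n\<in>?J. \<nu> (\<Gamma> n))"
      by (rule atomic_integral_clusters[OF assms(3) \<Gamma>b assms(16) _ ii(2) yE bj I_def I(1) j(2) f1 f0]) auto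
    ultimately have "atomic_integral \<mu> ?f - atomic_integral \<nu> ?f = (\<Sum>n\<in>?J. \<mu> (\<Lambda> n) - \<nu> (\<Gamma> n))"
      by (simp add: sum_subtractf)
    also have "norm \<dots> \<le> real (card ?J) * \<epsilon>"
      using n0(2) In0 by (intro sum_norm_bound) (auto intro: less_imp_le)
    also have "\<dots> \<le> real N * \<epsilon>"
    proof -
      have "card ?J \<le> card I" using I(1) by (intro card_mono) auto
      then show ?thesis using I(2) \<epsilon> by (intro mult_right_mono) auto
    qed
    finally have 1: "norm (atomic_integral \<mu> ?f - atomic_integral \<nu> ?f) \<le> real N * \<epsilon>" .
    have out: "\<phi> j t = 0" if "t \<notin> ball q d" for t
      using that b[OF j(1)] by (intro \<phi>(3)) auto
    have 2: "norm (atomic_integral \<mu> (\<phi> j) - \<mu> {q}) \<le> \<epsilon>"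
      using out by (intro d1(3) \<phi>(1) \<phi>q \<phi>(4)) (auto simp: d_def)
    have 3: "norm (atomic_integral \<nu> (\<phi> j) - \<nu> {q}) \<le> \<epsilon>"
      using out by (intro d2(3) \<phi>(1) \<phi>q \<phi>(4)) (auto simp: d_def)
    let ?m = "atomic_integral \<mu>" and ?n = "atomic_integral \<nu>"
    have tri: "norm (A - B - C + D + F) \<le> norm A + norm B + norm C + norm D + norm F" for A B C D F :: complex
      by (intro norm_triangle_le order_trans[OF norm_triangle_ineq4] add_mono order_refl)
    have eq: "\<mu> {q} - \<nu> {q} = (?m ?f - ?n ?f) - (?m (\<phi> j) - \<mu> {q}) - (?m ?f - ?m (\<phi> j))
        + (?n (\<phi> j) - \<nu> {q}) + (?n ?f - ?n (\<phi> j))" by simp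
    have "norm (\<mu> {q} - \<nu> {q}) \<le> norm (?m ?f - ?n ?f) + norm (?m (\<phi> j) - \<mu> {q}) + norm (?m ?f - ?m (\<phi> j))
        + norm (?n (\<phi> j) - \<nu> {q}) + norm (?n ?f - ?n (\<phi> j))"
      by (subst eq) (rule tri)
    also have "\<dots> \<le> real N * \<epsilon> + \<epsilon> + \<epsilon> + \<epsilon> + \<epsilon>"
      by (intro add_mono 1 2 3 \<tau> j)
    finally show ?thesis by (simp add: algebra_simps)
  qed
  have small: "norm (\<mu> {q} - \<nu> {q}) \<le> \<epsilon>" if "\<epsilon> > 0" for q \<epsilon>
    using main[of "\<epsilon> / (real N + 4)" q] that by (simp add: add_nonneg_pos)
  have point: "\<mu> {q} = \<nu> {q}" for q
  proof -
    have "norm (\<mu> {q} - \<nu> {q}) \<le> 0" by (rule field_le_epsilon) (use small in simp)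
    then show ?thesis by simp
  qed
  show ?thesis
  proof
    fix A :: "'a set" assume A: "A \<in> bounded_borel"
    show "\<mu> A = \<nu> A"
      using atomic_measure_has_sum[OF assms(1) A] atomic_measure_has_sum[OF assms(3) A]
      unfolding point by (rule has_sum_unique)
  qed
qed

end
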